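(* Let $n\ge2$, $0<m<n-1$, $\gamma>1$, set $\alpha=(n-1)/2$, and let $\psi_0$, $K$ and $T_\lambda$ be as in the context. There is a constant $C$, independent of $\lambda$, such that for all $\lambda\ge2$ $$\|T_\lambda\|\le\begin{cases} C\,\lambda^{-\frac1\gamma(m+1/2)}, & \text{if } m<\gamma\alpha-1/2,\\ C\,\lambda^{-\alpha}\log\lambda, & \text{if } m=\gamma\alpha-1/2,\\ C\,\lambda^{-\alpha}, & \text{if } m>\gamma\alpha-1/2.\end{cases}$$
   Context: Let $\psi_0\in C_0^\infty(\mathbb{R}^n\times\mathbb{R}^{n-1})$ and $K(z)=|z|^{-(n-m-1)}$ for $z\in\mathbb{R}^n\setminus\{0\}$. For $f\in L^2(\mathbb{R}^{n-1})$, $x\in\mathbb{R}^n$ and $\lambda\ge2$ define $$T_\lambda f(x)=\int_{\mathbb{R}^{n-1}}e^{i\lambda|x-(y',0)|^\gamma}\,\psi_0(x,y')\,K(x-(y',0))\,f(y')\,dy'.$$ $\|T_\lambda\|$ denotes the norm of $T_\lambda$ as an operator from $L^2(\mathbb{R}^{n-1})$ to $L^2(\mathbb{R}^n)$. The constant $C$ may depend on $n,m,\gamma,\psi_0$. *)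

theory Defs
  imports "HOL-Analysis.Analysis"
begin

text \<open>
  With \<open>CARD('k) = n - 1\<close>, the space \<open>R^(n-1)\<close> is \<open>real ^ 'k\<close> and \<open>R^n\<close> is
  \<open>(real ^ 'k) \<times> real\<close>, whose norm is the Euclidean one, so that the point \<open>(y', 0)\<close> of
  \<open>R^n\<close> is literally the pair \<open>(y', 0)\<close>.
\<close>

fun C_k :: "nat \<Rightarrow> ('a::euclidean_space \<Rightarrow> 'b::real_normed_vector) \<Rightarrow> bool" where
  "C_k 0 f \<longleftrightarrow> continuous_on UNIV f"
| "C_k (Suc k) f \<longleftrightarrow>
     f differentiable_on UNIV \<and> (\<forall>v. C_k k (\<lambda>x. frechet_derivative f (at x) v))"

definition smooth_compactly_supported ::
    "('a::euclidean_space \<Rightarrow> 'b::real_normed_vector) \<Rightarrow> bool" where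
  "smooth_compactly_supported f \<longleftrightarrow> (\<forall>k. C_k k f) \<and> compact (closure {x. f x \<noteq> 0})"

definition L2 :: "('a::euclidean_space \<Rightarrow> complex) set" where
  "L2 = {f \<in> borel_measurable lebesgue. integrable lebesgue (\<lambda>x. (cmod (f x))\<^sup>2)}"

text \<open>
  The value \<open>\<infinity>\<close> is assigned to every function outside \<open>L2\<close>, non-measurable ones included. Hence
  a finite operator norm below entails that the operator maps \<open>L2\<close> into \<open>L2\<close>.
\<close>

definition L2_norm :: "('a::euclidean_space \<Rightarrow> complex) \<Rightarrow> ennreal" where
  "L2_norm f =
     (if f \<in> L2 then ennreal (sqrt (integral\<^sup>L lebesgue (\<lambda>x. (cmod (f x))\<^sup>2))) else \<infinity>)"

definition L2_operator_norm ::
    "(('a::euclidean_space \<Rightarrow> complex) \<Rightarrow> ('b::euclidean_space \<Rightarrow> complex)) \<Rightarrow> ennreal" where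
  "L2_operator_norm T = (SUP f\<in>{f \<in> L2. L2_norm f \<le> 1}. L2_norm (T f))"

text \<open>Here \<open>DIM('a)\<close> is \<open>n\<close>. The value at \<open>z = 0\<close> is \<open>0\<close> by the convention for \<open>powr\<close>.\<close>

definition K :: "real \<Rightarrow> 'a::euclidean_space \<Rightarrow> real" where
  "K m z = norm z powr (- (real DIM('a) - m - 1))"

text \<open>
  For \<open>f \<in> L2\<close> the integral below converges absolutely at every \<open>x\<close> whose last coordinate is
  nonzero, because the kernel is then bounded with compact support in \<open>y\<close>; so the default value of
  the Bochner integral can only occur on a null set of \<open>x\<close>.
\<close>

definition T_op ::
    "real \<Rightarrow> real \<Rightarrow> (((real ^ 'k) \<times> real) \<times> (real ^ 'k) \<Rightarrow> complex) \<Rightarrow> real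
      \<Rightarrow> (real ^ 'k::finite \<Rightarrow> complex) \<Rightarrow> ((real ^ 'k) \<times> real \<Rightarrow> complex)" where
  "T_op m \<gamma> \<psi>\<^sub>0 lam f x =
     (LINT y|lebesgue.
        exp (\<i> * complex_of_real (lam * norm (x - (y, 0)) powr \<gamma>)) * \<psi>\<^sub>0 (x, y)
          * complex_of_real (K m (x - (y, 0))) * f y)"

end

theory Submission
  imports Defs
begin

text \<open>
  Write \<open>d = n - 1\<close>, \<open>z = x - (y, 0)\<close> and \<open>\<beta> = d - m > 0\<close>, so that the kernel carries the singular
  factor \<open>norm z powr (- \<beta>)\<close>. The operator is split into scales \<open>r\<close>, the parts with
  \<open>r \<le> norm z \<le> 2 * r\<close>. Instead of a dyadic partition of unity a continuous superposition is used:
  for an explicit cutoff \<open>\<eta>\<close> supported in the annulus \<open>1 \<le> norm z \<le> 2\<close>, \<open>norm z powr (- \<beta>)\<close> is a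
  constant times the integral of \<open>\<eta> (z / r) * r powr (- \<beta> - 1)\<close> over \<open>r > 0\<close>. This removes the
  singularity, and \<open>\<eta>\<close> may be a truncated power of a polynomial in \<open>(norm z)\<^sup>2\<close>, since only finitely
  many derivatives of it matter.

  For one scale let \<open>T r\<close> be the operator with the kernel
  \<open>exp (i * lam * norm z powr \<gamma>) * \<psi> (x, y) * \<eta> (z / r)\<close>. The kernel \<open>G (y, y')\<close> of
  \<open>adjoint (T r) \<circ> T r\<close> is an oscillatory integral over \<open>x\<close> in \<open>R^n\<close> whose phase is the difference
  of \<open>lam * norm (x - p) powr \<gamma>\<close> at the two centres \<open>p = (y, 0)\<close> and \<open>p' = (y', 0)\<close>. Since \<open>\<gamma> > 1\<close>,
  the gradient of \<open>norm z powr \<gamma>\<close> is strongly monotone on the annulus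
  (\<open>gradient_norm_powr_monotone\<close>). Hence the derivative of the phase in the direction \<open>p - p'\<close>
  does not vanish on the support of the amplitude, and after rescaling by \<open>r\<close> it is at least
  \<open>lam * r powr (\<gamma> - 1) * norm (y - y')\<close> up to a constant. Integrating by parts \<open>d + 1\<close> times along
  this single direction (\<open>nonstationary_integral_bound\<close>) gives
  \<open>norm (G (y, y')) \<le> C * r ^ n * min 1 ((lam * r powr (\<gamma> - 1) * norm (y - y')) ^ - (d + 1))\<close>, and
  \<open>G\<close> vanishes for \<open>norm (y - y') > 4 * r\<close>. A Schur test (\<open>TstarT_Schur\<close>) then yields
  \<open>norm (T r) \<le> C * r powr (d + 1/2) * min 1 ((lam * r powr \<gamma>) powr (- d / 2))\<close>. The
  \<open>x\<close>-integral includes the last coordinate, which accounts for the gain of \<open>1/2\<close>.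

  Minkowski's integral inequality bounds the norm of the whole operator by the integral over
  \<open>0 < r \<le> S\<close> of \<open>r powr (m - 1/2) * min 1 ((lam * r powr \<gamma>) powr (- \<alpha>))\<close>, where \<open>S\<close> comes from the
  support of \<open>\<psi>\<close>. The two regimes meet at \<open>r = lam powr (- 1 / \<gamma>)\<close>; beyond it the integrand is
  \<open>lam powr (- \<alpha>) * r powr (m - 1/2 - \<gamma> * \<alpha>)\<close>. The sign of \<open>m + 1/2 - \<gamma> * \<alpha>\<close> decides whether that
  crossover point, all scales equally (the logarithm), or the scales of size one dominate
  (\<open>scale_integral_le\<close>), which are the three cases of the theorem.
\<close>

section \<open>Derivatives along a line\<close>

definition has_line_derivative ::
    "('e::real_normed_vector \<Rightarrow> complex) \<Rightarrow> 'e \<Rightarrow> 'e \<Rightarrow> complex \<Rightarrow> bool" where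
  "has_line_derivative f v x D \<longleftrightarrow>
     ((\<lambda>s. f (x + s *\<^sub>R v)) has_vector_derivative D) (at (0::real))"

lemma has_line_derivative_add:
  "has_line_derivative f v x D \<Longrightarrow> has_line_derivative g v x E \<Longrightarrow>
   has_line_derivative (\<lambda>x. f x + g x) v x (D + E)"
  unfolding has_line_derivative_def by (rule has_vector_derivative_add)

lemma has_line_derivative_mult:
  assumes "has_line_derivative f v x D" "has_line_derivative g v x E"
  shows "has_line_derivative (\<lambda>x. f x * g x) v x (D * g x + f x * E)"
  using has_vector_derivative_mult[OF assms[unfolded has_line_derivative_def]]
  unfolding has_line_derivative_def by (simp add: algebra_simps)

lemma has_line_derivative_const: "has_line_derivative (\<lambda>_. c) v x 0"
  unfolding has_line_derivative_def by simp

lemma has_line_derivative_cmult: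
  "has_line_derivative f v x D \<Longrightarrow> has_line_derivative (\<lambda>x. c * f x) v x (c * D)"
  using has_line_derivative_mult[OF has_line_derivative_const] by fastforce

lemma has_line_derivative_cnj:
  "has_line_derivative f v x D \<Longrightarrow> has_line_derivative (\<lambda>x. cnj (f x)) v x (cnj D)"
  unfolding has_line_derivative_def
  by (rule bounded_linear.has_vector_derivative[OF bounded_linear_cnj])

lemma has_line_derivative_of_real:
  "((\<lambda>s. f (x + s *\<^sub>R v)) has_real_derivative D) (at 0) \<Longrightarrow>
   has_line_derivative (\<lambda>x. complex_of_real (f x)) v x (of_real D)"
  unfolding has_line_derivative_def has_real_derivative_iff_has_vector_derivative
  using bounded_linear.has_vector_derivative[OF bounded_linear_of_real] by blast

lemma has_line_derivative_field_chain:
  assumes "has_line_derivative f v x D" "(g has_field_derivative E) (at (f x))"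
  shows "has_line_derivative (\<lambda>x. g (f x)) v x (D * E)"
  using field_vector_diff_chain_at[of "\<lambda>s. f (x + s *\<^sub>R v)" D 0 g E] assms
  unfolding has_line_derivative_def o_def by simp

lemma has_line_derivative_inverse:
  assumes "has_line_derivative f v x D" "f x \<noteq> 0"
  shows "has_line_derivative (\<lambda>x. inverse (f x)) v x (- (D * (inverse (f x) * inverse (f x))))"
proof -
  have "(inverse has_field_derivative - (inverse (f x) ^ Suc (Suc 0))) (at (f x))"
    using DERIV_inverse[OF assms(2)] by simp
  from has_line_derivative_field_chain[OF assms(1) this] show ?thesis by simp
qed

lemma has_line_derivative_exp:
  assumes "((\<lambda>s. \<theta> (x + s *\<^sub>R v)) has_real_derivative D) (at 0)"
  shows "has_line_derivative (\<lambda>x. exp (\<i> * complex_of_real (\<theta> x))) v x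
           (\<i> * of_real D * exp (\<i> * complex_of_real (\<theta> x)))"
  using has_line_derivative_field_chain
    [OF has_line_derivative_cmult[OF has_line_derivative_of_real[OF assms], of \<i>] DERIV_exp]
  by (simp add: mult.commute)

lemma has_line_derivative_unique:
  "has_line_derivative f v x D \<Longrightarrow> has_line_derivative f v x E \<Longrightarrow> D = E"
  unfolding has_line_derivative_def by (rule vector_derivative_unique_at)

lemma has_line_derivative_cong_open:
  assumes "open U" "x \<in> U" "\<And>z. z \<in> U \<Longrightarrow> f z = g z" "has_line_derivative f v x D"
  shows "has_line_derivative g v x D"
proof -
  have "open ((\<lambda>s::real. x + s *\<^sub>R v) -` U)"
    by (intro open_vimage continuous_intros assms(1))
  then show ?thesis
    using assms unfolding has_line_derivative_def
    by (elim has_vector_derivative_transform_within_open) auto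
qed

lemma has_line_derivative_shift:
  assumes "has_line_derivative f v (x + t *\<^sub>R v) D"
  shows "((\<lambda>s. f (x + s *\<^sub>R v)) has_vector_derivative D) (at t)"
proof -
  have *: "((\<lambda>s. f ((x + t *\<^sub>R v) + s *\<^sub>R v)) has_vector_derivative D) (at (0::real))"
    using assms unfolding has_line_derivative_def .
  have "((\<lambda>s::real. s - t) has_vector_derivative 1) (at t)"
    by (auto intro!: derivative_eq_intros)
  from vector_diff_chain_at[OF this, of "\<lambda>s. f ((x + t *\<^sub>R v) + s *\<^sub>R v)" D] *
  show ?thesis by (simp add: o_def algebra_simps)
qed

text \<open>
  The derivative along \<open>v\<close> is a witness \<open>g\<close> that is pinned down only on \<open>S\<close>: the phases and their
  quotients are smooth near the annuli on which the amplitudes live, but in general not at the centres.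
\<close>

primrec dir_bounded ::
    "nat \<Rightarrow> real \<Rightarrow> 'e::real_normed_vector \<Rightarrow> 'e set \<Rightarrow> ('e \<Rightarrow> complex) \<Rightarrow> bool" where
  "dir_bounded 0 C v S f \<longleftrightarrow> (\<forall>x\<in>S. norm (f x) \<le> C)"
| "dir_bounded (Suc k) C v S f \<longleftrightarrow> (\<forall>x\<in>S. norm (f x) \<le> C) \<and>
     (\<exists>g. (\<forall>x\<in>S. has_line_derivative f v x (g x)) \<and> dir_bounded k C v S g)"

lemma dir_bounded_SucI:
  "(\<And>x. x \<in> S \<Longrightarrow> norm (f x) \<le> C) \<Longrightarrow> (\<And>x. x \<in> S \<Longrightarrow> has_line_derivative f v x (g x)) \<Longrightarrow>
   dir_bounded k C v S g \<Longrightarrow> dir_bounded (Suc k) C v S f"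
  by auto

lemma dir_bounded_norm: "dir_bounded k C v S f \<Longrightarrow> x \<in> S \<Longrightarrow> norm (f x) \<le> C"
  by (cases k) auto

lemma dir_bounded_SucD: "dir_bounded (Suc k) C v S f \<Longrightarrow> dir_bounded k C v S f"
  by (induction k arbitrary: f) auto

lemma dir_bounded_mono:
  "dir_bounded k C v S f \<Longrightarrow> C \<le> D \<Longrightarrow> U \<subseteq> S \<Longrightarrow> dir_bounded k D v U f"
proof (induction k arbitrary: f)
  case 0 then show ?case by (auto intro: order_trans)
next
  case (Suc k)
  then obtain g where "\<forall>x\<in>S. has_line_derivative f v x (g x)" "dir_bounded k C v S g" by auto
  with Suc show ?case
    by (intro dir_bounded_SucI[of _ _ _ _ g]) (auto intro: order_trans)
qed

lemma dir_bounded_const: "norm c \<le> C \<Longrightarrow> 0 \<le> C \<Longrightarrow> dir_bounded k C v S (\<lambda>_. c)"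
proof (induction k arbitrary: c)
  case (Suc k)
  then show ?case
    by (intro dir_bounded_SucI[of _ _ _ _ "\<lambda>_. 0"] has_line_derivative_const Suc.IH) auto
qed auto

lemma dir_bounded_add:
  "dir_bounded k C v S f \<Longrightarrow> dir_bounded k D v S g \<Longrightarrow> dir_bounded k (C + D) v S (\<lambda>x. f x + g x)"
proof (induction k arbitrary: f g)
  case 0
  then show ?case by (auto intro!: norm_triangle_le add_mono)
next
  case (Suc k)
  then obtain f' g' where
    "\<forall>x\<in>S. has_line_derivative f v x (f' x)" "dir_bounded k C v S f'"
    "\<forall>x\<in>S. has_line_derivative g v x (g' x)" "dir_bounded k D v S g'" by auto
  moreover have "\<forall>x\<in>S. norm (f x + g x) \<le> C + D"
    using Suc.prems by (auto intro!: norm_triangle_le add_mono)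
  ultimately show ?case
    using Suc.IH[of f' g']
    by (intro dir_bounded_SucI[of _ _ _ _ "\<lambda>x. f' x + g' x"] has_line_derivative_add) auto
qed

lemma dir_bounded_mult:
  "dir_bounded k C v S f \<Longrightarrow> dir_bounded k D v S g \<Longrightarrow> 0 \<le> C \<Longrightarrow> 0 \<le> D \<Longrightarrow>
   dir_bounded k (2 ^ k * C * D) v S (\<lambda>x. f x * g x)"
proof (induction k arbitrary: f g)
  case 0
  then show ?case by (auto simp: norm_mult intro!: mult_mono)
next
  case (Suc k)
  then obtain f' g' where *:
    "\<forall>x\<in>S. has_line_derivative f v x (f' x)" "dir_bounded k C v S f'"
    "\<forall>x\<in>S. has_line_derivative g v x (g' x)" "dir_bounded k D v S g'" by auto
  have "norm (f x * g x) \<le> 2 ^ Suc k * C * D" if "x \<in> S" for x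
  proof -
    have "norm (f x * g x) \<le> C * D"
      using Suc.prems that by (auto simp: norm_mult intro!: mult_mono)
    also have "\<dots> \<le> 2 ^ Suc k * (C * D)"
      using mult_right_mono[of 1 "2 ^ Suc k" "C * D"] Suc.prems(3,4) one_le_power[of "2::real" "Suc k"]
      by simp
    finally show ?thesis by (simp add: algebra_simps)
  qed
  moreover have "dir_bounded k (2 ^ Suc k * C * D) v S (\<lambda>x. f' x * g x + f x * g' x)"
  proof -
    have "dir_bounded k (2 ^ k * C * D + 2 ^ k * C * D) v S (\<lambda>x. f' x * g x + f x * g' x)"
      by (intro dir_bounded_add Suc.IH dir_bounded_SucD[of k C v S f]
            dir_bounded_SucD[of k D v S g] * Suc.prems)
    also have "2 ^ k * C * D + 2 ^ k * C * D = 2 ^ Suc k * C * D" by simp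
    finally show ?thesis .
  qed
  moreover have "\<forall>x\<in>S. has_line_derivative (\<lambda>x. f x * g x) v x (f' x * g x + f x * g' x)"
    using * by (auto intro: has_line_derivative_mult)
  ultimately show ?case
    by (intro dir_bounded_SucI[of _ _ _ _ "\<lambda>x. f' x * g x + f x * g' x"]) auto
qed

lemma dir_bounded_cmult:
  assumes "dir_bounded k C v S f" "0 \<le> C"
  shows "dir_bounded k (2 ^ k * norm c * C) v S (\<lambda>x. c * f x)"
  using dir_bounded_mult[OF dir_bounded_const[of c "norm c"] assms(1)] assms(2) by simp

lemma dir_bounded_uminus:
  "dir_bounded k C v S f \<Longrightarrow> dir_bounded k C v S (\<lambda>x. - f x)"
proof (induction k arbitrary: f)
  case (Suc k)
  then obtain f' where *: "\<forall>x\<in>S. has_line_derivative f v x (f' x)" "dir_bounded k C v S f'" by auto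
  then have "\<forall>x\<in>S. has_line_derivative (\<lambda>x. - f x) v x (- f' x)"
    using has_line_derivative_cmult[of f v _ _ "-1"] by auto
  with Suc * show ?case by (intro dir_bounded_SucI[of _ _ _ _ "\<lambda>x. - f' x"]) auto
qed auto

lemma dir_bounded_cnj:
  "dir_bounded k C v S f \<Longrightarrow> dir_bounded k C v S (\<lambda>x. cnj (f x))"
proof (induction k arbitrary: f)
  case (Suc k)
  then obtain f' where *: "\<forall>x\<in>S. has_line_derivative f v x (f' x)" "dir_bounded k C v S f'" by auto
  with Suc show ?case
    by (intro dir_bounded_SucI[of _ _ _ _ "\<lambda>x. cnj (f' x)"] has_line_derivative_cnj) auto
qed auto

text \<open>
  By the quotient rule \<open>1/f\<close> has the derivative \<open>- f' * (1/f) * (1/f)\<close>, to which the induction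
  hypothesis for \<open>1/f\<close> applies. The constant \<open>D\<close> precedes \<open>v\<close>, \<open>S\<close> and \<open>f\<close> in the quantifier order
  because one constant has to serve for all scales, directions and pairs of centres.
\<close>

lemma dir_bounded_inverse:
  assumes "0 < c" "0 \<le> C"
  obtains D where "0 \<le> D"
    "\<And>(v::'e::real_normed_vector) S f. dir_bounded k C v S f \<Longrightarrow> (\<And>x. x \<in> S \<Longrightarrow> c \<le> norm (f x)) \<Longrightarrow>
       dir_bounded k D v S (\<lambda>x. inverse (f x))"
proof -
  have "\<exists>D\<ge>0. \<forall>(v::'e) S f. dir_bounded k C v S f \<longrightarrow> (\<forall>x\<in>S. c \<le> norm (f x)) \<longrightarrow>
       dir_bounded k D v S (\<lambda>x. inverse (f x))"
  proof (induction k)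
    case 0
    show ?case using assms
      by (intro exI[of _ "inverse c"]) (auto simp: norm_inverse intro!: le_imp_inverse_le)
  next
    case (Suc k)
    then obtain D where D: "D \<ge> 0" "\<And>(v::'e) S f. dir_bounded k C v S f \<Longrightarrow> (\<forall>x\<in>S. c \<le> norm (f x)) \<Longrightarrow>
       dir_bounded k D v S (\<lambda>x. inverse (f x))" by auto
    define D' where "D' = max (inverse c) (2 ^ k * C * (2 ^ k * D * D))"
    have "dir_bounded (Suc k) D' v S (\<lambda>x. inverse (f x))"
      if f: "dir_bounded (Suc k) C v S f" "\<forall>x\<in>S. c \<le> norm (f x)" for v :: 'e and S f
    proof -
      from f obtain f' where *: "\<forall>x\<in>S. has_line_derivative f v x (f' x)" "dir_bounded k C v S f'" by auto
      have i: "dir_bounded k D v S (\<lambda>x. inverse (f x))"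
        by (intro D(2) dir_bounded_SucD[OF f(1)] f(2))
      have "dir_bounded k (2 ^ k * C * (2 ^ k * D * D)) v S
              (\<lambda>x. - (f' x * (inverse (f x) * inverse (f x))))"
        by (intro dir_bounded_uminus dir_bounded_mult * i mult_nonneg_nonneg assms D(1)) simp
      then have "dir_bounded k D' v S (\<lambda>x. - (f' x * (inverse (f x) * inverse (f x))))"
        by (rule dir_bounded_mono) (auto simp: D'_def)
      moreover have "norm (inverse (f x)) \<le> D'" if "x \<in> S" for x
      proof -
        have "norm (inverse (f x)) \<le> inverse c"
          using f that assms by (auto simp: norm_inverse intro!: le_imp_inverse_le)
        then show ?thesis by (simp add: D'_def)
      qed
      moreover have "has_line_derivative (\<lambda>x. inverse (f x)) v x (- (f' x * (inverse (f x) * inverse (f x))))"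
        if "x \<in> S" for x
        using that *(1) f(2) assms(1) by (intro has_line_derivative_inverse) force+
      ultimately show ?thesis by (intro dir_bounded_SucI) auto
    qed
    moreover have "D' \<ge> 0" using assms by (simp add: D'_def le_max_iff_disj)
    ultimately show ?case by blast
  qed
  then show thesis using that by blast
qed

lemma line_derivative_vanishes:
  assumes "closed S" "\<And>x. x \<notin> S \<Longrightarrow> f x = 0" "x \<notin> S"
  shows "has_line_derivative f v x 0"
  by (rule has_line_derivative_cong_open[of "- S" x "\<lambda>_. 0"])
     (use assms has_line_derivative_const in auto)

text \<open>
  Amplitude times reciprocal phase derivative: near a point off the closed set \<open>S\<close> the product is
  constantly zero, whatever \<open>w\<close> is there, and on \<open>S\<close> the Leibniz rule applies.
\<close>

lemma dir_bounded_mult_support: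
  assumes "closed S"
  shows "dir_bounded k C v UNIV b \<Longrightarrow> (\<And>x. x \<notin> S \<Longrightarrow> b x = 0) \<Longrightarrow> dir_bounded k D v S w \<Longrightarrow>
    0 \<le> C \<Longrightarrow> 0 \<le> D \<Longrightarrow> dir_bounded k (2 ^ k * C * D) v UNIV (\<lambda>x. b x * w x)"
proof (induction k arbitrary: b w)
  case 0
  have "norm (b x * w x) \<le> C * D" for x
    using 0 by (cases "x \<in> S") (auto simp: norm_mult intro!: mult_mono)
  then show ?case by auto
next
  case (Suc k)
  then obtain b' w' where *:
    "\<And>x. has_line_derivative b v x (b' x)" "dir_bounded k C v UNIV b'"
    "\<forall>x\<in>S. has_line_derivative w v x (w' x)" "dir_bounded k D v S w'" by auto
  have b': "b' x = 0" if "x \<notin> S" for x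
    using has_line_derivative_unique[OF *(1) line_derivative_vanishes[OF assms Suc.prems(2) that]]
    by auto
  have "norm (b x * w x) \<le> 2 ^ Suc k * C * D" for x
  proof -
    have "norm (b x * w x) \<le> C * D"
      using Suc.prems by (cases "x \<in> S") (auto simp: norm_mult intro!: mult_mono)
    also have "\<dots> \<le> 2 ^ Suc k * (C * D)"
      using mult_right_mono[of 1 "2 ^ Suc k" "C * D"] Suc.prems(4,5) one_le_power[of "2::real" "Suc k"]
      by simp
    finally show ?thesis by (simp add: algebra_simps)
  qed
  moreover have "dir_bounded k (2 ^ Suc k * C * D) v UNIV (\<lambda>x. b' x * w x + b x * w' x)"
  proof -
    have "dir_bounded k (2 ^ k * C * D + 2 ^ k * C * D) v UNIV (\<lambda>x. b' x * w x + b x * w' x)"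
      by (intro dir_bounded_add Suc.IH dir_bounded_SucD[of k C v UNIV b]
            dir_bounded_SucD[of k D v S w] * Suc.prems b')
    also have "2 ^ k * C * D + 2 ^ k * C * D = 2 ^ Suc k * C * D" by simp
    finally show ?thesis .
  qed
  moreover have "has_line_derivative (\<lambda>x. b x * w x) v x (b' x * w x + b x * w' x)" for x
  proof (cases "x \<in> S")
    case True
    then show ?thesis using * by (auto intro: has_line_derivative_mult)
  next
    case False
    then have "has_line_derivative (\<lambda>x. b x * w x) v x 0"
      using Suc.prems(2) by (intro line_derivative_vanishes[OF assms]) auto
    with False show ?thesis using b' Suc.prems(2) by simp
  qed
  ultimately show ?case
    by (intro dir_bounded_SucI[of _ _ _ _ "\<lambda>x. b' x * w x + b x * w' x"]) auto
qed

lemma dir_bounded_SucE: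
  assumes "dir_bounded (Suc k) C v S f"
  obtains g where "\<And>x. x \<in> S \<Longrightarrow> has_line_derivative f v x (g x)" "dir_bounded k C v S g"
  using assms by auto

declare dir_bounded.simps(2) [simp del]

section \<open>Integration by parts along a line\<close>

lemma line_derivative_measurable:
  fixes f :: "'e::euclidean_space \<Rightarrow> complex"
  assumes [measurable]: "f \<in> borel_measurable borel"
    and der: "\<And>x. has_line_derivative f v x (g x)"
  shows "g \<in> borel_measurable borel"
    and "(\<lambda>n. (f (x + inverse (real (Suc n)) *\<^sub>R v) - f x) /\<^sub>R inverse (real (Suc n))) \<longlonglongrightarrow> g x"
proof -
  show lim: "(\<lambda>n. (f (x + inverse (real (Suc n)) *\<^sub>R v) - f x) /\<^sub>R inverse (real (Suc n))) \<longlonglongrightarrow> g x" for x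
  proof -
    have "(\<lambda>h. norm (f (x + h *\<^sub>R v) - f x - h *\<^sub>R g x) / norm h) \<midarrow>0\<rightarrow> 0"
      using der[of x] unfolding has_line_derivative_def has_vector_derivative_def has_derivative_at
      by simp
    moreover have "eventually (\<lambda>h. norm (f (x + h *\<^sub>R v) - f x - h *\<^sub>R g x) / norm h =
        norm ((f (x + h *\<^sub>R v) - f x) /\<^sub>R h - g x)) (at (0::real))"
    proof (rule eventually_at_filter[THEN iffD2, OF always_eventually], intro allI impI)
      fix h :: real assume h: "h \<noteq> 0"
      have "(f (x + h *\<^sub>R v) - f x) /\<^sub>R h - g x = (f (x + h *\<^sub>R v) - f x - h *\<^sub>R g x) /\<^sub>R h"
        using h by (simp add: algebra_simps)
      then show "norm (f (x + h *\<^sub>R v) - f x - h *\<^sub>R g x) / norm h =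
          norm ((f (x + h *\<^sub>R v) - f x) /\<^sub>R h - g x)"
        by (simp add: divide_inverse)
    qed
    ultimately have "(\<lambda>h. norm ((f (x + h *\<^sub>R v) - f x) /\<^sub>R h - g x)) \<midarrow>0\<rightarrow> 0"
      by (rule Lim_transform_eventually)
    then have "(\<lambda>s. (f (x + s *\<^sub>R v) - f x) /\<^sub>R s) \<midarrow>0\<rightarrow> g x"
      by (rule LIM_zero_cancel[OF tendsto_norm_zero_cancel])
    moreover have "filterlim (\<lambda>n. inverse (real (Suc n))) (at 0) sequentially"
      unfolding filterlim_at using LIMSEQ_inverse_real_of_nat by auto
    ultimately show ?thesis
      by (rule filterlim_compose)
  qed
  show "g \<in> borel_measurable borel"
    by (rule borel_measurable_LIMSEQ_metric[OF _ lim]) measurable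
qed


lemma integrable_bounded_support:
  fixes f :: "'e::euclidean_space \<Rightarrow> complex"
  assumes [measurable]: "f \<in> borel_measurable borel"
    and "\<And>x. norm (f x) \<le> B" "bounded S" "\<And>x. x \<notin> S \<Longrightarrow> f x = 0"
  shows "integrable lborel f"
proof -
  obtain R where R: "S \<subseteq> cball 0 R" using bounded_subset_ballD[OF assms(3), of 0] ball_subset_cball by (meson order_trans)
  show ?thesis
  proof (rule Bochner_Integration.integrable_bound)
    show "integrable lborel (\<lambda>x. B * indicator (cball 0 R) x :: real)"
      using emeasure_lborel_cball_finite[of 0 R]
      by (intro integrable_mult_right integrable_real_indicator) auto
    have "norm (f x) \<le> norm (B * indicator (cball 0 R) x :: real)" for x
      using assms(2)[of x] assms(4)[of x] R
      by (cases "x \<in> cball 0 R") (auto simp: subset_iff indicator_def simp del: mem_cball)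
    then show "AE x in lborel. norm (f x) \<le> norm (B * indicator (cball 0 R) x :: real)" by simp
  qed simp
qed

text \<open>
  The difference quotients of \<open>F\<close> along \<open>v\<close> have integral zero by translation invariance of
  Lebesgue measure, and they converge boundedly to \<open>g\<close>. This replaces a change of coordinates and
  Fubini's theorem in the direction \<open>v\<close>.
\<close>

lemma integral_line_derivative_eq_0:
  fixes F :: "'e::euclidean_space \<Rightarrow> complex"
  assumes F [measurable]: "F \<in> borel_measurable borel"
    and der: "\<And>x. has_line_derivative F v x (g x)"
    and g: "\<And>x. norm (g x) \<le> C" and B: "\<And>x. norm (F x) \<le> B"
    and S: "bounded S" "\<And>x. x \<notin> S \<Longrightarrow> F x = 0"
  shows "integral\<^sup>L lborel g = 0"
proof -
  obtain R where R: "S \<subseteq> cball 0 R" using bounded_subset_ballD[OF S(1), of 0] ball_subset_cball by (meson order_trans)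
  define s where "s n = inverse (real (Suc n))" for n
  define q where "q n x = (F (x + s n *\<^sub>R v) - F x) /\<^sub>R s n" for n x
  have s: "0 < s n" "s n \<le> 1" for n by (auto simp: s_def field_simps)
  note [measurable] = line_derivative_measurable(1)[OF F der]
  have [measurable]: "q n \<in> borel_measurable borel" for n unfolding q_def by measurable
  have lim: "(\<lambda>n. q n x) \<longlonglongrightarrow> g x" for x
    using line_derivative_measurable(2)[OF F der] unfolding q_def s_def .
  have q_le: "norm (q n x) \<le> C" for n x
  proof -
    have "((\<lambda>t. F (x + t *\<^sub>R v)) has_vector_derivative g (x + t *\<^sub>R v)) (at t)" for t
      by (rule has_line_derivative_shift[OF der])
    then have "norm (F (x + s n *\<^sub>R v) - F (x + 0 *\<^sub>R v)) \<le> C * norm (s n - 0)"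
      using g s(1)[of n]
      by (intro differentiable_bound[of UNIV "\<lambda>t. F (x + t *\<^sub>R v)" "\<lambda>t h. h *\<^sub>R g (x + t *\<^sub>R v)"])
         (auto simp: has_vector_derivative_def mult.commute[of C] intro!: onorm_bound mult_left_mono
               intro: order_trans[OF norm_ge_zero])
    then have "norm (F (x + s n *\<^sub>R v) - F x) \<le> C * s n" using s(1)[of n] by simp
    moreover have "norm (q n x) = norm (F (x + s n *\<^sub>R v) - F x) / s n"
      using s(1)[of n] by (simp add: q_def divide_inverse mult.commute)
    ultimately show ?thesis using s(1)[of n] by (simp add: pos_divide_le_eq)
  qed
  have q_0: "q n x = 0" if "x \<notin> cball 0 (R + norm v)" for n x
  proof -
    have "norm (s n *\<^sub>R v) \<le> norm v" using s[of n] by (simp add: mult_left_le_one_le)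
    then have "norm x \<le> norm (x + s n *\<^sub>R v) + norm v"
      using norm_triangle_ineq4[of "x + s n *\<^sub>R v" "s n *\<^sub>R v"] by simp
    then have "x + s n *\<^sub>R v \<notin> S" "x \<notin> S" using that R
      by (fastforce, smt (verit, best) R mem_cball_0 norm_ge_zero subsetD that)
    then show ?thesis by (simp add: q_def S(2))
  qed
  define w :: "'e \<Rightarrow> real" where "w x = C * indicator (cball 0 (R + norm v)) x" for x
  have "(\<lambda>n. integral\<^sup>L lborel (q n)) \<longlonglongrightarrow> integral\<^sup>L lborel g"
  proof (rule integral_dominated_convergence[where w = w])
    show "integrable lborel w" unfolding w_def
      using emeasure_lborel_cball_finite[of 0 "R + norm v"]
      by (intro integrable_mult_right integrable_real_indicator) auto
    show "AE x in lborel. norm (q n x) \<le> w x" for n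
      using q_le[of n] q_0[of _ n] by (auto simp: w_def indicator_def simp del: mem_cball)
  qed (use lim in auto)
  moreover have "integral\<^sup>L lborel (q n) = 0" for n
  proof -
    have iF: "integrable lborel F" by (rule integrable_bounded_support[OF F B S])
    have "integral\<^sup>L lborel F = integral\<^sup>L (distr lborel borel ((+) (s n *\<^sub>R v))) F"
      by (simp add: lborel_distr_plus)
    also have "\<dots> = (\<integral>x. F (x + s n *\<^sub>R v) \<partial>lborel)"
      by (subst integral_distr) (auto simp: add.commute)
    finally have eq: "(\<integral>x. F (x + s n *\<^sub>R v) \<partial>lborel) = integral\<^sup>L lborel F" ..
    have "integrable (distr lborel borel ((+) (s n *\<^sub>R v))) F"
      using iF by (simp add: lborel_distr_plus)
    then have "integrable lborel (\<lambda>x. F (x + s n *\<^sub>R v))"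
      by (subst (asm) integrable_distr_eq) (auto simp: add.commute)
    then show ?thesis unfolding q_def using iF eq by simp
  qed
  ultimately show ?thesis using LIMSEQ_unique[OF _ tendsto_const] by auto
qed

lemma norm_integral_le_measure:
  fixes f :: "'e::euclidean_space \<Rightarrow> complex"
  assumes [measurable]: "f \<in> borel_measurable borel" "S \<in> sets borel"
    and "bounded S" "\<And>x. norm (f x) \<le> C" "\<And>x. x \<notin> S \<Longrightarrow> f x = 0"
  shows "norm (integral\<^sup>L lborel f) \<le> C * measure lborel S"
proof -
  have fin: "emeasure lborel S < \<infinity>" using emeasure_bounded_finite[OF assms(3)] .
  have "norm (integral\<^sup>L lborel f) \<le> (\<integral>x. C * indicator S x \<partial>lborel)"
  proof (rule integral_norm_bound[THEN order_trans], rule integral_mono)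
    show "integrable lborel (\<lambda>x. norm (f x))"
      using assms by (intro integrable_norm integrable_bounded_support[of _ C S]) auto
    show "integrable lborel (\<lambda>x. C * indicator S x)"
      using fin by (intro integrable_mult_right integrable_real_indicator) auto
    show "norm (f x) \<le> C * indicator S x" for x
      using assms by (cases "x \<in> S") auto
  qed
  also have "\<dots> = C * measure lborel S" using fin by simp
  finally show ?thesis .
qed

text \<open>
  Since \<open>exp (i * \<theta>)\<close> has the derivative \<open>i * \<Lambda> * q * exp (i * \<theta>)\<close> along \<open>v\<close>, integration by parts
  replaces the amplitude \<open>b\<close> by the derivative of \<open>b / q\<close> and gains a factor \<open>1 / \<Lambda>\<close>. Each step
  costs one order of differentiability, so the induction is on \<open>k\<close>.
\<close>

lemma nonstationary_integral_bound:
  fixes \<theta> q :: "'e::euclidean_space \<Rightarrow> real"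
  assumes S: "closed S" "bounded S"
    and [measurable]: "\<theta> \<in> borel_measurable borel" "q \<in> borel_measurable borel"
    and \<theta>: "\<And>x. x \<in> S \<Longrightarrow> ((\<lambda>s. \<theta> (x + s *\<^sub>R v)) has_real_derivative \<Lambda> * q x) (at 0)"
    and q: "\<And>x. x \<in> S \<Longrightarrow> q x \<noteq> 0"
    and "0 < \<Lambda>" "0 \<le> D"
  shows "b \<in> borel_measurable borel \<Longrightarrow> dir_bounded k C v UNIV b \<Longrightarrow> (\<And>x. x \<notin> S \<Longrightarrow> b x = 0) \<Longrightarrow>
    dir_bounded k D v S (\<lambda>x. inverse (complex_of_real (q x))) \<Longrightarrow> 2 ^ k * D \<le> E \<Longrightarrow> 0 \<le> C \<Longrightarrow>
    norm (\<integral>x. exp (\<i> * complex_of_real (\<theta> x)) * b x \<partial>lborel) \<le> C * (E / \<Lambda>) ^ k * measure lborel S"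
proof (induction k arbitrary: b C)
  case 0
  then have "norm (\<integral>x. exp (\<i> * complex_of_real (\<theta> x)) * b x \<partial>lborel) \<le> C * measure lborel S"
    using S by (intro norm_integral_le_measure) (auto simp: norm_mult)
  then show ?case by simp
next
  case (Suc k)
  note [measurable] = Suc.prems(1)
  define w where "w x = inverse (complex_of_real (q x))" for x
  have [measurable]: "w \<in> borel_measurable borel" unfolding w_def by measurable
  have D: "dir_bounded (Suc k) D v S w" using Suc.prems(4) unfolding w_def .
  have "dir_bounded (Suc k) (2 ^ Suc k * C * D) v UNIV (\<lambda>x. b x * w x)"
    by (rule dir_bounded_mult_support[OF S(1) Suc.prems(2,3) D Suc.prems(6) assms(8)])
  also have "2 ^ Suc k * C * D = C * (2 ^ Suc k * D)" by simp
  finally have bw: "dir_bounded (Suc k) (C * E) v UNIV (\<lambda>x. b x * w x)"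
    by (rule dir_bounded_mono) (use Suc.prems in \<open>auto intro: mult_left_mono\<close>)
  then obtain b' where b': "\<And>x. has_line_derivative (\<lambda>x. b x * w x) v x (b' x)"
    "dir_bounded k (C * E) v UNIV b'"
    using dir_bounded_SucE[of k "C * E" v UNIV] by (metis UNIV_I)
  have [measurable]: "b' \<in> borel_measurable borel"
    by (rule line_derivative_measurable(1)[OF _ b'(1)]) measurable
  have b'0: "b' x = 0" if "x \<notin> S" for x
    using Suc.prems(3) by (intro has_line_derivative_unique[OF b'(1) line_derivative_vanishes[OF S(1) _ that]]) auto
  define u where "u x = exp (\<i> * complex_of_real (\<theta> x))" for x
  have [measurable]: "u \<in> borel_measurable borel" unfolding u_def by measurable
  have u: "norm (u x) = 1" for x by (simp add: u_def)
  have CE: "0 \<le> C * E"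
    using Suc.prems(5,6) assms(8) by (intro mult_nonneg_nonneg) (auto intro: order_trans[rotated])
  have b_le: "norm (b x) \<le> C" and b'_le: "norm (b' x) \<le> C * E" and bw_le: "norm (b x * w x) \<le> C * E" for x
    using dir_bounded_norm[OF Suc.prems(2), of x] dir_bounded_norm[OF b'(2), of x] dir_bounded_norm[OF bw, of x]
    by auto
  have der: "has_line_derivative (\<lambda>x. u x * (b x * w x)) v x (\<i> * \<Lambda> * (u x * b x) + u x * b' x)" for x
  proof (cases "x \<in> S")
    case True
    have "has_line_derivative u v x (\<i> * of_real (\<Lambda> * q x) * u x)"
      unfolding u_def by (rule has_line_derivative_exp[OF \<theta>[OF True]])
    from has_line_derivative_mult[OF this b'(1)]
    have "has_line_derivative (\<lambda>x. u x * (b x * w x)) v x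
      (\<i> * of_real (\<Lambda> * q x) * u x * (b x * w x) + u x * b' x)" .
    moreover have "\<i> * of_real (\<Lambda> * q x) * u x * (b x * w x) = \<i> * \<Lambda> * (u x * b x)"
      using q[OF True] by (simp add: w_def)
    ultimately show ?thesis by (simp only:)
  next
    case False
    then show ?thesis using Suc.prems(3) b'0
      line_derivative_vanishes[OF S(1), of "\<lambda>x. u x * (b x * w x)" x v] by auto
  qed
  \<comment> \<open>The integrand is the derivative of the compactly supported function \<open>u * b / q\<close>.\<close>
  have "(\<integral>x. \<i> * \<Lambda> * (u x * b x) + u x * b' x \<partial>lborel) = 0"
  proof (rule integral_line_derivative_eq_0[OF _ der _ _ S(2)])
    show "norm (\<i> * \<Lambda> * (u x * b x) + u x * b' x) \<le> \<Lambda> * C + C * E" for x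
      using b_le[of x] b'_le[of x] assms(7)
      by (intro norm_triangle_le add_mono) (auto simp: norm_mult u)
    show "norm (u x * (b x * w x)) \<le> C * E" for x using bw_le[of x] by (simp add: norm_mult u)
  qed (use Suc.prems(3) in auto)
  moreover have i1: "integrable lborel (\<lambda>x. u x * b x)"
    using b_le S(2) Suc.prems(3) by (intro integrable_bounded_support[of _ C S]) (auto simp: norm_mult u)
  moreover have i2: "integrable lborel (\<lambda>x. u x * b' x)"
    using b'_le S(2) b'0 by (intro integrable_bounded_support[of _ "C * E" S]) (auto simp: norm_mult u)
  ultimately have "\<i> * \<Lambda> * (\<integral>x. u x * b x \<partial>lborel) = - (\<integral>x. u x * b' x \<partial>lborel)"
    by (simp add: add_eq_0_iff2)
  then have "norm (\<i> * \<Lambda> * (\<integral>x. u x * b x \<partial>lborel)) = norm (\<integral>x. u x * b' x \<partial>lborel)" by simp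
  then have eq: "norm (\<integral>x. u x * b x \<partial>lborel) = norm (\<integral>x. u x * b' x \<partial>lborel) / \<Lambda>"
    using assms(7) by (simp add: norm_mult field_simps)
  have "norm (\<integral>x. u x * b' x \<partial>lborel) \<le> C * E * (E / \<Lambda>) ^ k * measure lborel S"
    unfolding u_def
  proof (rule Suc.IH[OF _ b'(2) b'0])
    show "dir_bounded k D v S (\<lambda>x. inverse (complex_of_real (q x)))"
      using Suc.prems(4) by (rule dir_bounded_SucD)
    have "2 ^ k * D \<le> 2 ^ Suc k * D" using assms(8) by (intro mult_right_mono) auto
    with Suc.prems(5) show "2 ^ k * D \<le> E" by (rule order_trans[rotated])
  qed (use CE in auto)
  with assms(7) show ?case unfolding u_def[symmetric] eq by (simp add: field_simps)
qed

section \<open>Symbols on an annulus\<close>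

definition annulus :: "'e::euclidean_space set" where
  "annulus = {z. 1 \<le> norm z \<and> norm z \<le> 2}"

text \<open>
  Families \<open>F e\<close> indexed by a unit direction \<open>e\<close>, with constants uniform in \<open>e\<close>. The Lipschitz bound
  is required separately from the bounds on derivatives because the annulus is not convex: the
  segment between two of its points may pass through the origin, where powers of \<open>norm z\<close> are in general singular.
\<close>

definition bounded_lipschitz :: "('e::euclidean_space \<Rightarrow> 'e \<Rightarrow> real) \<Rightarrow> bool" where
  "bounded_lipschitz F \<longleftrightarrow> (\<exists>C\<ge>0. \<forall>e z w. norm e = 1 \<longrightarrow> z \<in> annulus \<longrightarrow> w \<in> annulus \<longrightarrow>
     \<bar>F e z\<bar> \<le> C \<and> \<bar>F e z - F e w\<bar> \<le> C * norm (z - w))"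

primrec symbol :: "nat \<Rightarrow> ('e::euclidean_space \<Rightarrow> 'e \<Rightarrow> real) \<Rightarrow> bool" where
  "symbol 0 F \<longleftrightarrow> bounded_lipschitz F"
| "symbol (Suc k) F \<longleftrightarrow> bounded_lipschitz F \<and>
     (\<exists>F'. (\<forall>e z. norm e = 1 \<longrightarrow> z \<in> annulus \<longrightarrow>
        ((\<lambda>s. F e (z + s *\<^sub>R e)) has_real_derivative F' e z) (at 0)) \<and> symbol k F')"

lemma bounded_lipschitzI:
  assumes "\<And>e z. norm e = 1 \<Longrightarrow> z \<in> annulus \<Longrightarrow> \<bar>F e z\<bar> \<le> C"
    and "\<And>e z w. norm e = 1 \<Longrightarrow> z \<in> annulus \<Longrightarrow> w \<in> annulus \<Longrightarrow> \<bar>F e z - F e w\<bar> \<le> D * norm (z - w)"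
  shows "bounded_lipschitz F"
  unfolding bounded_lipschitz_def
proof (intro exI[of _ "max 0 (max C D)"] conjI allI impI)
  fix e z w :: 'a assume *: "norm e = 1" "z \<in> annulus" "w \<in> annulus"
  show "\<bar>F e z\<bar> \<le> max 0 (max C D)" using assms(1)[OF *(1,2)] by simp
  have "D * norm (z - w) \<le> max 0 (max C D) * norm (z - w)" by (intro mult_right_mono) auto
  with assms(2)[OF *] show "\<bar>F e z - F e w\<bar> \<le> max 0 (max C D) * norm (z - w)" by simp
qed simp

lemma bounded_lipschitzE:
  assumes "bounded_lipschitz F"
  obtains C where "0 \<le> C" "\<And>e z. norm e = 1 \<Longrightarrow> z \<in> annulus \<Longrightarrow> \<bar>F e z\<bar> \<le> C"
    "\<And>e z w. norm e = 1 \<Longrightarrow> z \<in> annulus \<Longrightarrow> w \<in> annulus \<Longrightarrow> \<bar>F e z - F e w\<bar> \<le> C * norm (z - w)"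
  using assms unfolding bounded_lipschitz_def by metis

lemma bounded_lipschitz_const: "bounded_lipschitz (\<lambda>_ _. c)"
  by (rule bounded_lipschitzI[of _ "\<bar>c\<bar>" 0]) auto

lemma bounded_lipschitz_add:
  assumes "bounded_lipschitz F" "bounded_lipschitz G"
  shows "bounded_lipschitz (\<lambda>e z. F e z + G e z)"
proof -
  obtain C where C: "0 \<le> C" "\<And>e z. norm e = 1 \<Longrightarrow> z \<in> annulus \<Longrightarrow> \<bar>F e z\<bar> \<le> C"
    "\<And>e z w. norm e = 1 \<Longrightarrow> z \<in> annulus \<Longrightarrow> w \<in> annulus \<Longrightarrow> \<bar>F e z - F e w\<bar> \<le> C * norm (z - w)"
    using bounded_lipschitzE[OF assms(1)] by metis
  obtain D where D: "0 \<le> D" "\<And>e z. norm e = 1 \<Longrightarrow> z \<in> annulus \<Longrightarrow> \<bar>G e z\<bar> \<le> D"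
    "\<And>e z w. norm e = 1 \<Longrightarrow> z \<in> annulus \<Longrightarrow> w \<in> annulus \<Longrightarrow> \<bar>G e z - G e w\<bar> \<le> D * norm (z - w)"
    using bounded_lipschitzE[OF assms(2)] by metis
  show ?thesis
  proof (rule bounded_lipschitzI[of _ "C + D" "C + D"])
    fix e z :: 'a assume "norm e = 1" "z \<in> annulus"
    then show "\<bar>F e z + G e z\<bar> \<le> C + D" using C(2)[of e z] D(2)[of e z] by linarith
  next
    fix e z w :: 'a assume "norm e = 1" "z \<in> annulus" "w \<in> annulus"
    then show "\<bar>F e z + G e z - (F e w + G e w)\<bar> \<le> (C + D) * norm (z - w)"
      using C(3)[of e z w] D(3)[of e z w] by (simp add: distrib_right)
  qed
qed

lemma bounded_lipschitz_mult:
  assumes "bounded_lipschitz F" "bounded_lipschitz G"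
  shows "bounded_lipschitz (\<lambda>e z. F e z * G e z)"
proof -
  obtain C where C: "0 \<le> C" "\<And>e z. norm e = 1 \<Longrightarrow> z \<in> annulus \<Longrightarrow> \<bar>F e z\<bar> \<le> C"
    "\<And>e z w. norm e = 1 \<Longrightarrow> z \<in> annulus \<Longrightarrow> w \<in> annulus \<Longrightarrow> \<bar>F e z - F e w\<bar> \<le> C * norm (z - w)"
    using bounded_lipschitzE[OF assms(1)] by metis
  obtain D where D: "0 \<le> D" "\<And>e z. norm e = 1 \<Longrightarrow> z \<in> annulus \<Longrightarrow> \<bar>G e z\<bar> \<le> D"
    "\<And>e z w. norm e = 1 \<Longrightarrow> z \<in> annulus \<Longrightarrow> w \<in> annulus \<Longrightarrow> \<bar>G e z - G e w\<bar> \<le> D * norm (z - w)"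
    using bounded_lipschitzE[OF assms(2)] by metis
  show ?thesis
  proof (rule bounded_lipschitzI[of _ "C * D" "2 * C * D"])
    fix e z :: 'a assume "norm e = 1" "z \<in> annulus"
    then show "\<bar>F e z * G e z\<bar> \<le> C * D"
      using C(1) C(2)[of e z] D(2)[of e z] by (auto simp: abs_mult intro!: mult_mono)
  next
    fix e z w :: 'a assume *: "norm e = 1" "z \<in> annulus" "w \<in> annulus"
    have "F e z * G e z - F e w * G e w = F e z * (G e z - G e w) + (F e z - F e w) * G e w"
      by (simp add: algebra_simps)
    also have "\<bar>\<dots>\<bar> \<le> \<bar>F e z\<bar> * \<bar>G e z - G e w\<bar> + \<bar>F e z - F e w\<bar> * \<bar>G e w\<bar>"
      by (metis abs_mult abs_triangle_ineq)
    also have "\<dots> \<le> C * (D * norm (z - w)) + (C * norm (z - w)) * D"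
      using * C D by (intro add_mono mult_mono) auto
    finally show "\<bar>F e z * G e z - F e w * G e w\<bar> \<le> 2 * C * D * norm (z - w)"
      by (simp add: algebra_simps)
  qed
qed

lemma symbol_bounded_lipschitz: "symbol k F \<Longrightarrow> bounded_lipschitz F"
  by (cases k) auto

lemma symbol_SucI:
  "bounded_lipschitz F \<Longrightarrow>
   (\<And>e z. norm e = 1 \<Longrightarrow> z \<in> annulus \<Longrightarrow> ((\<lambda>s. F e (z + s *\<^sub>R e)) has_real_derivative F' e z) (at 0)) \<Longrightarrow>
   symbol k F' \<Longrightarrow> symbol (Suc k) F"
  by auto

lemma symbol_SucE:
  assumes "symbol (Suc k) F"
  obtains F' where
    "\<And>e z. norm e = 1 \<Longrightarrow> z \<in> annulus \<Longrightarrow> ((\<lambda>s. F e (z + s *\<^sub>R e)) has_real_derivative F' e z) (at 0)"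
    "symbol k F'"
  using assms by auto

lemma symbol_SucD: "symbol (Suc k) F \<Longrightarrow> symbol k F"
  by (induction k arbitrary: F) auto

declare symbol.simps(2) [simp del]

lemma symbol_const: "symbol k (\<lambda>_ _. c)"
proof (induction k arbitrary: c)
  case (Suc k)
  show ?case
    by (rule symbol_SucI[OF bounded_lipschitz_const _ Suc.IH[of 0]]) auto
qed (simp add: bounded_lipschitz_const)

lemma symbol_add: "symbol k F \<Longrightarrow> symbol k G \<Longrightarrow> symbol k (\<lambda>e z. F e z + G e z)"
proof (induction k arbitrary: F G)
  case (Suc k)
  obtain F' where F': "\<And>e z. norm e = 1 \<Longrightarrow> z \<in> annulus \<Longrightarrow>
      ((\<lambda>s. F e (z + s *\<^sub>R e)) has_real_derivative F' e z) (at 0)" "symbol k F'"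
    using symbol_SucE[OF Suc.prems(1)] by metis
  obtain G' where G': "\<And>e z. norm e = 1 \<Longrightarrow> z \<in> annulus \<Longrightarrow>
      ((\<lambda>s. G e (z + s *\<^sub>R e)) has_real_derivative G' e z) (at 0)" "symbol k G'"
    using symbol_SucE[OF Suc.prems(2)] by metis
  show ?case
    by (rule symbol_SucI[of _ "\<lambda>e z. F' e z + G' e z"])
       (intro bounded_lipschitz_add symbol_bounded_lipschitz[OF Suc.prems(1)]
         symbol_bounded_lipschitz[OF Suc.prems(2)] DERIV_add F' G' Suc.IH; assumption)+
qed (simp add: bounded_lipschitz_add)

lemma symbol_mult: "symbol k F \<Longrightarrow> symbol k G \<Longrightarrow> symbol k (\<lambda>e z. F e z * G e z)"
proof (induction k arbitrary: F G)
  case (Suc k)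
  obtain F' where F': "\<And>e z. norm e = 1 \<Longrightarrow> z \<in> annulus \<Longrightarrow>
      ((\<lambda>s. F e (z + s *\<^sub>R e)) has_real_derivative F' e z) (at 0)" "symbol k F'"
    using symbol_SucE[OF Suc.prems(1)] by metis
  obtain G' where G': "\<And>e z. norm e = 1 \<Longrightarrow> z \<in> annulus \<Longrightarrow>
      ((\<lambda>s. G e (z + s *\<^sub>R e)) has_real_derivative G' e z) (at 0)" "symbol k G'"
    using symbol_SucE[OF Suc.prems(2)] by metis
  show ?case
  proof (rule symbol_SucI[of _ "\<lambda>e z. F' e z * G e z + G' e z * F e z"])
    show "symbol k (\<lambda>e z. F' e z * G e z + G' e z * F e z)"
      by (intro symbol_add Suc.IH F'(2) G'(2) symbol_SucD[OF Suc.prems(1)] symbol_SucD[OF Suc.prems(2)])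
    show "((\<lambda>s. F e (z + s *\<^sub>R e) * G e (z + s *\<^sub>R e)) has_real_derivative
        F' e z * G e z + G' e z * F e z) (at 0)" if "norm e = 1" "z \<in> annulus" for e z
      using DERIV_mult[OF F'(1)[OF that] G'(1)[OF that]] by simp
  qed (intro bounded_lipschitz_mult symbol_bounded_lipschitz[OF Suc.prems(1)]
         symbol_bounded_lipschitz[OF Suc.prems(2)])
qed (simp add: bounded_lipschitz_mult)

lemma symbol_inner: "symbol k (\<lambda>(e::'e::euclidean_space) z. z \<bullet> e)"
proof -
  have b: "bounded_lipschitz (\<lambda>(e::'e) z. z \<bullet> e)"
  proof (rule bounded_lipschitzI[of _ 2 1])
    fix e z w :: 'e assume *: "norm e = 1"
    show "\<bar>z \<bullet> e\<bar> \<le> 2" if "z \<in> annulus"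
      using Cauchy_Schwarz_ineq2[of z e] * that by (simp add: annulus_def)
    show "\<bar>z \<bullet> e - w \<bullet> e\<bar> \<le> 1 * norm (z - w)"
      using Cauchy_Schwarz_ineq2[of "z - w" e] * by (simp add: inner_diff_left)
  qed
  show ?thesis
  proof (cases k)
    case (Suc j)
    have "((\<lambda>s. (z + s *\<^sub>R e) \<bullet> e) has_real_derivative 1) (at 0)" if "norm e = 1" for e z :: 'e
    proof -
      have "e \<bullet> e = 1" using that by (simp add: dot_square_norm)
      then show ?thesis by (auto simp: inner_add_left intro!: derivative_eq_intros)
    qed
    then show ?thesis unfolding Suc by (intro symbol_SucI[OF b _ symbol_const[of _ 1]])
  qed (use b in simp)
qed

lemma powr_lipschitz_1_2:
  fixes a b \<beta> :: real
  assumes "1 \<le> a" "a \<le> 2" "1 \<le> b" "b \<le> 2"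
  shows "\<bar>a powr \<beta> - b powr \<beta>\<bar> \<le> \<bar>\<beta>\<bar> * 2 powr \<bar>\<beta> - 1\<bar> * \<bar>a - b\<bar>"
proof -
  have "norm (a powr \<beta> - b powr \<beta>) \<le> \<bar>\<beta>\<bar> * 2 powr \<bar>\<beta> - 1\<bar> * norm (a - b)"
  proof (rule field_differentiable_bound[of "{1..2}" _ "\<lambda>t. \<beta> * t powr (\<beta> - 1)"])
    fix t :: real assume t: "t \<in> {1..2}"
    then show "((\<lambda>t. t powr \<beta>) has_field_derivative \<beta> * t powr (\<beta> - 1)) (at t within {1..2})"
      by (auto intro!: derivative_eq_intros)
    have "t powr (\<beta> - 1) \<le> t powr \<bar>\<beta> - 1\<bar>" using t by (intro powr_mono) auto
    also have "\<dots> \<le> 2 powr \<bar>\<beta> - 1\<bar>" using t by (intro powr_mono2) auto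
    finally show "norm (\<beta> * t powr (\<beta> - 1)) \<le> \<bar>\<beta>\<bar> * 2 powr \<bar>\<beta> - 1\<bar>"
      by (auto simp: abs_mult intro!: mult_left_mono)
  qed (use assms in auto)
  then show ?thesis by simp
qed

lemma DERIV_norm_powr_line:
  fixes z e :: "'e::euclidean_space"
  assumes "z \<noteq> 0"
  shows "((\<lambda>s. norm (z + s *\<^sub>R e) powr \<beta>) has_real_derivative \<beta> * norm z powr (\<beta> - 2) * (z \<bullet> e)) (at 0)"
proof -
  have eq: "norm y powr \<beta> = (y \<bullet> y) powr (\<beta> / 2)" for y :: 'e and \<beta>
  proof (cases "y = 0")
    case False
    have "(y \<bullet> y) powr (\<beta> / 2) = (norm y powr 2) powr (\<beta> / 2)"
      using False by (simp add: dot_square_norm powr_numeral)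
    also have "\<dots> = norm y powr \<beta>" by (simp only: powr_powr) simp
    finally show ?thesis ..
  qed simp
  have "0 < z \<bullet> z" using assms by simp
  then have "((\<lambda>s. ((z + s *\<^sub>R e) \<bullet> (z + s *\<^sub>R e)) powr (\<beta> / 2)) has_real_derivative
      \<beta> / 2 * (z \<bullet> z) powr (\<beta> / 2 - 1) * (2 * (z \<bullet> e))) (at 0)"
    by (auto simp: inner_add_left inner_add_right inner_commute algebra_simps intro!: derivative_eq_intros)
  moreover have "(z \<bullet> z) powr (\<beta> / 2 - 1) = norm z powr (\<beta> - 2)"
    by (subst eq) (simp add: diff_divide_distrib)
  ultimately show ?thesis unfolding eq[of _ \<beta>] by (simp add: algebra_simps)
qed

lemma annulus_nonzero: "z \<in> annulus \<Longrightarrow> z \<noteq> 0"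
  by (auto simp: annulus_def)

text \<open>
  The derivative along \<open>e\<close> is \<open>\<beta> * norm z powr (\<beta> - 2) * (z \<bullet> e)\<close>, so that powers of the norm and
  the linear function \<open>z \<bullet> e\<close> together are closed under differentiation. The Lipschitz bound comes
  from the one-dimensional mean value theorem applied to \<open>norm z\<close> in \<open>[1, 2]\<close>.
\<close>

lemma symbol_norm_powr: "symbol k (\<lambda>(e::'e::euclidean_space) z. norm z powr \<beta>)"
proof (induction k arbitrary: \<beta>)
  case 0
  have "bounded_lipschitz (\<lambda>(e::'e) z. norm z powr \<beta>)"
  proof (rule bounded_lipschitzI[of _ "2 powr \<bar>\<beta>\<bar>" "\<bar>\<beta>\<bar> * 2 powr \<bar>\<beta> - 1\<bar>"])
    fix e z w :: 'e
    assume z: "z \<in> annulus"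
    have "norm z powr \<beta> \<le> norm z powr \<bar>\<beta>\<bar>" using z by (intro powr_mono) (auto simp: annulus_def)
    also have "\<dots> \<le> 2 powr \<bar>\<beta>\<bar>" using z by (intro powr_mono2) (auto simp: annulus_def)
    finally show "\<bar>norm z powr \<beta>\<bar> \<le> 2 powr \<bar>\<beta>\<bar>" by simp
    assume w: "w \<in> annulus"
    have "\<bar>norm z powr \<beta> - norm w powr \<beta>\<bar> \<le> \<bar>\<beta>\<bar> * 2 powr \<bar>\<beta> - 1\<bar> * \<bar>norm z - norm w\<bar>"
      using z w by (intro powr_lipschitz_1_2) (auto simp: annulus_def)
    also have "\<dots> \<le> \<bar>\<beta>\<bar> * 2 powr \<bar>\<beta> - 1\<bar> * norm (z - w)"
      by (intro mult_left_mono norm_triangle_ineq3) auto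
    finally show "\<bar>norm z powr \<beta> - norm w powr \<beta>\<bar> \<le> \<bar>\<beta>\<bar> * 2 powr \<bar>\<beta> - 1\<bar> * norm (z - w)" .
  qed
  then show ?case by simp
next
  case (Suc k)
  show ?case
  proof (rule symbol_SucI[of _ "\<lambda>e z. \<beta> * norm z powr (\<beta> - 2) * (z \<bullet> e)"])
    show "bounded_lipschitz (\<lambda>(e::'e) z. norm z powr \<beta>)"
      using Suc.IH symbol_bounded_lipschitz by blast
    show "symbol k (\<lambda>(e::'e) z. \<beta> * norm z powr (\<beta> - 2) * (z \<bullet> e))"
      by (intro symbol_mult symbol_const symbol_inner Suc.IH)
  qed (intro DERIV_norm_powr_line annulus_nonzero)
qed

text \<open>
  Differentiating along \<open>r *\<^sub>R e\<close> compensates the rescaling by \<open>1 / r\<close>, so the constant does not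
  depend on \<open>r\<close>.
\<close>

lemma symbol_rescaled:
  assumes "symbol k F"
  obtains C where "0 \<le> C"
    "\<And>(e::'e::euclidean_space) p r. norm e = 1 \<Longrightarrow> 0 < r \<Longrightarrow>
       dir_bounded k C (r *\<^sub>R e) {x. (x - p) /\<^sub>R r \<in> annulus} (\<lambda>x. complex_of_real (F e ((x - p) /\<^sub>R r)))"
proof -
  have "\<exists>C\<ge>0. \<forall>(e::'e) p r. norm e = 1 \<longrightarrow> 0 < r \<longrightarrow>
       dir_bounded k C (r *\<^sub>R e) {x. (x - p) /\<^sub>R r \<in> annulus} (\<lambda>x. complex_of_real (F e ((x - p) /\<^sub>R r)))"
    using assms
  proof (induction k arbitrary: F)
    case 0
    then obtain C where "0 \<le> C" "\<And>e z. norm e = 1 \<Longrightarrow> z \<in> annulus \<Longrightarrow> \<bar>F e z\<bar> \<le> C"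
      by (auto elim: bounded_lipschitzE)
    then show ?case by (intro exI[of _ C]) auto
  next
    case (Suc k)
    obtain C where C: "0 \<le> C" "\<And>e z. norm e = 1 \<Longrightarrow> z \<in> annulus \<Longrightarrow> \<bar>F e z\<bar> \<le> C"
      using symbol_bounded_lipschitz[OF Suc.prems] by (auto elim: bounded_lipschitzE)
    obtain F' where F': "\<And>e z. norm e = 1 \<Longrightarrow> z \<in> annulus \<Longrightarrow>
        ((\<lambda>s. F e (z + s *\<^sub>R e)) has_real_derivative F' e z) (at 0)" "symbol k F'"
      using symbol_SucE[OF Suc.prems] by metis
    obtain D where D: "0 \<le> D" "\<And>(e::'e) p r. norm e = 1 \<Longrightarrow> 0 < r \<Longrightarrow>
       dir_bounded k D (r *\<^sub>R e) {x. (x - p) /\<^sub>R r \<in> annulus} (\<lambda>x. complex_of_real (F' e ((x - p) /\<^sub>R r)))"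
      using Suc.IH[OF F'(2)] by blast
    have "dir_bounded (Suc k) (max C D) (r *\<^sub>R e) {x. (x - p) /\<^sub>R r \<in> annulus}
        (\<lambda>x. complex_of_real (F e ((x - p) /\<^sub>R r)))" if "norm e = 1" "0 < r" for e p :: 'e and r
    proof (rule dir_bounded_SucI)
      show "dir_bounded k (max C D) (r *\<^sub>R e) {x. (x - p) /\<^sub>R r \<in> annulus}
          (\<lambda>x. complex_of_real (F' e ((x - p) /\<^sub>R r)))"
        by (rule dir_bounded_mono[OF D(2)[OF that]]) auto
      fix x assume x: "x \<in> {x. (x - p) /\<^sub>R r \<in> annulus}"
      then show "norm (complex_of_real (F e ((x - p) /\<^sub>R r))) \<le> max C D"
        using C(2)[OF that(1)] by (auto simp: le_max_iff_disj)
      have "(x + s *\<^sub>R r *\<^sub>R e - p) /\<^sub>R r = (x - p) /\<^sub>R r + s *\<^sub>R e" for s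
        using that(2) by (simp add: algebra_simps)
      then show "has_line_derivative (\<lambda>x. complex_of_real (F e ((x - p) /\<^sub>R r))) (r *\<^sub>R e) x
         (complex_of_real (F' e ((x - p) /\<^sub>R r)))"
        using F'(1)[OF that(1), of "(x - p) /\<^sub>R r"] x by (intro has_line_derivative_of_real) simp
    qed
    then show ?case using C(1) by (intro exI[of _ "max C D"]) auto
  qed
  then show thesis using that by blast
qed

abbreviation centre_quotient :: "('e::euclidean_space \<Rightarrow> 'e \<Rightarrow> real) \<Rightarrow> 'e \<Rightarrow> real \<Rightarrow> 'e \<Rightarrow> 'e \<Rightarrow> 'e \<Rightarrow> real" where
  "centre_quotient F e r p p' x \<equiv>
     (F e ((x - p) /\<^sub>R r) - F e ((x - p') /\<^sub>R r)) * (r / norm (p - p'))"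

text \<open>
  The rescaled centres have distance \<open>norm (p - p') / r\<close>, by which the difference is divided. For \<open>F\<close>
  the derivative of \<open>norm z powr \<gamma>\<close> along \<open>e\<close>, this is the normalised derivative of the phase.
\<close>

lemma symbol_difference_quotient:
  assumes "symbol k F"
  obtains C where "0 \<le> C"
    "\<And>(e::'e::euclidean_space) p p' r. norm e = 1 \<Longrightarrow> 0 < r \<Longrightarrow> p \<noteq> p' \<Longrightarrow>
       dir_bounded k C (r *\<^sub>R e) {x. (x - p) /\<^sub>R r \<in> annulus \<and> (x - p') /\<^sub>R r \<in> annulus}
         (\<lambda>x. complex_of_real (centre_quotient F e r p p' x))"
proof -
  have "\<exists>C\<ge>0. \<forall>(e::'e) p p' r. norm e = 1 \<longrightarrow> 0 < r \<longrightarrow> p \<noteq> p' \<longrightarrow>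
       dir_bounded k C (r *\<^sub>R e) {x. (x - p) /\<^sub>R r \<in> annulus \<and> (x - p') /\<^sub>R r \<in> annulus}
         (\<lambda>x. complex_of_real (centre_quotient F e r p p' x))"
    using assms
  proof (induction k arbitrary: F)
    case 0
    then obtain C where C: "0 \<le> C" "\<And>e z w. norm e = 1 \<Longrightarrow> z \<in> annulus \<Longrightarrow> w \<in> annulus \<Longrightarrow>
        \<bar>F e z - F e w\<bar> \<le> C * norm (z - w)"
      by (auto elim: bounded_lipschitzE)
    show ?case
    proof (intro exI[of _ C] conjI allI impI C(1), simp only: dir_bounded.simps, intro ballI)
      fix e p p' x :: 'e and r :: real
      assume *: "norm e = 1" "0 < r" "p \<noteq> p'" "x \<in> {x. (x - p) /\<^sub>R r \<in> annulus \<and> (x - p') /\<^sub>R r \<in> annulus}"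
      have "(x - p) /\<^sub>R r - (x - p') /\<^sub>R r = (p' - p) /\<^sub>R r" by (simp add: algebra_simps)
      then have "norm ((x - p) /\<^sub>R r - (x - p') /\<^sub>R r) = norm (p - p') / r"
        using *(2) by (simp add: norm_minus_commute divide_inverse mult.commute)
      then have "\<bar>F e ((x - p) /\<^sub>R r) - F e ((x - p') /\<^sub>R r)\<bar> \<le> C * (norm (p - p') / r)"
        using C(2)[of e "(x - p) /\<^sub>R r" "(x - p') /\<^sub>R r"] * by auto
      then have "\<bar>F e ((x - p) /\<^sub>R r) - F e ((x - p') /\<^sub>R r)\<bar> * (r / norm (p - p'))
          \<le> C * (norm (p - p') / r) * (r / norm (p - p'))"
        using *(2) by (intro mult_right_mono) auto
      also have "\<dots> = C" using *(2,3) by simp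
      finally show "norm (complex_of_real (centre_quotient F e r p p' x)) \<le> C"
        using *(2) by (simp only: norm_of_real abs_mult abs_divide abs_norm_cancel)
    qed
  next
    case (Suc k)
    obtain C where C: "0 \<le> C" "\<And>(e::'e) p p' r. norm e = 1 \<Longrightarrow> 0 < r \<Longrightarrow> p \<noteq> p' \<Longrightarrow>
       dir_bounded k C (r *\<^sub>R e) {x. (x - p) /\<^sub>R r \<in> annulus \<and> (x - p') /\<^sub>R r \<in> annulus}
         (\<lambda>x. complex_of_real (centre_quotient F e r p p' x))"
      using Suc.IH[OF symbol_SucD[OF Suc.prems]] by blast
    obtain F' where F': "\<And>e z. norm e = 1 \<Longrightarrow> z \<in> annulus \<Longrightarrow>
        ((\<lambda>s. F e (z + s *\<^sub>R e)) has_real_derivative F' e z) (at 0)" "symbol k F'"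
      using symbol_SucE[OF Suc.prems] by metis
    obtain D where D: "0 \<le> D" "\<And>(e::'e) p p' r. norm e = 1 \<Longrightarrow> 0 < r \<Longrightarrow> p \<noteq> p' \<Longrightarrow>
       dir_bounded k D (r *\<^sub>R e) {x. (x - p) /\<^sub>R r \<in> annulus \<and> (x - p') /\<^sub>R r \<in> annulus}
         (\<lambda>x. complex_of_real (centre_quotient F' e r p p' x))"
      using Suc.IH[OF F'(2)] by blast
    have "dir_bounded (Suc k) (max C D) (r *\<^sub>R e) {x. (x - p) /\<^sub>R r \<in> annulus \<and> (x - p') /\<^sub>R r \<in> annulus}
         (\<lambda>x. complex_of_real (centre_quotient F e r p p' x))"
      (is "dir_bounded _ _ _ ?S _")
      if "norm e = 1" "0 < r" "p \<noteq> p'" for e p p' :: 'e and r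
    proof (rule dir_bounded_SucI)
      show "dir_bounded k (max C D) (r *\<^sub>R e) ?S
         (\<lambda>x. complex_of_real (centre_quotient F' e r p p' x))"
        by (rule dir_bounded_mono[OF D(2)[OF that]]) auto
      fix x assume x: "x \<in> ?S"
      show "norm (complex_of_real (centre_quotient F e r p p' x)) \<le> max C D"
        using dir_bounded_norm[OF C(2)[OF that] x] by (rule order_trans) simp
      have eq: "(x + s *\<^sub>R r *\<^sub>R e - p) /\<^sub>R r = (x - p) /\<^sub>R r + s *\<^sub>R e" for s p
        using that(2) by (simp add: algebra_simps)
      have "((\<lambda>s. (F e ((x - p) /\<^sub>R r + s *\<^sub>R e) - F e ((x - p') /\<^sub>R r + s *\<^sub>R e)) * (r / norm (p - p')))
          has_real_derivative centre_quotient F' e r p p' x) (at 0)"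
        using x by (intro DERIV_cmult_right DERIV_diff F'(1) that(1)) auto
      then show "has_line_derivative (\<lambda>x. complex_of_real (centre_quotient F e r p p' x)) (r *\<^sub>R e) x
         (complex_of_real (centre_quotient F' e r p p' x))"
        by (intro has_line_derivative_of_real) (simp only: eq)
    qed
    then show ?case using C(1) by (intro exI[of _ "max C D"]) auto
  qed
  then show thesis using that by blast
qed

section \<open>Convexity of the phase and the cutoff\<close>

text \<open>
  For fixed norms \<open>a\<close> and \<open>b\<close> of \<open>u\<close> and \<open>v\<close>, both sides are affine in \<open>u \<bullet> v\<close>, which ranges over
  \<open>[- a * b, a * b]\<close>. Hence it suffices to compare them at the endpoints, for antiparallel and
  parallel vectors, where the claim concerns the function \<open>t powr (\<gamma> - 1)\<close> of one variable. That function
  is strictly increasing because \<open>\<gamma> > 1\<close>.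
\<close>

lemma gradient_norm_powr_monotone:
  assumes "1 < \<gamma>"
  obtains c where "0 < c"
    "\<And>u v :: 'e::euclidean_space. u \<in> annulus \<Longrightarrow> v \<in> annulus \<Longrightarrow>
       c * (norm (u - v))\<^sup>2 \<le> \<gamma> * norm u powr (\<gamma> - 2) * (u \<bullet> (u - v)) - \<gamma> * norm v powr (\<gamma> - 2) * (v \<bullet> (u - v))"
proof -
  define p where "p = \<gamma> - 1"
  have p: "0 < p" using assms by (simp add: p_def)
  define c where "c = min (1/2) (p * 2 powr (- \<bar>p - 1\<bar>))"
  have c: "0 < c" "c \<le> 1/2" "c \<le> p * 2 powr (- \<bar>p - 1\<bar>)" using p by (auto simp: c_def)
  have mvt: "c * (a - b)\<^sup>2 \<le> (a powr p - b powr p) * (a - b)"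
    if ab: "1 \<le> b" "b < a" "a \<le> 2" for a b :: real
  proof -
    have "\<exists>z. b < z \<and> z < a \<and> a powr p - b powr p = (a - b) * (p * z powr (p - 1))"
      using ab by (intro MVT2) (auto intro!: derivative_eq_intros)
    then obtain z where z: "b < z" "z < a" "a powr p - b powr p = (a - b) * (p * z powr (p - 1))" by auto
    have "2 powr (- \<bar>p - 1\<bar>) \<le> z powr (- \<bar>p - 1\<bar>)" using z ab by (intro powr_mono2') auto
    also have "\<dots> \<le> z powr (p - 1)" using z ab by (intro powr_mono) auto
    finally have "c \<le> p * z powr (p - 1)"
      using c(3) p by (meson mult_left_mono less_imp_le order_trans)
    then have "(a - b) * c * (a - b) \<le> (a - b) * (p * z powr (p - 1)) * (a - b)"
      using ab by (intro mult_right_mono mult_left_mono) auto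
    then show ?thesis unfolding z(3) by (simp add: power2_eq_square algebra_simps)
  qed
  have par: "c * (a - b)\<^sup>2 \<le> (a powr p - b powr p) * (a - b)"
    if "1 \<le> b" "b \<le> 2" "1 \<le> a" "a \<le> 2" for a b :: real
    using mvt[of b a] mvt[of a b] that
    by (cases a b rule: linorder_cases) (auto simp: power2_commute[of a b] algebra_simps)
  have anti: "c * (a + b)\<^sup>2 \<le> (a powr p + b powr p) * (a + b)"
    if "1 \<le> b" "b \<le> 2" "1 \<le> a" "a \<le> 2" for a b :: real
  proof -
    have "c * (a + b) \<le> 1/2 * (a + b)" using c(2) that by (intro mult_right_mono) auto
    also have "\<dots> \<le> a powr p + b powr p"
      using ge_one_powr_ge_zero[of a p] ge_one_powr_ge_zero[of b p] that p by auto
    finally have "c * (a + b) * (a + b) \<le> (a powr p + b powr p) * (a + b)"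
      using that by (intro mult_right_mono) auto
    then show ?thesis by (simp add: power2_eq_square mult.assoc)
  qed
  have main: "c * (norm (u - v))\<^sup>2 \<le> norm u powr (\<gamma> - 2) * (u \<bullet> (u - v)) - norm v powr (\<gamma> - 2) * (v \<bullet> (u - v))"
    if uv: "u \<in> annulus" "v \<in> annulus" for u v :: 'e
  proof -
    define a where "a = norm u"
    define b where "b = norm v"
    define s where "s = u \<bullet> v"
    define A where "A = a powr (\<gamma> - 2)"
    define B where "B = b powr (\<gamma> - 2)"
    have ab: "1 \<le> b" "b \<le> 2" "1 \<le> a" "a \<le> 2" using uv by (auto simp: a_def b_def annulus_def)
    have s: "\<bar>s\<bar> \<le> a * b" unfolding s_def a_def b_def by (rule Cauchy_Schwarz_ineq2)
    have pw: "a powr p = A * a" "b powr p = B * b"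
      using ab powr_add[of a "\<gamma> - 2" 1] powr_add[of b "\<gamma> - 2" 1]
      by (auto simp: A_def B_def p_def)
    have 1: "c * (a - b)\<^sup>2 \<le> (A * a - B * b) * (a - b)" using par[OF ab] unfolding pw .
    have 2: "c * (a + b)\<^sup>2 \<le> (A * a + B * b) * (a + b)" using anti[OF ab] unfolding pw .
    \<comment> \<open>The position of \<open>u \<bullet> v\<close> between its extreme values, as a convex combination.\<close>
    define t where "t = s / (a * b)"
    have abpos: "0 < a * b" using ab by simp
    have t: "\<bar>t\<bar> \<le> 1" using s abpos by (simp add: t_def abs_divide)
    have st: "s = t * (a * b)" using abpos ab by (simp add: t_def)
    have "(1 + t) / 2 * (c * (a - b)\<^sup>2) + (1 - t) / 2 * (c * (a + b)\<^sup>2)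
        \<le> (1 + t) / 2 * ((A * a - B * b) * (a - b)) + (1 - t) / 2 * ((A * a + B * b) * (a + b))"
      using t 1 2 by (intro add_mono mult_left_mono) auto
    moreover have "(1 + t) / 2 * (c * (a - b)\<^sup>2) + (1 - t) / 2 * (c * (a + b)\<^sup>2)
        = c * (a\<^sup>2 + b\<^sup>2 - 2 * s)"
      unfolding st by (simp add: field_simps power2_eq_square)
    moreover have "(1 + t) / 2 * ((A * a - B * b) * (a - b)) + (1 - t) / 2 * ((A * a + B * b) * (a + b))
        = A * (a\<^sup>2 - s) - B * (s - b\<^sup>2)"
      unfolding st by (simp add: field_simps power2_eq_square)
    moreover have "(norm (u - v))\<^sup>2 = a\<^sup>2 + b\<^sup>2 - 2 * s"
      by (simp add: a_def b_def s_def power2_norm_eq_inner inner_diff_left inner_diff_right inner_commute)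
    moreover have "u \<bullet> (u - v) = a\<^sup>2 - s" "v \<bullet> (u - v) = s - b\<^sup>2"
      by (auto simp: a_def b_def s_def power2_norm_eq_inner inner_diff_right inner_commute)
    ultimately show ?thesis unfolding A_def B_def by (simp add: a_def b_def)
  qed
  show thesis
  proof (rule that[of "\<gamma> * c"])
    show "0 < \<gamma> * c" using assms c by simp
    fix u v :: 'e assume "u \<in> annulus" "v \<in> annulus"
    from mult_left_mono[OF main[OF this], of \<gamma>] assms
    show "\<gamma> * c * (norm (u - v))\<^sup>2
      \<le> \<gamma> * norm u powr (\<gamma> - 2) * (u \<bullet> (u - v)) - \<gamma> * norm v powr (\<gamma> - 2) * (v \<bullet> (u - v))"
      by (simp add: right_diff_distrib mult.assoc)
  qed
qed

text \<open>
  For \<open>M > 0\<close> this is positive exactly for \<open>1 < norm z < 2\<close>. A truncated power, rather than a smooth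
  bump, is explicit and has \<open>M - 1\<close> continuous derivatives.
\<close>

definition cutoff :: "nat \<Rightarrow> 'e::euclidean_space \<Rightarrow> real" where
  "cutoff M z = max 0 (((norm z)\<^sup>2 - 1) * (4 - (norm z)\<^sup>2)) ^ M"

lemma cutoff_nonneg: "0 \<le> cutoff M z"
  by (simp add: cutoff_def)

lemma cutoff_le: "cutoff M z \<le> (9/4) ^ M"
proof -
  have "0 \<le> ((norm z)\<^sup>2 - 5/2)\<^sup>2" by simp
  then have "((norm z)\<^sup>2 - 1) * (4 - (norm z)\<^sup>2) \<le> 9/4" by (simp add: power2_eq_square algebra_simps)
  then show ?thesis unfolding cutoff_def by (intro power_mono) auto
qed

lemma cutoff_eq_0: "z \<notin> annulus \<Longrightarrow> 0 < M \<Longrightarrow> cutoff M z = 0"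
proof -
  assume z: "z \<notin> annulus" and M: "0 < M"
  have "((norm z)\<^sup>2 - 1) * (4 - (norm z)\<^sup>2) \<le> 0"
  proof (cases "norm z < 1")
    case True
    then have "(norm z)\<^sup>2 \<le> 1" by (simp add: power_le_one)
    then show ?thesis by (intro mult_nonpos_nonneg) auto
  next
    case False
    with z have "2 \<le> norm z" by (auto simp: annulus_def)
    then have "2\<^sup>2 \<le> (norm z)\<^sup>2" by (intro power_mono) auto
    then show ?thesis by (intro mult_nonneg_nonpos) auto
  qed
  then show ?thesis using M by (simp add: cutoff_def max_def)
qed

lemma cutoff_measurable [measurable]: "cutoff M \<in> borel_measurable borel"
  unfolding cutoff_def by measurable

lemma DERIV_truncated_power:
  assumes "0 < j"
  shows "((\<lambda>t::real. max 0 t ^ Suc j) has_real_derivative real (Suc j) * max 0 t ^ j) (at t)"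
proof (cases t "0::real" rule: linorder_cases)
  case less
  have "((\<lambda>t::real. 0) has_real_derivative 0) (at t)" by simp
  then have "((\<lambda>t::real. max 0 t ^ Suc j) has_real_derivative 0) (at t)"
    by (rule has_field_derivative_transform_within_open[where S = "{..<0}"]) (use less in auto)
  then show ?thesis using less by (simp add: zero_power[OF assms])
next
  case greater
  have "((\<lambda>t::real. t ^ Suc j) has_real_derivative real (Suc j) * t ^ j) (at t)"
    using DERIV_pow[of "Suc j" t UNIV] by (simp only: diff_Suc_Suc diff_zero)
  then have "((\<lambda>t::real. max 0 t ^ Suc j) has_real_derivative real (Suc j) * t ^ j) (at t)"
    by (rule has_field_derivative_transform_within_open[where S = "{0<..}"]) (use greater in auto)
  then show ?thesis using greater by simp
next
  case equal
  have "(\<lambda>h::real. max 0 h ^ j) \<midarrow>0\<rightarrow> max 0 0 ^ j" by (intro tendsto_intros)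
  moreover have "(\<lambda>h::real. max 0 h ^ j) = (\<lambda>h. (max 0 (0 + h) ^ Suc j - max 0 0 ^ Suc j) / h)"
  proof
    fix h :: real
    show "max 0 h ^ j = (max 0 (0 + h) ^ Suc j - max 0 0 ^ Suc j) / h"
      using assms by (cases h "0::real" rule: linorder_cases) auto
  qed
  ultimately have "((\<lambda>t::real. max 0 t ^ Suc j) has_real_derivative max 0 0 ^ j) (at 0)"
    unfolding DERIV_def by (simp only:)
  then show ?thesis using assms unfolding equal by (simp add: zero_power)
qed

lemma closed_annulus_preimage: "closed {x::'e::euclidean_space. (x - p) /\<^sub>R r \<in> annulus}"
  unfolding annulus_def mem_Collect_eq by (intro closed_Collect_conj closed_Collect_le continuous_intros)

text \<open>
  The derivative of the cutoff with exponent \<open>Suc j\<close> is the cutoff with exponent \<open>j\<close> times a symbol.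
  The symbol is bounded only on the annulus, but the remaining truncated power confines the product to the
  annulus.
\<close>

lemma cutoff_dir_bounded:
  assumes "k < M"
  obtains C where "0 \<le> C"
    "\<And>(e::'e::euclidean_space) p r. norm e = 1 \<Longrightarrow> 0 < r \<Longrightarrow>
       dir_bounded k C (r *\<^sub>R e) UNIV (\<lambda>x. complex_of_real (cutoff M ((x - p) /\<^sub>R r)))"
proof -
  have "\<exists>C\<ge>0. \<forall>(e::'e) p r. norm e = 1 \<longrightarrow> 0 < r \<longrightarrow>
       dir_bounded k C (r *\<^sub>R e) UNIV (\<lambda>x. complex_of_real (cutoff M ((x - p) /\<^sub>R r)))"
    using assms
  proof (induction k arbitrary: M)
    case 0
    show ?case
      by (intro exI[of _ "(9/4) ^ M"]) (auto simp: cutoff_nonneg cutoff_le)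
  next
    case (Suc k)
    then obtain j where M: "M = Suc j" and j: "k < j" by (cases M) auto
    obtain C where C: "0 \<le> C" "\<And>(e::'e) p r. norm e = 1 \<Longrightarrow> 0 < r \<Longrightarrow>
       dir_bounded k C (r *\<^sub>R e) UNIV (\<lambda>x. complex_of_real (cutoff j ((x - p) /\<^sub>R r)))"
      using Suc.IH[OF j] by blast
    define G where "G e z = real (Suc j) * ((z \<bullet> e) * (10 + (- 4) * norm z powr 2))" for e z :: 'e
    have "symbol k G" unfolding G_def
      by (intro symbol_mult symbol_add symbol_const symbol_inner symbol_norm_powr)
    then obtain D where D: "0 \<le> D" "\<And>(e::'e) p r. norm e = 1 \<Longrightarrow> 0 < r \<Longrightarrow>
       dir_bounded k D (r *\<^sub>R e) {x. (x - p) /\<^sub>R r \<in> annulus} (\<lambda>x. complex_of_real (G e ((x - p) /\<^sub>R r)))"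
      using symbol_rescaled[of k G] by blast
    define B where "B = max ((9/4) ^ M) (2 ^ k * C * D)"
    have "dir_bounded (Suc k) B (r *\<^sub>R e) UNIV (\<lambda>x. complex_of_real (cutoff M ((x - p) /\<^sub>R r)))"
      if er: "norm e = 1" "0 < r" for e p :: 'e and r
    proof (rule dir_bounded_SucI)
      show "norm (complex_of_real (cutoff M ((x - p) /\<^sub>R r))) \<le> B" for x
        by (simp add: cutoff_nonneg B_def le_max_iff_disj cutoff_le)
      have "dir_bounded k (2 ^ k * C * D) (r *\<^sub>R e) UNIV
          (\<lambda>x. complex_of_real (cutoff j ((x - p) /\<^sub>R r)) * complex_of_real (G e ((x - p) /\<^sub>R r)))"
        using j by (intro dir_bounded_mult_support[OF closed_annulus_preimage[where p = p and r = r]] C D er) (auto intro: cutoff_eq_0)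
      then show "dir_bounded k B (r *\<^sub>R e) UNIV
          (\<lambda>x. complex_of_real (cutoff j ((x - p) /\<^sub>R r)) * complex_of_real (G e ((x - p) /\<^sub>R r)))"
        by (rule dir_bounded_mono) (auto simp: B_def)
      fix x
      define z where "z = (x - p) /\<^sub>R r"
      define g where "g s = ((z + s *\<^sub>R e) \<bullet> (z + s *\<^sub>R e) - 1) * (4 - (z + s *\<^sub>R e) \<bullet> (z + s *\<^sub>R e))" for s :: real
      have g: "(g has_real_derivative (z \<bullet> e) * (10 - 4 * (z \<bullet> z))) (at 0)"
        unfolding g_def
        by (auto intro!: derivative_eq_intros simp: inner_add_left inner_add_right inner_commute algebra_simps)
      have tp: "((\<lambda>t. max 0 t ^ Suc j) has_real_derivative real (Suc j) * max 0 (g 0) ^ j) (at (g 0))"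
        using j by (intro DERIV_truncated_power) simp
      have "((\<lambda>s. max 0 (g s) ^ Suc j) has_real_derivative
          real (Suc j) * max 0 (g 0) ^ j * ((z \<bullet> e) * (10 - 4 * (z \<bullet> z)))) (at 0)"
        by (rule DERIV_chain2[OF tp g])
      moreover have "max 0 (g s) ^ Suc j = cutoff M (z + s *\<^sub>R e)" for s
        by (simp add: cutoff_def g_def M power2_norm_eq_inner)
      moreover have "real (Suc j) * max 0 (g 0) ^ j * ((z \<bullet> e) * (10 - 4 * (z \<bullet> z))) = cutoff j z * G e z"
        by (simp add: cutoff_def g_def G_def power2_norm_eq_inner[symmetric] powr_numeral)
      moreover have "z + s *\<^sub>R e = (x + s *\<^sub>R r *\<^sub>R e - p) /\<^sub>R r" for s
        using er by (simp add: z_def algebra_simps)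
      ultimately have "((\<lambda>s. cutoff M ((x + s *\<^sub>R r *\<^sub>R e - p) /\<^sub>R r)) has_real_derivative cutoff j z * G e z) (at 0)"
        by simp
      from has_line_derivative_of_real[of "\<lambda>x. cutoff M ((x - p) /\<^sub>R r)", OF this]
      show "has_line_derivative (\<lambda>x. complex_of_real (cutoff M ((x - p) /\<^sub>R r))) (r *\<^sub>R e) x
          (complex_of_real (cutoff j ((x - p) /\<^sub>R r)) * complex_of_real (G e ((x - p) /\<^sub>R r)))"
        by (simp add: z_def)
    qed
    moreover have "0 \<le> B" by (simp add: B_def le_max_iff_disj)
    ultimately show ?case by blast
  qed
  then show thesis using that by blast
qed

section \<open>Smooth functions of compact support\<close>

lemma continuous_compact_support_bounded:
  fixes f :: "'e::euclidean_space \<Rightarrow> complex"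
  assumes "continuous_on UNIV f" "compact (closure {x. f x \<noteq> 0})"
  obtains C where "0 \<le> C" "\<And>x. norm (f x) \<le> C"
proof -
  let ?S = "closure {x. f x \<noteq> 0}"
  have "compact (f ` ?S)"
    using assms by (intro compact_continuous_image) (auto intro: continuous_on_subset)
  then obtain C where C: "\<And>y. y \<in> f ` ?S \<Longrightarrow> norm y \<le> C"
    using compact_imp_bounded bounded_iff by metis
  have "norm (f x) \<le> max 0 C" for x
    using C[of "f x"] closure_subset[of "{x. f x \<noteq> 0}"] by (cases "f x = 0") (auto simp: le_max_iff_disj)
  then show thesis by (intro that[of "max 0 C"]) auto
qed

text \<open>
  The iterated derivative of \<open>f\<close> along \<open>v\<close> is a polynomial in the coordinates of \<open>v\<close> whose coefficients
  are iterated derivatives along basis vectors. The latter are finitely many and bounded, which makes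
  the bound uniform over \<open>norm v \<le> R\<close>.
\<close>

lemma C_k_dir_bounded:
  fixes f :: "'e::euclidean_space \<Rightarrow> complex"
  assumes "C_k k f" "compact (closure {x. f x \<noteq> 0})" "0 \<le> R"
  obtains C where "0 \<le> C" "\<And>v. norm v \<le> R \<Longrightarrow> dir_bounded k C v UNIV f"
proof -
  have "\<exists>C\<ge>0. \<forall>v. norm v \<le> R \<longrightarrow> dir_bounded k C v UNIV f"
    using assms(1,2)
  proof (induction k arbitrary: f)
    case 0
    obtain C where "0 \<le> C" "\<And>x. norm (f x) \<le> C"
      using continuous_compact_support_bounded[of f] 0 by auto
    then show ?case by (intro exI[of _ "C"]) auto
  next
    case (Suc k)
    let ?D = "\<lambda>v x. frechet_derivative f (at x) v"
    have d: "(f has_derivative frechet_derivative f (at x)) (at x)" for x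
      using Suc.prems(1) by (simp add: differentiable_on_def frechet_derivative_works)
    have lin: "linear (frechet_derivative f (at x))" for x
      using d has_derivative_linear by blast
    have zero: "?D v x = 0" if "x \<notin> closure {x. f x \<noteq> 0}" for v x
    proof -
      have "(f has_derivative (\<lambda>_. 0)) (at x)"
      proof (rule has_derivative_transform_within_open[where s = "- closure {x. f x \<noteq> 0}"])
        show "((\<lambda>_. 0) has_derivative (\<lambda>_. 0)) (at x)" by simp
        show "x \<in> - closure {x. f x \<noteq> 0}" using that by simp
        show "0 = f z" if "z \<in> - closure {x. f x \<noteq> 0}" for z
          using that closure_subset[of "{x. f x \<noteq> 0}"] by auto
      qed auto
      then show ?thesis using has_derivative_unique[OF d] by metis
    qed
    have "compact (closure {x. ?D v x \<noteq> 0})" for v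
    proof -
      have "closure {x. ?D v x \<noteq> 0} \<subseteq> closure {x. f x \<noteq> 0}"
        using zero by (intro closure_minimal) auto
      then show ?thesis using Suc.prems(2) compact_Int_closed[of _ "closure {x. ?D v x \<noteq> 0}"]
        by (metis closed_closure inf.absorb_iff2)
    qed
    then have "\<exists>C\<ge>0. \<forall>v. norm v \<le> R \<longrightarrow> dir_bounded k C v UNIV (?D b)" for b
      using Suc.prems(1) by (intro Suc.IH) auto
    then obtain C where C: "\<And>b. 0 \<le> C b" "\<And>b v. norm v \<le> R \<Longrightarrow> dir_bounded k (C b) v UNIV (?D b)"
      by metis
    have "continuous_on UNIV f" using Suc.prems(1) differentiable_imp_continuous_on by auto
    then obtain C0 where C0: "0 \<le> C0" "\<And>x. norm (f x) \<le> C0"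
      using continuous_compact_support_bounded Suc.prems(2) by blast
    define E where "E = max C0 (\<Sum>b\<in>Basis. 2 ^ k * R * C b)"
    have "dir_bounded (Suc k) E v UNIV f" if v: "norm v \<le> R" for v
    proof (rule dir_bounded_SucI)
      show "norm (f x) \<le> E" for x using C0(2)[of x] by (simp add: E_def)
      have s: "dir_bounded k (\<Sum>b\<in>A. 2 ^ k * R * C b) v UNIV (\<lambda>x. \<Sum>b\<in>A. of_real (v \<bullet> b) * ?D b x)"
        if "finite A" "A \<subseteq> Basis" for A
        using that
      proof (induction A rule: finite_induct)
        case empty
        show ?case by (simp add: dir_bounded_const)
      next
        case (insert b A)
        have "norm (complex_of_real (v \<bullet> b)) \<le> R"
          using insert.prems v Basis_le_norm[of b v] by auto
        then have "2 ^ k * norm (complex_of_real (v \<bullet> b)) * C b \<le> 2 ^ k * R * C b"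
          using C(1) by (intro mult_right_mono mult_left_mono) auto
        then have "dir_bounded k (2 ^ k * R * C b) v UNIV (\<lambda>x. of_real (v \<bullet> b) * ?D b x)"
          by (rule dir_bounded_mono[OF dir_bounded_cmult[OF C(2)[OF v] C(1)]]) auto
        from dir_bounded_add[OF this insert.IH] insert show ?case by simp
      qed
      have "?D v x = (\<Sum>b\<in>Basis. of_real (v \<bullet> b) * ?D b x)" for x
      proof -
        have "?D v x = ?D (\<Sum>b\<in>Basis. (v \<bullet> b) *\<^sub>R b) x" by (simp add: euclidean_representation)
        also have "\<dots> = (\<Sum>b\<in>Basis. (v \<bullet> b) *\<^sub>R ?D b x)"
          by (simp add: linear_sum[OF lin] linear_cmul[OF lin])
        finally show ?thesis by (simp add: scaleR_conv_of_real)
      qed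
      then have "?D v = (\<lambda>x. \<Sum>b\<in>Basis. of_real (v \<bullet> b) * ?D b x)" by (rule ext)
      then show "dir_bounded k E v UNIV (?D v)"
        using dir_bounded_mono[OF s[OF finite_Basis subset_refl], where D = E and U = UNIV] by (simp add: E_def)
      fix x
      have "((\<lambda>s::real. x + s *\<^sub>R v) has_derivative (\<lambda>s. s *\<^sub>R v)) (at 0)"
        by (auto intro!: derivative_eq_intros)
      from has_derivative_compose[OF this, of f "frechet_derivative f (at x)"] d[of x]
      show "has_line_derivative f v x (?D v x)"
        unfolding has_line_derivative_def has_vector_derivative_def
        by (simp add: linear_cmul[OF lin])
    qed
    moreover have "0 \<le> E" using C0(1) by (simp add: E_def le_max_iff_disj)
    ultimately show ?case by blast
  qed
  then show thesis using that by blast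
qed

section \<open>The kernel of one scale\<close>

lemma dir_bounded_slice:
  "dir_bounded k C (v, 0) UNIV f \<Longrightarrow> dir_bounded k C v UNIV (\<lambda>x. f (x, y))"
proof (induction k arbitrary: f)
  case (Suc k)
  obtain g where g: "\<And>x. has_line_derivative f (v, 0) x (g x)" "dir_bounded k C (v, 0) UNIV g"
    using dir_bounded_SucE[OF Suc.prems] by (metis UNIV_I)
  show ?case
  proof (rule dir_bounded_SucI[OF _ _ Suc.IH[OF g(2)]])
    show "norm (f (x, y)) \<le> C" for x using dir_bounded_norm[OF Suc.prems] by simp
    show "has_line_derivative (\<lambda>x. f (x, y)) v x (g (x, y))" for x
      using g(1)[of "(x, y)"] unfolding has_line_derivative_def by simp
  qed
qed auto

definition scale_kernel ::
    "real \<Rightarrow> (('y::euclidean_space \<times> real) \<times> 'y \<Rightarrow> complex) \<Rightarrow> real \<Rightarrow> nat \<Rightarrow> real \<Rightarrow> 'y \<times> real \<Rightarrow> 'y \<Rightarrow> complex" where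
  "scale_kernel \<gamma> \<psi> lam M r x y =
     exp (\<i> * complex_of_real (lam * norm (x - (y, 0)) powr \<gamma>)) * \<psi> (x, y)
       * complex_of_real (cutoff M ((x - (y, 0)) /\<^sub>R r))"

lemma smooth_continuous: "smooth_compactly_supported \<psi> \<Longrightarrow> continuous_on UNIV \<psi>"
  unfolding smooth_compactly_supported_def by (metis C_k.simps(1))

lemma smooth_measurable: "smooth_compactly_supported \<psi> \<Longrightarrow> \<psi> \<in> borel_measurable borel"
  using borel_measurable_continuous_onI smooth_continuous by blast

lemma borel_measurable_cnj [measurable (raw)]:
  assumes "f \<in> borel_measurable M"
  shows "(\<lambda>x. cnj (f x)) \<in> borel_measurable M"
proof -
  have "cnj \<in> borel_measurable borel" by (intro borel_measurable_continuous_onI continuous_intros)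
  then show ?thesis using assms by (rule measurable_compose_rev)
qed

lemma measure_annulus_preimage_le:
  fixes p :: "'e::euclidean_space"
  assumes "0 < r" "S \<in> sets borel" "S \<subseteq> {x. (x - p) /\<^sub>R r \<in> annulus}"
  shows "measure lborel S \<le> unit_ball_vol (real DIM('e)) * 2 ^ DIM('e) * r ^ DIM('e)"
    "bounded S"
proof -
  have sub: "S \<subseteq> cball p (2 * r)"
  proof
    fix x assume "x \<in> S"
    then have "norm ((x - p) /\<^sub>R r) \<le> 2" using assms(3) by (auto simp: annulus_def)
    then have "norm (x - p) / r \<le> 2" using assms(1) by (simp add: divide_inverse mult.commute)
    then show "x \<in> cball p (2 * r)"
      using assms(1) by (simp add: pos_divide_le_eq dist_norm norm_minus_commute)
  qed
  have "measure lborel S \<le> measure lborel (cball p (2 * r))"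
    using assms(2) emeasure_lborel_cball_finite[of p "2 * r"]
    by (intro measure_mono_fmeasurable sub) (auto simp: fmeasurable_def)
  also have "\<dots> = unit_ball_vol (real DIM('e)) * (2 * r) ^ DIM('e)"
    using assms(1) by (simp add: content_cball)
  finally show "measure lborel S \<le> unit_ball_vol (real DIM('e)) * 2 ^ DIM('e) * r ^ DIM('e)"
    by (simp add: power_mult_distrib)
  show "bounded S" using sub bounded_cball bounded_subset by blast
qed

lemma annulus_preimages_close:
  assumes "0 < r" "(x - p) /\<^sub>R r \<in> annulus" "(x - p') /\<^sub>R r \<in> annulus"
  shows "norm (p - p') \<le> 4 * r"
proof -
  have "norm (p' - p) / r = norm ((x - p) /\<^sub>R r - (x - p') /\<^sub>R r)"
  proof -
    have "(x - p) /\<^sub>R r - (x - p') /\<^sub>R r = (p' - p) /\<^sub>R r" by (simp add: algebra_simps)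
    then show ?thesis using assms(1) by (simp add: divide_inverse mult.commute)
  qed
  also have "\<dots> \<le> 4"
    using norm_triangle_ineq4[of "(x - p) /\<^sub>R r" "(x - p') /\<^sub>R r"] assms(2,3) by (auto simp: annulus_def)
  finally show ?thesis using assms(1) by (simp add: pos_divide_le_eq norm_minus_commute)
qed

text \<open>
  The product of the two kernels has the phase \<open>lam * norm (x - p) powr \<gamma> - lam * norm (x - p') powr \<gamma>\<close>
  with \<open>p = (y, 0)\<close> and \<open>p' = (y', 0)\<close>, and an amplitude supported where \<open>x\<close> has distance between \<open>r\<close>
  and \<open>2 * r\<close> from both centres. Along \<open>r *\<^sub>R e\<close>, with \<open>e\<close> the unit vector from \<open>p'\<close> to \<open>p\<close>, all amplitude
  derivatives are bounded uniformly in \<open>r \<le> R\<close>, while the phase derivative is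
  \<open>lam * r powr (\<gamma> - 1) * norm (y - y')\<close> times a quotient \<open>q\<close> bounded away from zero by
  monotonicity of the gradient.
\<close>

lemma scale_kernel_TstarT_bound:
  fixes \<psi> :: "('y::euclidean_space \<times> real) \<times> 'y \<Rightarrow> complex"
  assumes \<gamma>: "1 < \<gamma>" and \<psi>: "smooth_compactly_supported \<psi>" and NM: "N < M" and R: "0 < R"
  obtains C where "0 \<le> C"
    "\<And>lam r y y'. 0 < lam \<Longrightarrow> 0 < r \<Longrightarrow> r \<le> R \<Longrightarrow>
       norm (\<integral>x. scale_kernel \<gamma> \<psi> lam M r x y * cnj (scale_kernel \<gamma> \<psi> lam M r x y') \<partial>lborel)
         \<le> C * r ^ (DIM('y) + 1)"
    "\<And>lam r y y'. 0 < lam \<Longrightarrow> 0 < r \<Longrightarrow> r \<le> R \<Longrightarrow> y \<noteq> y' \<Longrightarrow>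
       norm (\<integral>x. scale_kernel \<gamma> \<psi> lam M r x y * cnj (scale_kernel \<gamma> \<psi> lam M r x y') \<partial>lborel)
         \<le> C * r ^ (DIM('y) + 1) / (lam * r powr (\<gamma> - 1) * norm (y - y')) ^ N"
    "\<And>lam r y y'. 0 < r \<Longrightarrow> 4 * r < norm (y - y') \<Longrightarrow>
       (\<integral>x. scale_kernel \<gamma> \<psi> lam M r x y * cnj (scale_kernel \<gamma> \<psi> lam M r x y') \<partial>lborel) = 0"
proof -
  let ?n = "DIM('y) + 1"
  define F where "F e z = \<gamma> * norm z powr (\<gamma> - 2) * (z \<bullet> e)" for e z :: "'y \<times> real"
  have symF: "symbol N F"
    unfolding F_def by (intro symbol_mult symbol_const symbol_norm_powr symbol_inner)
  obtain c where c: "0 < c" "\<And>u v :: 'y \<times> real. u \<in> annulus \<Longrightarrow> v \<in> annulus \<Longrightarrow>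
       c * (norm (u - v))\<^sup>2 \<le> \<gamma> * norm u powr (\<gamma> - 2) * (u \<bullet> (u - v)) - \<gamma> * norm v powr (\<gamma> - 2) * (v \<bullet> (u - v))"
    using gradient_norm_powr_monotone[OF \<gamma>] by blast
  obtain Q where Q: "0 \<le> Q" "\<And>(e::'y \<times> real) p p' r. norm e = 1 \<Longrightarrow> 0 < r \<Longrightarrow> p \<noteq> p' \<Longrightarrow>
       dir_bounded N Q (r *\<^sub>R e) {x. (x - p) /\<^sub>R r \<in> annulus \<and> (x - p') /\<^sub>R r \<in> annulus}
         (\<lambda>x. complex_of_real (centre_quotient F e r p p' x))"
    using symbol_difference_quotient[OF symF] by blast
  obtain D where D: "0 \<le> D"
    "\<And>(v::'y \<times> real) S f. dir_bounded N Q v S f \<Longrightarrow> (\<And>x. x \<in> S \<Longrightarrow> c \<le> norm (f x)) \<Longrightarrow>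
       dir_bounded N D v S (\<lambda>x. inverse (f x))"
    using dir_bounded_inverse[OF c(1) Q(1)] by blast
  obtain K where K: "0 \<le> K" "\<And>(e::'y \<times> real) p r. norm e = 1 \<Longrightarrow> 0 < r \<Longrightarrow>
       dir_bounded N K (r *\<^sub>R e) UNIV (\<lambda>x. complex_of_real (cutoff M ((x - p) /\<^sub>R r)))"
    using cutoff_dir_bounded[OF NM] by blast
  obtain P where P: "0 \<le> P" "\<And>v. norm v \<le> R \<Longrightarrow> dir_bounded N P v UNIV \<psi>"
    using C_k_dir_bounded[of N \<psi> R] \<psi> R unfolding smooth_compactly_supported_def by auto
  define B where "B = 2 ^ N * (2 ^ N * P * P) * (2 ^ N * K * K)"
  have B: "0 \<le> B" using P K by (simp add: B_def)
  define V where "V = unit_ball_vol (real ?n) * 2 ^ ?n"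
  have V: "0 \<le> V" by (simp add: V_def unit_ball_vol_nonneg)
  define E where "E = 2 ^ N * D"
  have [measurable]: "\<psi> \<in> borel_measurable borel" by (rule smooth_measurable[OF \<psi>])
  define \<theta> where "\<theta> lam p p' x = lam * norm (x - p) powr \<gamma> - lam * norm (x - p') powr \<gamma>"
    for lam and p p' x :: "'y \<times> real"
  define b where "b r y y' x = \<psi> (x, y) * cnj (\<psi> (x, y')) *
      (complex_of_real (cutoff M ((x - (y, 0)) /\<^sub>R r)) * complex_of_real (cutoff M ((x - (y', 0)) /\<^sub>R r)))"
    for r y y' x
  define S where "S r y y' = {x. (x - (y, 0 :: real)) /\<^sub>R r \<in> annulus \<and> (x - (y', 0)) /\<^sub>R r \<in> annulus}"
    for r and y y' :: 'y
  have Sc: "closed (S r y y')" for r y y'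
    unfolding S_def by (intro closed_Collect_conj closed_annulus_preimage)
  have Sb [measurable]: "S r y y' \<in> sets borel" for r y y' using Sc by auto
  have Ssub: "S r y y' \<subseteq> {x. (x - (y, 0)) /\<^sub>R r \<in> annulus}" for r y y' by (auto simp: S_def)
  have Smeas: "measure lborel (S r y y') \<le> V * r ^ ?n" "bounded (S r y y')" if "0 < r" for r y y'
    using measure_annulus_preimage_le[OF that Sb Ssub] by (auto simp: V_def add.commute)
  have eq: "scale_kernel \<gamma> \<psi> lam M r x y * cnj (scale_kernel \<gamma> \<psi> lam M r x y')
      = exp (\<i> * complex_of_real (\<theta> lam (y, 0) (y', 0) x)) * b r y y' x" for lam r y y' x
    unfolding scale_kernel_def \<theta>_def b_def
    by (simp add: exp_cnj exp_diff exp_minus right_diff_distrib divide_inverse)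
  have b0: "b r y y' x = 0" if "x \<notin> S r y y'" for r y y' x
    using that NM by (auto simp: b_def S_def cutoff_eq_0)
  have bm [measurable]: "b r y y' \<in> borel_measurable borel" for r y y'
  proof -
    have [measurable]: "(\<lambda>x. cutoff M ((x - p) /\<^sub>R r)) \<in> borel_measurable borel" for p :: "'y \<times> real" and r
      by measurable
    have [measurable]: "(\<lambda>x. \<psi> (x, y)) \<in> borel_measurable borel" for y
      by (rule borel_measurable_continuous_onI[OF continuous_on_compose2[OF smooth_continuous[OF \<psi>]]])
         (rule continuous_on_Pair[OF continuous_on_id continuous_on_const], simp)
    show ?thesis unfolding b_def by (intro borel_measurable_times borel_measurable_cnj borel_measurable_of_real) measurable
  qed
  have \<theta>m [measurable]: "\<theta> lam p p' \<in> borel_measurable borel" for lam p p'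
    unfolding \<theta>_def by measurable
  have db: "dir_bounded N B (r *\<^sub>R e) UNIV (b r y y')" if "norm e = 1" "0 < r" "r \<le> R" for r e y y'
  proof -
    have "norm (r *\<^sub>R e, 0 :: 'y) \<le> R" using that by simp
    then have s: "dir_bounded N P (r *\<^sub>R e) UNIV (\<lambda>x. \<psi> (x, y))" for y
      by (intro dir_bounded_slice P(2))
    show ?thesis unfolding b_def[abs_def] B_def
      by (intro dir_bounded_mult dir_bounded_cnj s K that mult_nonneg_nonneg P(1)) simp_all
  qed
  have bB: "norm (b r y y' x) \<le> B" if "0 < r" "r \<le> R" for r y y' x
    using dir_bounded_norm[OF db[of "(0, 1)" r y y']] that by (simp add: norm_Pair)
  show thesis
  proof (rule that[of "max (B * V) (B * E ^ N * V)"])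
    show "0 \<le> max (B * V) (B * E ^ N * V)" using B V by (simp add: le_max_iff_disj)
  next
    fix lam r :: real and y y' :: 'y
    assume lr: "0 < lam" "0 < r" "r \<le> R"
    have "norm (\<integral>x. exp (\<i> * complex_of_real (\<theta> lam (y, 0) (y', 0) x)) * b r y y' x \<partial>lborel)
        \<le> B * measure lborel (S r y y')"
      using lr b0 bB Smeas(2) by (intro norm_integral_le_measure) (auto simp: norm_mult)
    also have "\<dots> \<le> B * (V * r ^ ?n)" using Smeas lr B by (intro mult_left_mono) auto
    also have "\<dots> \<le> max (B * V) (B * E ^ N * V) * r ^ ?n"
      using lr mult_right_mono[of "B * V" "max (B * V) (B * E ^ N * V)" "r ^ ?n"] by (simp add: mult.assoc)
    finally show "norm (\<integral>x. scale_kernel \<gamma> \<psi> lam M r x y * cnj (scale_kernel \<gamma> \<psi> lam M r x y') \<partial>lborel)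
         \<le> max (B * V) (B * E ^ N * V) * r ^ ?n"
      unfolding eq .
  next
    fix lam r :: real and y y' :: 'y
    assume lr: "0 < lam" "0 < r" "r \<le> R" and y: "y \<noteq> y'"
    define p where "p = (y, 0 :: real)"
    define p' where "p' = (y', 0 :: real)"
    define h where "h = norm (p - p')"
    have hy: "h = norm (y - y')" by (simp add: h_def p_def p'_def norm_Pair)
    have h: "0 < h" using y by (simp add: hy)
    have pp: "p \<noteq> p'" using y by (simp add: p_def p'_def)
    define e where "e = (p - p') /\<^sub>R h"
    have e: "norm e = 1" using h by (simp add: e_def h_def)
    define q where "q x = (F e ((x - p) /\<^sub>R r) - F e ((x - p') /\<^sub>R r)) * (r / h)" for x
    have [measurable]: "q \<in> borel_measurable borel" unfolding q_def F_def by measurable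
    define \<Lambda> where "\<Lambda> = lam * r powr (\<gamma> - 1) * h"
    have \<Lambda>: "0 < \<Lambda>" using lr h by (simp add: \<Lambda>_def)
    have Sp: "S r y y' = {x. (x - p) /\<^sub>R r \<in> annulus \<and> (x - p') /\<^sub>R r \<in> annulus}"
      by (simp add: S_def p_def p'_def)
    \<comment> \<open>Monotonicity is applied to the two rescaled arguments, whose difference is a multiple of \<open>e\<close>.\<close>
    have qle: "c \<le> \<bar>q x\<bar>" if x: "x \<in> S r y y'" for x
    proof -
      define u where "u = (x - p) /\<^sub>R r"
      define v where "v = (x - p') /\<^sub>R r"
      have uv: "u \<in> annulus" "v \<in> annulus" using x by (auto simp: Sp u_def v_def)
      have d: "u - v = (- (h / r)) *\<^sub>R e"
      proof -
        have "(- (h / r)) *\<^sub>R e = (- inverse r) *\<^sub>R (p - p')"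
          using h by (simp add: e_def divide_inverse mult.commute)
        then show ?thesis by (simp add: u_def v_def algebra_simps)
      qed
      have "c * (h / r)\<^sup>2 \<le> - (h / r) * (F e u - F e v)"
        using c(2)[OF uv] e h lr unfolding d by (simp add: F_def algebra_simps)
      then have "(h / r) * (c * (h / r)) \<le> (h / r) * (- (F e u - F e v))"
        by (simp only: power2_eq_square mult.assoc mult.left_commute mult_minus_left mult_minus_right)
      then have "c * (h / r) \<le> - (F e u - F e v)"
        using h lr by (subst (asm) mult_le_cancel_left_pos) auto
      then have "c \<le> - (F e u - F e v) * (r / h)" using h lr by (simp add: field_simps)
      also have "\<dots> = - q x" by (simp only: q_def u_def v_def mult_minus_left)
      finally show ?thesis by linarith
    qed
    have "dir_bounded N Q (r *\<^sub>R e) (S r y y') (\<lambda>x. complex_of_real (q x))"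
      using Q(2)[OF e lr(2) pp] unfolding Sp q_def h_def .
    then have dq: "dir_bounded N D (r *\<^sub>R e) (S r y y') (\<lambda>x. inverse (complex_of_real (q x)))"
      using qle by (intro D(2)) auto
    have \<theta>': "((\<lambda>s. \<theta> lam p p' (x + s *\<^sub>R r *\<^sub>R e)) has_real_derivative \<Lambda> * q x) (at 0)"
      if x: "x \<in> S r y y'" for x
    proof -
      have pt: "norm (x + s *\<^sub>R r *\<^sub>R e - w) powr \<gamma> = r powr \<gamma> * norm ((x - w) /\<^sub>R r + s *\<^sub>R e) powr \<gamma>" for s w
      proof -
        have "x + s *\<^sub>R r *\<^sub>R e - w = r *\<^sub>R ((x - w) /\<^sub>R r + s *\<^sub>R e)"
          using lr by (simp add: algebra_simps)
        then show ?thesis using lr by (simp add: powr_mult)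
      qed
      have "((\<lambda>s. lam * (r powr \<gamma> * norm ((x - p) /\<^sub>R r + s *\<^sub>R e) powr \<gamma>)
               - lam * (r powr \<gamma> * norm ((x - p') /\<^sub>R r + s *\<^sub>R e) powr \<gamma>)) has_real_derivative
          lam * (r powr \<gamma> * F e ((x - p) /\<^sub>R r)) - lam * (r powr \<gamma> * F e ((x - p') /\<^sub>R r))) (at 0)"
        using x unfolding F_def Sp
        by (intro DERIV_diff DERIV_cmult DERIV_norm_powr_line annulus_nonzero) auto
      moreover have "lam * (r powr \<gamma> * F e ((x - p) /\<^sub>R r)) - lam * (r powr \<gamma> * F e ((x - p') /\<^sub>R r)) = \<Lambda> * q x"
      proof -
        have "r powr \<gamma> = r powr (\<gamma> - 1) * r" using lr powr_add[of r "\<gamma> - 1" 1] by simp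
        then show ?thesis using h lr by (simp add: \<Lambda>_def q_def algebra_simps)
      qed
      ultimately show ?thesis unfolding \<theta>_def pt by simp
    qed
    have "norm (\<integral>x. exp (\<i> * complex_of_real (\<theta> lam p p' x)) * b r y y' x \<partial>lborel)
        \<le> B * (E / \<Lambda>) ^ N * measure lborel (S r y y')"
    proof (rule nonstationary_integral_bound[OF Sc Smeas(2)[OF lr(2)] _ _ \<theta>' _ \<Lambda> D(1) _ db[OF e lr(2,3)] b0 dq])
      show "q x \<noteq> 0" if "x \<in> S r y y'" for x using qle[OF that] c(1) by auto
    qed (auto simp: E_def B)
    also have "\<dots> \<le> B * (E / \<Lambda>) ^ N * (V * r ^ ?n)"
      using Smeas lr B \<Lambda> D(1) by (intro mult_left_mono) (auto simp: E_def)
    also have "\<dots> = B * E ^ N * V * r ^ ?n / \<Lambda> ^ N" by (simp add: power_divide)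
    also have "\<dots> \<le> max (B * V) (B * E ^ N * V) * r ^ ?n / \<Lambda> ^ N"
      using lr \<Lambda> by (intro divide_right_mono mult_right_mono) auto
    finally show "norm (\<integral>x. scale_kernel \<gamma> \<psi> lam M r x y * cnj (scale_kernel \<gamma> \<psi> lam M r x y') \<partial>lborel)
         \<le> max (B * V) (B * E ^ N * V) * r ^ ?n / (lam * r powr (\<gamma> - 1) * norm (y - y')) ^ N"
      unfolding eq p_def[symmetric] p'_def[symmetric] hy[symmetric] \<Lambda>_def[symmetric] .
  next
    fix lam r :: real and y y' :: 'y
    assume r: "0 < r" "4 * r < norm (y - y')"
    have "S r y y' = {}"
    proof (rule ccontr)
      assume "S r y y' \<noteq> {}"
      then obtain x where "(x - (y, 0 :: real)) /\<^sub>R r \<in> annulus" "(x - (y', 0)) /\<^sub>R r \<in> annulus"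
        unfolding S_def by blast
      then have "norm ((y, 0 :: real) - (y', 0)) \<le> 4 * r"
        by (rule annulus_preimages_close[OF r(1)])
      with r(2) show False by (simp add: norm_Pair)
    qed
    then have "b r y y' x = 0" for x using b0 by simp
    then show "(\<integral>x. scale_kernel \<gamma> \<psi> lam M r x y * cnj (scale_kernel \<gamma> \<psi> lam M r x y') \<partial>lborel) = 0"
      unfolding eq by simp
  qed
qed

lemma nn_integral_inverse_power_atLeast:
  fixes a :: real
  assumes "0 < a" "0 < N"
  shows "(\<integral>\<^sup>+s. ennreal (real N / s ^ Suc N) * indicator {a..} s \<partial>lborel) = ennreal (1 / a ^ N)"
proof -
  have "(\<integral>\<^sup>+s. ennreal (real N / s ^ Suc N) * indicator {a..} s \<partial>lborel) = ennreal (0 - (- (1 / a ^ N)))"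
  proof (rule nn_integral_FTC_atLeast)
    show "(\<lambda>s. real N / s ^ Suc N) \<in> borel_measurable borel" by measurable
    fix s :: real assume s: "a \<le> s"
    have "((\<lambda>s. - inverse (s ^ N)) has_real_derivative inverse (s ^ N) * (real N * s ^ (N - Suc 0)) * inverse (s ^ N)) (at s)"
      using s assms by (auto intro!: derivative_eq_intros)
    moreover have "inverse (s ^ N) * (real N * s ^ (N - Suc 0)) * inverse (s ^ N) = real N / s ^ Suc N"
      using s assms by (cases N) (auto simp: field_simps)
    ultimately show "((\<lambda>s. - (1 / s ^ N)) has_real_derivative real N / s ^ Suc N) (at s)"
      by (simp add: divide_inverse)
    show "0 \<le> real N / s ^ Suc N" using s assms by simp
  next
    have "((\<lambda>s::real. - inverse (s ^ N)) \<longlongrightarrow> - 0) at_top"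
      using assms by (intro tendsto_minus tendsto_inverse_0_at_top filterlim_pow_at_top filterlim_ident)
    then show "((\<lambda>s::real. - (1 / s ^ N)) \<longlongrightarrow> 0) at_top" by (simp add: divide_inverse)
  qed
  then show ?thesis by simp
qed

text \<open>
  The integrand is at most the integral of \<open>N / s ^ (N + 1)\<close> over \<open>s \<ge> max 1 (\<mu> * norm (y - w))\<close> with
  \<open>N = Suc DIM('y)\<close>. After exchanging the integrals, the \<open>w\<close>-integral is the volume of a ball of radius
  \<open>s / \<mu>\<close>, and the exponent \<open>N > DIM('y)\<close> leaves a convergent integral of \<open>1 / s\<^sup>2\<close>.
\<close>

lemma nn_integral_min_inverse_power_le:
  fixes y :: "'y::euclidean_space"
  assumes "0 < \<mu>"
  shows "(\<integral>\<^sup>+w. ennreal (min 1 (1 / (\<mu> * norm (y - w)) ^ Suc DIM('y))) \<partial>lborel)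
    \<le> ennreal (unit_ball_vol (real DIM('y)) * real (Suc DIM('y)) / \<mu> ^ DIM('y))"
proof -
  let ?d = "DIM('y)"
  let ?N = "Suc ?d"
  define f where "f s = ennreal (real ?N / s ^ Suc ?N) * indicator {1..} s" for s :: real
  have [measurable]: "f \<in> borel_measurable borel" unfolding f_def by measurable
  have pt: "ennreal (min 1 (1 / (\<mu> * norm (y - w)) ^ ?N)) \<le> (\<integral>\<^sup>+s. f s * indicator {s. \<mu> * norm (y - w) \<le> s} s \<partial>lborel)"
    for w
  proof -
    define a where "a = max 1 (\<mu> * norm (y - w))"
    have a: "1 \<le> a" by (simp add: a_def)
    have "min 1 (1 / (\<mu> * norm (y - w)) ^ ?N) \<le> 1 / a ^ ?N"
      by (auto simp: a_def max_def)
    then have "ennreal (min 1 (1 / (\<mu> * norm (y - w)) ^ ?N)) \<le> ennreal (1 / a ^ ?N)"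
      by (rule ennreal_leI)
    also have "\<dots> = (\<integral>\<^sup>+s. ennreal (real ?N / s ^ Suc ?N) * indicator {a..} s \<partial>lborel)"
      using a by (subst nn_integral_inverse_power_atLeast) auto
    also have "\<dots> = (\<integral>\<^sup>+s. f s * indicator {s. \<mu> * norm (y - w) \<le> s} s \<partial>lborel)"
      by (intro nn_integral_cong) (auto simp: f_def a_def indicator_def)
    finally show ?thesis .
  qed
  have "(\<integral>\<^sup>+w. ennreal (min 1 (1 / (\<mu> * norm (y - w)) ^ ?N)) \<partial>lborel)
      \<le> (\<integral>\<^sup>+w. (\<integral>\<^sup>+s. f s * indicator {s. \<mu> * norm (y - w) \<le> s} s \<partial>lborel) \<partial>lborel)"
    by (intro nn_integral_mono pt)
  also have "\<dots> = (\<integral>\<^sup>+w. (\<integral>\<^sup>+s. f s * indicator {z. \<mu> * norm (y - fst z) \<le> snd z} (w, s) \<partial>lborel) \<partial>lborel)"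
    by (intro nn_integral_cong) (auto simp: indicator_def)
  also have "\<dots> = (\<integral>\<^sup>+s. (\<integral>\<^sup>+w. f s * indicator {z. \<mu> * norm (y - fst z) \<le> snd z} (w, s) \<partial>lborel) \<partial>lborel)"
    by (rule lborel_pair.Fubini'[symmetric]) measurable
  also have "\<dots> \<le> (\<integral>\<^sup>+s. ennreal (unit_ball_vol (real ?d) * real ?N / \<mu> ^ ?d) * (ennreal (real 1 / s ^ Suc 1) * indicator {1..} s) \<partial>lborel)"
  proof (intro nn_integral_mono)
    fix s :: real
    have "(\<integral>\<^sup>+w. f s * indicator {z. \<mu> * norm (y - fst z) \<le> snd z} (w, s) \<partial>lborel)
        = f s * (\<integral>\<^sup>+w. indicator (cball y (s / \<mu>)) w \<partial>lborel)"
      using assms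
      by (subst nn_integral_cmult[symmetric])
         (auto simp: indicator_def dist_norm field_simps intro!: nn_integral_cong borel_measurable_indicator)
    also have "\<dots> = f s * emeasure lborel (cball y (s / \<mu>))" by (subst nn_integral_indicator) auto
    also have "\<dots> \<le> ennreal (unit_ball_vol (real ?d) * real ?N / \<mu> ^ ?d) * (ennreal (real 1 / s ^ Suc 1) * indicator {1..} s)"
    proof (cases "1 \<le> s")
      case True
      have "f s * emeasure lborel (cball y (s / \<mu>))
          = ennreal (real ?N / s ^ Suc ?N * (unit_ball_vol (real ?d) * (s / \<mu>) ^ ?d))"
      proof -
        have "f s = ennreal (real ?N / s ^ Suc ?N)" using True by (simp add: f_def)
        moreover have "emeasure lborel (cball y (s / \<mu>)) = ennreal (unit_ball_vol (real ?d) * (s / \<mu>) ^ ?d)"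
          using True assms by (intro emeasure_cball) auto
        moreover have "0 \<le> real ?N / s ^ Suc ?N" "0 \<le> unit_ball_vol (real ?d) * (s / \<mu>) ^ ?d"
          using True assms by (auto simp: unit_ball_vol_nonneg)
        ultimately show ?thesis by (simp only: ennreal_mult)
      qed
      also have "real ?N / s ^ Suc ?N * (unit_ball_vol (real ?d) * (s / \<mu>) ^ ?d)
          = unit_ball_vol (real ?d) * real ?N / \<mu> ^ ?d * (real 1 / s ^ Suc 1)"
        using True assms by (simp add: power_divide field_simps)
      also have "ennreal \<dots> = ennreal (unit_ball_vol (real ?d) * real ?N / \<mu> ^ ?d) * ennreal (real 1 / s ^ Suc 1)"
        using True assms by (intro ennreal_mult) (auto simp: unit_ball_vol_nonneg)
      finally show ?thesis using True by (simp only: indicator_simps atLeast_iff) simp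
    qed (simp add: f_def)
    finally show "(\<integral>\<^sup>+w. f s * indicator {z. \<mu> * norm (y - fst z) \<le> snd z} (w, s) \<partial>lborel)
      \<le> ennreal (unit_ball_vol (real ?d) * real ?N / \<mu> ^ ?d) * (ennreal (real 1 / s ^ Suc 1) * indicator {1..} s)" .
  qed
  also have "\<dots> = ennreal (unit_ball_vol (real ?d) * real ?N / \<mu> ^ ?d)"
    by (subst nn_integral_cmult) (auto simp: nn_integral_inverse_power_atLeast[of 1 1, simplified])
  finally show ?thesis .
qed

section \<open>The Schur test for the adjoint square\<close>

lemma integrable_bounded_mult_L2:
  fixes f g :: "'y::euclidean_space \<Rightarrow> complex"
  assumes [measurable]: "f \<in> borel_measurable borel" "g \<in> borel_measurable borel"
    and f: "(\<integral>\<^sup>+y. ennreal ((norm (f y))\<^sup>2) \<partial>lborel) < \<infinity>"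
    and g: "\<And>y. norm (g y) \<le> B" "\<And>y. R < norm y \<Longrightarrow> g y = 0"
  shows "integrable lborel (\<lambda>y. g y * f y)"
proof (rule integrableI_bounded)
  have [measurable]: "cball (0::'y) R \<in> sets borel" by simp
  have B: "0 \<le> B" using g(1)[of 0] norm_ge_zero order_trans by blast
  have "ennreal (norm (g y * f y)) \<le> ennreal B * indicator (cball 0 R) y + ennreal B * ennreal ((norm (f y))\<^sup>2)" for y
  proof (cases "y \<in> cball 0 R")
    case True
    have "norm (f y) \<le> 1 + (norm (f y))\<^sup>2"
      using sum_squares_ge_zero[of "norm (f y) - 1" "norm (f y)"] by (simp add: power2_eq_square algebra_simps)
    then have "norm (g y * f y) \<le> B * (1 + (norm (f y))\<^sup>2)"
      unfolding norm_mult using g(1)[of y] B by (intro mult_mono) auto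
    then have "ennreal (norm (g y * f y)) \<le> ennreal (B * 1 + B * (norm (f y))\<^sup>2)"
      by (intro ennreal_leI) (simp add: distrib_left)
    also have "\<dots> = ennreal B * 1 + ennreal B * ennreal ((norm (f y))\<^sup>2)"
      using B by (subst ennreal_plus) (auto simp: ennreal_mult)
    finally show ?thesis using True by simp
  qed (use g(2) in auto)
  then have "(\<integral>\<^sup>+y. ennreal (norm (g y * f y)) \<partial>lborel)
      \<le> (\<integral>\<^sup>+y. ennreal B * indicator (cball 0 R) y + ennreal B * ennreal ((norm (f y))\<^sup>2) \<partial>lborel)"
    by (intro nn_integral_mono)
  also have "\<dots> = ennreal B * emeasure lborel (cball 0 R :: 'y set) + ennreal B * (\<integral>\<^sup>+y. ennreal ((norm (f y))\<^sup>2) \<partial>lborel)"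
    by (subst nn_integral_add)
       (simp_all add: nn_integral_cmult nn_integral_cmult_indicator)
  also have "\<dots> < \<infinity>"
    using f emeasure_lborel_cball_finite[of "0 :: 'y" R] by (auto simp: ennreal_mult_less_top)
  finally show "(\<integral>\<^sup>+y. ennreal (norm (g y * f y)) \<partial>lborel) < \<infinity>" .
qed measurable

lemma lborel_tensor:
  fixes u v :: "'y::euclidean_space \<Rightarrow> complex"
  assumes u: "integrable lborel u" and v: "integrable lborel v"
  shows "integrable lborel (\<lambda>w. u (fst w) * v (snd w))"
    and "(\<integral>w. u (fst w) * v (snd w) \<partial>lborel) = integral\<^sup>L lborel u * integral\<^sup>L lborel v"
proof -
  have [measurable]: "u \<in> borel_measurable borel" "v \<in> borel_measurable borel"
    using u v by (auto dest: borel_measurable_integrable)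
  have i: "integrable (lborel \<Otimes>\<^sub>M lborel) (\<lambda>w. u (fst w) * v (snd w))"
    by (rule lborel_pair.Fubini_integrable) (use u v in \<open>auto simp: norm_mult\<close>)
  then show "integrable lborel (\<lambda>w. u (fst w) * v (snd w))" by (simp add: lborel_prod)
  show "(\<integral>w. u (fst w) * v (snd w) \<partial>lborel) = integral\<^sup>L lborel u * integral\<^sup>L lborel v"
    using lborel_pair.integral_fst'[OF i] by (simp add: lborel_prod)
qed

text \<open>
  Expanding the square and exchanging integrals turns the left-hand side into the quadratic form of
  \<open>f\<close> with the kernel \<open>G y y' = \<integral> k x y * cnj (k x y')\<close>. As \<open>norm (G y y')\<close> is symmetric,
  \<open>2 * a * b \<le> a\<^sup>2 + b\<^sup>2\<close> reduces it to the row sums of \<open>norm (G y y')\<close>.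
\<close>

lemma TstarT_Schur:
  fixes k :: "'x::euclidean_space \<Rightarrow> 'y::euclidean_space \<Rightarrow> complex" and A :: ennreal
  assumes k: "case_prod k \<in> borel_measurable (borel \<Otimes>\<^sub>M borel)"
    and kB: "\<And>x y. norm (k x y) \<le> B"
    and kx: "\<And>x y. R < norm x \<Longrightarrow> k x y = 0" and ky: "\<And>x y. R < norm y \<Longrightarrow> k x y = 0"
    and A: "\<And>y. (\<integral>\<^sup>+y'. ennreal (norm (\<integral>x. k x y * cnj (k x y') \<partial>lborel)) \<partial>lborel) \<le> A"
    and f [measurable]: "f \<in> borel_measurable borel"
    and f2: "(\<integral>\<^sup>+y. ennreal ((norm (f y))\<^sup>2) \<partial>lborel) < \<infinity>"
  shows "(\<integral>\<^sup>+x. ennreal ((norm (\<integral>y. k x y * f y \<partial>lborel))\<^sup>2) \<partial>lborel)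
    \<le> A * (\<integral>\<^sup>+y. ennreal ((norm (f y))\<^sup>2) \<partial>lborel)"
proof -
  have km [measurable (raw)]: "(\<lambda>z. k (p z) (q z)) \<in> borel_measurable M"
    if "p \<in> borel_measurable M" "q \<in> borel_measurable M" for p q and M :: "'z measure"
    using measurable_compose[OF measurable_Pair[OF that] k] by simp
  have B: "0 \<le> B" using kB[of 0 0] norm_ge_zero order_trans by blast
  define u where "u x y = k x y * f y" for x y
  define h where "h x = (\<integral>y. u x y \<partial>lborel)" for x
  have um [measurable (raw)]: "(\<lambda>z. u (p z) (q z)) \<in> borel_measurable M"
    if [measurable]: "p \<in> borel_measurable M" "q \<in> borel_measurable M" for p q and M :: "'z measure"
    unfolding u_def by measurable
  have ui: "integrable lborel (u x)" for x
    unfolding u_def using kB ky by (intro integrable_bounded_mult_L2[OF _ _ f2]) auto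
  have [measurable]: "cball (0::'y) R \<in> sets borel" "cball (0::'x) R \<in> sets borel" by simp_all
  \<comment> \<open>\<open>f\<close> is integrable on the ball that contains the \<open>y\<close>-support of \<open>k\<close>, which dominates the triple integral.\<close>
  define F where "F y = indicator (cball 0 R) y * norm (f y)" for y :: 'y
  have Fi: "integrable lborel F"
  proof -
    have "integrable lborel (\<lambda>y. norm (complex_of_real (indicator (cball 0 R) y) * f y))"
      by (intro integrable_norm integrable_bounded_mult_L2[OF _ _ f2, where B = 1 and R = R]) (auto simp: indicator_def)
    then show ?thesis by (simp add: F_def[abs_def] norm_mult)
  qed
  have [measurable]: "F \<in> borel_measurable borel" unfolding F_def by measurable
  have F0: "0 \<le> F y" for y by (simp add: F_def)
  have uF: "norm (u x y) \<le> B * indicator (cball 0 R) x * F y" for x y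
    using kB[of x y] kx[of x y] ky[of y x]
    by (cases "R < norm x"; cases "R < norm y")
       (auto simp: u_def F_def norm_mult indicator_def intro!: mult_right_mono)
  define \<Phi> where "\<Phi> x w = u x (fst w) * cnj (u x (snd w))" for x w
  have inner: "(\<integral>w. \<Phi> x w \<partial>lborel) = h x * cnj (h x)" for x
    using lborel_tensor(2)[OF ui[of x] integrable_cnj[OF ui[of x]]]
    by (simp add: \<Phi>_def h_def)
  have \<Phi>i: "integrable (lborel \<Otimes>\<^sub>M lborel) (case_prod \<Phi>)"
  proof (rule Bochner_Integration.integrable_bound)
    define W where "W w = F (fst w) * F (snd w)" for w
    have "integrable lborel (\<lambda>w. complex_of_real (F (fst w)) * complex_of_real (F (snd w)))"
      by (intro lborel_tensor integrable_of_real Fi)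
    from integrable_norm[OF this] have Wi: "integrable lborel W"
      using F0 by (simp add: W_def[abs_def] norm_mult)
    have [measurable]: "W \<in> borel_measurable borel" using Wi by (auto dest: borel_measurable_integrable)
    show "integrable (lborel \<Otimes>\<^sub>M lborel) (\<lambda>z. (B\<^sup>2 * indicator (cball (0::'x) R) (fst z)) * W (snd z))"
    proof (rule lborel_pair.Fubini_integrable)
      show "integrable lborel (\<lambda>x. \<integral>w. norm (B\<^sup>2 * indicator (cball 0 R) (fst (x :: 'x, w)) * W (snd (x, w))) \<partial>lborel)"
        using emeasure_lborel_cball_finite[of "0 :: 'x" R]
        by (auto simp: abs_mult intro!: integrable_real_indicator)
    qed (use Wi in auto)
    have "norm (\<Phi> x w) \<le> B\<^sup>2 * indicator (cball 0 R) x * W w" for x w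
    proof -
      have "norm (\<Phi> x w) \<le> (B * indicator (cball 0 R) x * F (fst w)) * (B * indicator (cball 0 R) x * F (snd w))"
        using B F0 uF[of x "fst w"] uF[of x "snd w"]
        by (auto simp: \<Phi>_def norm_mult intro!: mult_mono mult_nonneg_nonneg)
      also have "\<dots> = B\<^sup>2 * indicator (cball 0 R) x * W w"
        by (auto simp: W_def indicator_def power2_eq_square)
      finally show ?thesis .
    qed
    then show "AE z in lborel \<Otimes>\<^sub>M lborel. norm (case_prod \<Phi> z)
        \<le> norm (B\<^sup>2 * indicator (cball 0 R) (fst z) * W (snd z))"
      by (intro AE_I2) (auto intro: order_trans[OF _ abs_ge_self])
  next
    have [measurable]: "(\<lambda>z::'x \<times> ('y \<times> 'y). fst (snd z)) \<in> borel_measurable (lborel \<Otimes>\<^sub>M lborel)"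
      "(\<lambda>z::'x \<times> ('y \<times> 'y). snd (snd z)) \<in> borel_measurable (lborel \<Otimes>\<^sub>M lborel)"
      by (auto simp: lborel_prod intro!: borel_measurable_continuous_onI continuous_intros)
    show "case_prod \<Phi> \<in> borel_measurable (lborel \<Otimes>\<^sub>M lborel)"
      unfolding \<Phi>_def split_def by (intro borel_measurable_times borel_measurable_cnj um) measurable
  qed
  define G where "G y y' = (\<integral>x. k x y * cnj (k x y') \<partial>lborel)" for y y'
  have Gm [measurable]: "(\<lambda>w. G (fst w) (snd w)) \<in> borel_measurable (borel \<Otimes>\<^sub>M borel)"
    unfolding G_def by measurable
  have [measurable]: "G y \<in> borel_measurable borel" "(\<lambda>y. G y y') \<in> borel_measurable borel" for y y'
    unfolding G_def by measurable
  have outer: "(\<integral>x. \<Phi> x w \<partial>lborel) = f (fst w) * cnj (f (snd w)) * G (fst w) (snd w)" for w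
  proof -
    have "(\<integral>x. \<Phi> x w \<partial>lborel) = (\<integral>x. (f (fst w) * cnj (f (snd w))) * (k x (fst w) * cnj (k x (snd w))) \<partial>lborel)"
      by (intro Bochner_Integration.integral_cong) (auto simp: \<Phi>_def u_def)
    then show ?thesis by (simp add: G_def)
  qed
  have hi: "integrable lborel (\<lambda>x. h x * cnj (h x))"
    using lborel_pair.integrable_fst[OF \<Phi>i] by (simp add: inner)
  have oi: "integrable lborel (\<lambda>w. f (fst w) * cnj (f (snd w)) * G (fst w) (snd w))"
    using lborel_pair.integrable_snd[OF \<Phi>i] by (simp add: outer)
  have eq: "(\<integral>x. h x * cnj (h x) \<partial>lborel) = (\<integral>w. f (fst w) * cnj (f (snd w)) * G (fst w) (snd w) \<partial>lborel)"
    using lborel_pair.Fubini_integral[OF \<Phi>i] by (simp add: inner outer)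
  have hh: "h x * cnj (h x) = complex_of_real ((norm (h x))\<^sup>2)" for x
    by (rule complex_norm_square[symmetric])
  define X where "X = (\<integral>\<^sup>+y. ennreal ((norm (f y))\<^sup>2) \<partial>lborel)"
  have Gsym: "norm (G y' y) = norm (G y y')" for y y'
  proof -
    have "cnj (G y y') = (\<integral>x. cnj (k x y * cnj (k x y')) \<partial>lborel)"
      unfolding G_def by (rule Bochner_Integration.integral_cnj[symmetric])
    then have "G y' y = cnj (G y y')" by (simp add: G_def mult.commute)
    then show ?thesis by simp
  qed
  have "(\<integral>\<^sup>+x. ennreal ((norm (h x))\<^sup>2) \<partial>lborel) = ennreal (\<integral>x. (norm (h x))\<^sup>2 \<partial>lborel)"
    using integrable_norm[OF hi] by (intro nn_integral_eq_integral) (auto simp: norm_mult power2_eq_square)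
  also have "(\<integral>x. (norm (h x))\<^sup>2 \<partial>lborel) = norm (\<integral>x. h x * cnj (h x) \<partial>lborel)"
    unfolding hh integral_complex_of_real by (simp add: integral_nonneg_AE)
  also have "ennreal \<dots> \<le> (\<integral>\<^sup>+w. ennreal (norm (f (fst w) * cnj (f (snd w)) * G (fst w) (snd w))) \<partial>lborel)"
    unfolding eq by (rule integral_norm_bound_ennreal[OF oi])
  also have "\<dots> \<le> (\<integral>\<^sup>+w. ennreal (1/2) * (ennreal ((norm (f (fst w)))\<^sup>2) * ennreal (norm (G (fst w) (snd w)))
      + ennreal ((norm (f (snd w)))\<^sup>2) * ennreal (norm (G (fst w) (snd w)))) \<partial>lborel)"
  proof (intro nn_integral_mono)
    fix w :: "'y \<times> 'y"
    let ?a = "norm (f (fst w))" and ?b = "norm (f (snd w))" and ?g = "norm (G (fst w) (snd w))"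
    have "?a * ?b \<le> 1/2 * (?a\<^sup>2 + ?b\<^sup>2)" using sum_squares_bound[of ?a ?b] by simp
    then have "?a * ?b * ?g \<le> 1/2 * (?a\<^sup>2 + ?b\<^sup>2) * ?g" by (rule mult_right_mono) simp
    then have "ennreal (?a * ?b * ?g) \<le> ennreal (1/2 * (?a\<^sup>2 * ?g + ?b\<^sup>2 * ?g))"
      by (intro ennreal_leI) (simp add: algebra_simps)
    also have "\<dots> = ennreal (1/2) * (ennreal (?a\<^sup>2) * ennreal ?g + ennreal (?b\<^sup>2) * ennreal ?g)"
      by (subst ennreal_mult) (auto simp: ennreal_plus ennreal_mult)
    finally show "ennreal (norm (f (fst w) * cnj (f (snd w)) * G (fst w) (snd w)))
        \<le> ennreal (1/2) * (ennreal (?a\<^sup>2) * ennreal ?g + ennreal (?b\<^sup>2) * ennreal ?g)"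
      by (simp add: norm_mult)
  qed
  also have "\<dots> = ennreal (1/2) * ((\<integral>\<^sup>+w. ennreal ((norm (f (fst w)))\<^sup>2) * ennreal (norm (G (fst w) (snd w))) \<partial>(lborel \<Otimes>\<^sub>M lborel))
      + (\<integral>\<^sup>+w. ennreal ((norm (f (snd w)))\<^sup>2) * ennreal (norm (G (fst w) (snd w))) \<partial>(lborel \<Otimes>\<^sub>M lborel)))"
    unfolding lborel_prod[symmetric] by (subst nn_integral_cmult; (subst nn_integral_add)?) measurable
  also have "(\<integral>\<^sup>+w. ennreal ((norm (f (fst w)))\<^sup>2) * ennreal (norm (G (fst w) (snd w))) \<partial>(lborel \<Otimes>\<^sub>M lborel))
      = (\<integral>\<^sup>+y. ennreal ((norm (f y))\<^sup>2) * (\<integral>\<^sup>+y'. ennreal (norm (G y y')) \<partial>lborel) \<partial>lborel)"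
    by (subst lborel.nn_integral_fst[symmetric]) (auto simp: nn_integral_cmult)
  also have "(\<integral>\<^sup>+w. ennreal ((norm (f (snd w)))\<^sup>2) * ennreal (norm (G (fst w) (snd w))) \<partial>(lborel \<Otimes>\<^sub>M lborel))
      = (\<integral>\<^sup>+y'. ennreal ((norm (f y'))\<^sup>2) * (\<integral>\<^sup>+y. ennreal (norm (G y' y)) \<partial>lborel) \<partial>lborel)"
    by (subst lborel_pair.nn_integral_snd[symmetric]) (auto simp: nn_integral_cmult Gsym)
  also have "ennreal (1/2) * ((\<integral>\<^sup>+y. ennreal ((norm (f y))\<^sup>2) * (\<integral>\<^sup>+y'. ennreal (norm (G y y')) \<partial>lborel) \<partial>lborel)
      + (\<integral>\<^sup>+y'. ennreal ((norm (f y'))\<^sup>2) * (\<integral>\<^sup>+y. ennreal (norm (G y' y)) \<partial>lborel) \<partial>lborel))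
    \<le> ennreal (1/2) * ((\<integral>\<^sup>+y. ennreal ((norm (f y))\<^sup>2) * A \<partial>lborel) + (\<integral>\<^sup>+y. ennreal ((norm (f y))\<^sup>2) * A \<partial>lborel))"
    using A unfolding G_def by (intro mult_left_mono add_mono nn_integral_mono) auto
  also have "(\<integral>\<^sup>+y. ennreal ((norm (f y))\<^sup>2) * A \<partial>lborel) = A * X"
    by (simp add: nn_integral_cmult X_def mult.commute)
  also have "ennreal (1/2) * (A * X + A * X) = (ennreal (1/2) * ennreal 2) * (A * X)"
    unfolding mult_2[symmetric] by (simp only: mult.assoc ennreal_numeral)
  also have "ennreal (1/2) * ennreal 2 = 1" by (subst ennreal_mult[symmetric]) auto
  finally show ?thesis by (simp add: h_def u_def X_def)
qed

lemma compact_support_bound: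
  assumes "smooth_compactly_supported \<psi>"
  obtains R where "1 \<le> R" "\<And>x (y::'y::euclidean_space). R < norm x \<or> R < norm y \<Longrightarrow> \<psi> (x :: 'x::euclidean_space, y) = 0"
    "\<And>x y. \<psi> (x, y) \<noteq> 0 \<Longrightarrow> norm x + norm y \<le> R"
proof -
  have "bounded {z. \<psi> z \<noteq> 0}"
    using assms compact_imp_bounded bounded_subset[OF _ closure_subset]
    unfolding smooth_compactly_supported_def by blast
  then obtain a where a: "\<And>z. \<psi> z \<noteq> 0 \<Longrightarrow> norm z \<le> a" unfolding bounded_iff by blast
  have ab: "norm x \<le> a \<and> norm y \<le> a" if "\<psi> (x, y) \<noteq> 0" for x y
    using a[OF that] norm_fst_le[of x y] norm_snd_le[of y x] by linarith
  show thesis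
  proof (rule that[of "max 1 (2 * max 0 a)"])
    fix x y
    show "\<psi> (x, y) = 0" if "max 1 (2 * max 0 a) < norm x \<or> max 1 (2 * max 0 a) < norm y"
      by (rule ccontr) (use ab[of x y] that in \<open>auto simp: max_def split: if_splits\<close>)
    show "norm x + norm y \<le> max 1 (2 * max 0 a)" if "\<psi> (x, y) \<noteq> 0"
      using ab[OF that] by (auto simp: max_def)
  qed simp
qed

lemma scale_kernel_measurable:
  assumes "smooth_compactly_supported \<psi>"
    and p: "p \<in> borel_measurable N" and q: "q \<in> borel_measurable N" and r [measurable]: "r \<in> borel_measurable N"
  shows "(\<lambda>z. scale_kernel \<gamma> \<psi> lam M (r z) (p z) (q z)) \<in> borel_measurable N"
proof -
  note [measurable] = smooth_measurable[OF assms(1)]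
  have [measurable]: "(\<lambda>z. p z - (q z, 0)) \<in> borel_measurable N"
    using p q by (intro borel_measurable_diff borel_measurable_Pair) auto
  have [measurable]: "(\<lambda>z. \<psi> (p z, q z)) \<in> borel_measurable N"
    by (rule measurable_compose[OF borel_measurable_Pair[OF p q] smooth_measurable[OF assms(1)]])
  show ?thesis unfolding scale_kernel_def by measurable
qed

text \<open>
  Row sums of the kernel of \<open>adjoint (T r) \<circ> T r\<close>: the support condition \<open>norm (y - y') \<le> 4 * r\<close> gives
  \<open>r ^ (d + 1) * r ^ d\<close>, and the decay gives \<open>r ^ (d + 1) * (lam * r powr (\<gamma> - 1)) ^ - d\<close>, where
  \<open>d = DIM('y)\<close>. The smaller of the two is used. Decay of order \<open>d + 1\<close> suffices for integrability on
  \<open>R^d\<close>, whence the exponent \<open>M\<close> of the cutoff.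
\<close>

lemma scale_operator_bound:
  fixes \<psi> :: "('y::euclidean_space \<times> real) \<times> 'y \<Rightarrow> complex"
  assumes \<gamma>: "1 < \<gamma>" and \<psi>: "smooth_compactly_supported \<psi>" and R: "0 < R" and M: "Suc DIM('y) < M"
  obtains C where "0 < C"
    "\<And>lam r f. 0 < lam \<Longrightarrow> 0 < r \<Longrightarrow> r \<le> R \<Longrightarrow> f \<in> borel_measurable borel \<Longrightarrow>
       (\<integral>\<^sup>+y. ennreal ((norm (f y :: complex))\<^sup>2) \<partial>lborel) < \<infinity> \<Longrightarrow>
       (\<integral>\<^sup>+x. ennreal ((norm (\<integral>y. scale_kernel \<gamma> \<psi> lam M r x y * f y \<partial>lborel))\<^sup>2) \<partial>lborel)
       \<le> ennreal (C * r ^ (2 * DIM('y) + 1) * min 1 (1 / (lam * r powr \<gamma>) ^ DIM('y)))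
           * (\<integral>\<^sup>+y. ennreal ((norm (f y))\<^sup>2) \<partial>lborel)"
proof -
  let ?d = "DIM('y)"
  define G where "G lam r y y' = (\<integral>x. scale_kernel \<gamma> \<psi> lam M r x y * cnj (scale_kernel \<gamma> \<psi> lam M r x y') \<partial>lborel)"
    for lam r y y'
  obtain C where C: "0 \<le> C"
    "\<And>lam r y y'. 0 < lam \<Longrightarrow> 0 < r \<Longrightarrow> r \<le> R \<Longrightarrow> norm (G lam r y y') \<le> C * r ^ (?d + 1)"
    "\<And>lam r y y'. 0 < lam \<Longrightarrow> 0 < r \<Longrightarrow> r \<le> R \<Longrightarrow> y \<noteq> y' \<Longrightarrow>
       norm (G lam r y y') \<le> C * r ^ (?d + 1) / (lam * r powr (\<gamma> - 1) * norm (y - y')) ^ Suc ?d"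
    "\<And>lam r y y'. 0 < r \<Longrightarrow> 4 * r < norm (y - y') \<Longrightarrow> G lam r y y' = 0"
    unfolding G_def by (rule scale_kernel_TstarT_bound[OF \<gamma> \<psi> M R]) blast
  define V where "V = unit_ball_vol (real ?d)"
  have V: "0 \<le> V" by (simp add: V_def unit_ball_vol_nonneg)
  define D where "D = max 1 (C * V * max (4 ^ ?d) (real (Suc ?d)))"
  obtain S where S: "1 \<le> S" "\<And>x y. S < norm x \<or> S < norm y \<Longrightarrow> \<psi> (x, y) = 0"
    "\<And>x y. \<psi> (x, y) \<noteq> 0 \<Longrightarrow> norm x + norm y \<le> S"
    using compact_support_bound[OF \<psi>] by blast
  obtain P where P: "0 \<le> P" "\<And>z. norm (\<psi> z) \<le> P"
    using continuous_compact_support_bounded[OF smooth_continuous[OF \<psi>]] \<psi>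
    unfolding smooth_compactly_supported_def by blast
  show thesis
  proof (rule that[of D])
    fix lam r :: real and f :: "'y \<Rightarrow> complex"
    assume lr: "0 < lam" "0 < r" "r \<le> R" and f: "f \<in> borel_measurable borel"
      "(\<integral>\<^sup>+y. ennreal ((norm (f y))\<^sup>2) \<partial>lborel) < \<infinity>"
    define \<mu> where "\<mu> = lam * r powr (\<gamma> - 1)"
    have \<mu>: "0 < \<mu>" using lr by (simp add: \<mu>_def)
    have Gm [measurable]: "G lam r y \<in> borel_measurable borel" for y
      unfolding G_def
      by (intro lborel.borel_measurable_lebesgue_integral)
         (auto simp: split_def intro!: borel_measurable_times borel_measurable_cnj scale_kernel_measurable[OF \<psi>])
    have near: "(\<integral>\<^sup>+y'. ennreal (norm (G lam r y y')) \<partial>lborel) \<le> ennreal (C * r ^ (?d + 1) * (V * (4 * r) ^ ?d))" for y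
    proof -
      have "(\<integral>\<^sup>+y'. ennreal (norm (G lam r y y')) \<partial>lborel)
          \<le> (\<integral>\<^sup>+y'. ennreal (C * r ^ (?d + 1)) * indicator (cball y (4 * r)) y' \<partial>lborel)"
      proof (intro nn_integral_mono)
        fix y'
        show "ennreal (norm (G lam r y y')) \<le> ennreal (C * r ^ (?d + 1)) * indicator (cball y (4 * r)) y'"
          using C(2)[OF lr, of y y'] C(4)[OF lr(2), of y y' lam]
          by (cases "norm (y - y') \<le> 4 * r") (auto simp: dist_norm intro: ennreal_leI)
      qed
      also have "\<dots> = ennreal (C * r ^ (?d + 1)) * ennreal (V * (4 * r) ^ ?d)"
        using lr by (subst nn_integral_cmult_indicator) (auto simp: emeasure_cball V_def)
      also have "\<dots> = ennreal (C * r ^ (?d + 1) * (V * (4 * r) ^ ?d))"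
        using lr V C(1) by (intro ennreal_mult[symmetric]) auto
      finally show ?thesis .
    qed
    have far: "(\<integral>\<^sup>+y'. ennreal (norm (G lam r y y')) \<partial>lborel)
        \<le> ennreal (C * r ^ (?d + 1) * (V * real (Suc ?d) / \<mu> ^ ?d))" for y
    proof -
      have "(\<integral>\<^sup>+y'. ennreal (norm (G lam r y y')) \<partial>lborel)
          \<le> (\<integral>\<^sup>+y'. ennreal (C * r ^ (?d + 1)) * ennreal (min 1 (1 / (\<mu> * norm (y - y')) ^ Suc ?d)) \<partial>lborel)"
      proof (intro nn_integral_mono_AE, rule eventually_mono[OF AE_lborel_singleton[of y]])
        fix y' assume "y' \<noteq> y"
        then have "norm (G lam r y y') \<le> C * r ^ (?d + 1) * min 1 (1 / (\<mu> * norm (y - y')) ^ Suc ?d)"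
          using C(2)[OF lr, of y y'] C(3)[OF lr, of y y'] by (auto simp: min_def \<mu>_def)
        then have "ennreal (norm (G lam r y y')) \<le> ennreal (C * r ^ (?d + 1) * min 1 (1 / (\<mu> * norm (y - y')) ^ Suc ?d))"
          by (rule ennreal_leI)
        also have "\<dots> = ennreal (C * r ^ (?d + 1)) * ennreal (min 1 (1 / (\<mu> * norm (y - y')) ^ Suc ?d))"
          using C(1) lr \<mu> by (intro ennreal_mult) auto
        finally show "ennreal (norm (G lam r y y'))
            \<le> ennreal (C * r ^ (?d + 1)) * ennreal (min 1 (1 / (\<mu> * norm (y - y')) ^ Suc ?d))" .
      qed
      also have "\<dots> = ennreal (C * r ^ (?d + 1)) * (\<integral>\<^sup>+y'. ennreal (min 1 (1 / (\<mu> * norm (y - y')) ^ Suc ?d)) \<partial>lborel)"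
        by (rule nn_integral_cmult) measurable
      also have "\<dots> \<le> ennreal (C * r ^ (?d + 1)) * ennreal (V * real (Suc ?d) / \<mu> ^ ?d)"
        unfolding V_def by (intro mult_left_mono nn_integral_min_inverse_power_le \<mu>) auto
      also have "\<dots> = ennreal (C * r ^ (?d + 1) * (V * real (Suc ?d) / \<mu> ^ ?d))"
        using lr V C(1) \<mu> by (intro ennreal_mult[symmetric]) auto
      finally show ?thesis .
    qed
    have schur: "(\<integral>\<^sup>+y'. ennreal (norm (G lam r y y')) \<partial>lborel)
        \<le> ennreal (D * r ^ (2 * ?d + 1) * min 1 (1 / (lam * r powr \<gamma>) ^ ?d))" for y
    proof (cases "1 \<le> 1 / (lam * r powr \<gamma>) ^ ?d")
      case True
      have "C * r ^ (?d + 1) * (V * (4 * r) ^ ?d) = (C * V * 4 ^ ?d) * r ^ (2 * ?d + 1)"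
        by (simp add: power_mult_distrib mult_2 power_add)
      also have "\<dots> \<le> D * r ^ (2 * ?d + 1)"
        using lr C(1) V by (intro mult_right_mono) (auto simp: D_def le_max_iff_disj intro!: disjI2 mult_left_mono)
      finally show ?thesis using True near[of y] by (auto intro: order_trans ennreal_leI simp: min_absorb1)
    next
      case False
      have "r powr \<gamma> = r powr (\<gamma> - 1) * r" using lr powr_add[of r "\<gamma> - 1" 1] by simp
      then have \<mu>r: "lam * r powr \<gamma> = \<mu> * r" by (simp add: \<mu>_def)
      have "C * r ^ (?d + 1) * (V * real (Suc ?d) / \<mu> ^ ?d)
          = (C * V * real (Suc ?d)) * (r ^ (2 * ?d + 1) * (1 / (lam * r powr \<gamma>) ^ ?d))"
      proof -
        have "r ^ (2 * ?d + 1) = r ^ (?d + 1) * r ^ ?d" by (simp add: mult_2 power_add)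
        then show ?thesis unfolding \<mu>r power_mult_distrib using lr \<mu> by simp
      qed
      also have "\<dots> \<le> D * (r ^ (2 * ?d + 1) * (1 / (lam * r powr \<gamma>) ^ ?d))"
        using lr C(1) V by (intro mult_right_mono) (auto simp: D_def le_max_iff_disj intro!: disjI2 mult_left_mono)
      finally show ?thesis using False far[of y]
        by (auto intro: order_trans ennreal_leI simp: min_absorb2 mult.assoc)
    qed
    show "(\<integral>\<^sup>+x. ennreal ((norm (\<integral>y. scale_kernel \<gamma> \<psi> lam M r x y * f y \<partial>lborel))\<^sup>2) \<partial>lborel)
       \<le> ennreal (D * r ^ (2 * ?d + 1) * min 1 (1 / (lam * r powr \<gamma>) ^ ?d))
           * (\<integral>\<^sup>+y. ennreal ((norm (f y))\<^sup>2) \<partial>lborel)"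
    proof (rule TstarT_Schur[OF _ _ _ _ schur[unfolded G_def] f])
      show "case_prod (scale_kernel \<gamma> \<psi> lam M r) \<in> borel_measurable (borel \<Otimes>\<^sub>M borel)"
        unfolding split_def by (intro scale_kernel_measurable[OF \<psi>]) measurable
      show "norm (scale_kernel \<gamma> \<psi> lam M r x y) \<le> P * (9/4) ^ M" for x y
        unfolding scale_kernel_def
        using mult_mono[OF P(2)[of "(x, y)"] cutoff_le[of M "(x - (y, 0)) /\<^sub>R r"]] P(1)
        by (simp add: norm_mult cutoff_nonneg)
      show "scale_kernel \<gamma> \<psi> lam M r x y = 0" if "S < norm x" for x y
        using S(2)[of x y] that by (simp add: scale_kernel_def)
      show "scale_kernel \<gamma> \<psi> lam M r x y = 0" if "S < norm y" for x y
        using S(2)[of x y] that by (simp add: scale_kernel_def)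
    qed
  qed (simp add: D_def)
qed

section \<open>Superposition of scales\<close>

lemma cutoff_scaled: "0 < r \<Longrightarrow> cutoff M (z /\<^sub>R r) = cutoff M (norm z / r)"
  by (simp add: cutoff_def divide_inverse mult.commute)

text \<open>
  The density in \<open>r\<close> whose integral reproduces \<open>s powr (- \<beta>)\<close> up to the constant \<open>scale_mass M \<beta>\<close>; here
  \<open>s\<close> stands for \<open>norm z\<close>, and the cutoff is the one on \<open>real\<close>.
\<close>

definition scale_weight :: "nat \<Rightarrow> real \<Rightarrow> real \<Rightarrow> real \<Rightarrow> real" where
  "scale_weight M \<beta> s r = indicator {0<..} r * cutoff M (s / r) * r powr (- \<beta> - 1)"

lemma scale_weight_nonneg: "0 \<le> scale_weight M \<beta> s r"
  by (simp add: scale_weight_def cutoff_nonneg)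

lemma scale_weight_measurable [measurable (raw)]:
  assumes [measurable]: "f \<in> borel_measurable N" "g \<in> borel_measurable N"
  shows "(\<lambda>z. scale_weight M \<beta> (f z) (g z)) \<in> borel_measurable N"
  unfolding scale_weight_def by measurable

lemma scale_weight_eq_0: "0 < M \<Longrightarrow> 0 < s \<Longrightarrow> r \<notin> {s/2..s} \<Longrightarrow> scale_weight M \<beta> s r = 0"
  using cutoff_eq_0[of "s / r" M]
  by (cases "0 < r") (auto simp: scale_weight_def annulus_def field_simps)

lemma scale_weight_integrable:
  assumes "0 < M" "0 < s" "0 < \<beta>"
  shows "integrable lborel (scale_weight M \<beta> s)"
proof (rule Bochner_Integration.integrable_bound)
  show "integrable lborel (\<lambda>r. (9/4) ^ M * (s/2) powr (- \<beta> - 1) * indicator {s/2..s} r :: real)"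
    by (intro integrable_mult_right integrable_real_indicator) (auto simp: emeasure_lborel_Icc_eq)
  have "scale_weight M \<beta> s r \<le> (9/4) ^ M * (s/2) powr (- \<beta> - 1) * indicator {s/2..s} r" for r
  proof (cases "r \<in> {s/2..s}")
    case True
    have "cutoff M (s / r) * r powr (- \<beta> - 1) \<le> (9/4) ^ M * (s/2) powr (- \<beta> - 1)"
      using True assms by (intro mult_mono cutoff_le powr_mono2') (auto simp: cutoff_nonneg)
    then show ?thesis using True assms by (simp add: scale_weight_def)
  qed (use scale_weight_eq_0[OF assms(1,2)] in simp)
  then show "AE r in lborel. norm (scale_weight M \<beta> s r)
      \<le> norm ((9/4) ^ M * (s/2) powr (- \<beta> - 1) * indicator {s/2..s} r :: real)"
    by (intro AE_I2) (auto simp: scale_weight_nonneg)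
qed measurable

definition scale_mass :: "nat \<Rightarrow> real \<Rightarrow> real" where
  "scale_mass M \<beta> = integral\<^sup>L lborel (scale_weight M \<beta> 1)"

lemma integral_scale_weight:
  assumes "0 < s"
  shows "integral\<^sup>L lborel (scale_weight M \<beta> s) = s powr (- \<beta>) * scale_mass M \<beta>"
proof -
  have "scale_weight M \<beta> s (0 + s * t) = s powr (- \<beta> - 1) * scale_weight M \<beta> 1 t" for t
    using assms by (cases "0 < t") (auto simp: scale_weight_def powr_mult zero_less_mult_iff)
  then have "integral\<^sup>L lborel (scale_weight M \<beta> s) = s * (s powr (- \<beta> - 1) * scale_mass M \<beta>)"
    using assms by (subst lborel_integral_real_affine[of s _ 0]) (auto simp: scale_mass_def)
  moreover have "s * s powr (- \<beta> - 1) = s powr (- \<beta>)"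
    using assms powr_add[of s 1 "- \<beta> - 1"] by simp
  ultimately show ?thesis by (simp add: mult.assoc[symmetric])
qed

lemma scale_mass_pos:
  assumes "0 < M" "0 < \<beta>"
  shows "0 < scale_mass M \<beta>"
proof -
  \<comment> \<open>Any interval inside \<open>(1/2, 1)\<close> serves; on this one both factors of the cutoff are at least \<open>1/2\<close>.\<close>
  have le: "(1/2) ^ M * indicator {5/8..3/4} r \<le> scale_weight M \<beta> 1 r" for r :: real
  proof (cases "r \<in> {5/8..3/4}")
    case True
    then have r: "5/8 \<le> r" "r \<le> 3/4" by auto
    define a where "a = (1 / r)\<^sup>2"
    have "(4/3)\<^sup>2 \<le> (1 / r)\<^sup>2" using r by (intro power_mono) (auto simp: field_simps)
    moreover have "(1 / r)\<^sup>2 \<le> (8/5)\<^sup>2" using r by (intro power_mono) (auto simp: field_simps)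
    ultimately have a: "1/2 \<le> a - 1" "1 \<le> 4 - a" by (auto simp: a_def power2_eq_square)
    have "1/2 * 1 \<le> (a - 1) * (4 - a)" using a by (intro mult_mono) auto
    then have "(1/2) ^ M \<le> max 0 ((a - 1) * (4 - a)) ^ M" by (intro power_mono) auto
    then have "(1/2) ^ M \<le> cutoff M (1 / r)" using r by (simp add: cutoff_def a_def)
    moreover have "1 \<le> r powr (- \<beta> - 1)"
      using r assms powr_mono2'[of "- \<beta> - 1" r 1] by auto
    ultimately have "(1/2) ^ M * 1 \<le> cutoff M (1 / r) * r powr (- \<beta> - 1)"
      by (intro mult_mono) (auto simp: cutoff_nonneg)
    then show ?thesis using True by (simp add: scale_weight_def)
  qed (simp add: scale_weight_nonneg)
  have "(\<integral>r. (1/2 :: real) ^ M * indicator {5/8..3/4::real} r \<partial>lborel) \<le> scale_mass M \<beta>"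
    unfolding scale_mass_def
    by (intro integral_mono le scale_weight_integrable assms integrable_mult_right integrable_real_indicator) auto
  moreover have "(\<integral>r. (1/2 :: real) ^ M * indicator {5/8..3/4::real} r \<partial>lborel) = (1/2) ^ M * (1/8)" by simp
  moreover have "0 < (1/2 :: real) ^ M * (1/8)" by simp
  ultimately show ?thesis by linarith
qed

text \<open>
  The singular factor is written as an integral over scales and the \<open>y\<close>- and \<open>r\<close>-integrals are
  exchanged. For \<open>snd x \<noteq> 0\<close> the distance from \<open>x\<close> to the points \<open>(y, 0)\<close> is bounded below, which gives
  absolute convergence. Scales \<open>r > S\<close> do not contribute, because on the support of \<open>\<psi>\<close> that distance
  is at most \<open>S\<close>.
\<close>

lemma norm_superposition_le:
  fixes \<psi> :: "('y::euclidean_space \<times> real) \<times> 'y \<Rightarrow> complex"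
  assumes \<psi>: "smooth_compactly_supported \<psi>" and M: "0 < M" and \<beta>: "0 < \<beta>"
    and S: "\<And>x y. \<psi> (x, y) \<noteq> 0 \<Longrightarrow> norm x + norm y \<le> S"
    and f [measurable]: "f \<in> borel_measurable borel"
    and f2: "(\<integral>\<^sup>+y. ennreal ((norm (f y :: complex))\<^sup>2) \<partial>lborel) < \<infinity>"
    and x: "snd x \<noteq> 0"
  shows "ennreal (scale_mass M \<beta>) * ennreal (norm (\<integral>y. exp (\<i> * complex_of_real (lam * norm (x - (y, 0)) powr \<gamma>)) * \<psi> (x, y)
      * complex_of_real (norm (x - (y, 0)) powr (- \<beta>)) * f y \<partial>lborel))
    \<le> (\<integral>\<^sup>+r. ennreal (indicator {0<..S} r * r powr (- \<beta> - 1))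
         * ennreal (norm (\<integral>y. scale_kernel \<gamma> \<psi> lam M r x y * f y \<partial>lborel)) \<partial>lborel)"
proof -
  define e where "e y = exp (\<i> * complex_of_real (lam * norm (x - (y, 0)) powr \<gamma>)) * \<psi> (x, y)" for y
  define \<rho> where "\<rho> y = norm (x - (y, 0))" for y
  have zm [measurable]: "(\<lambda>y. x - (y, 0)) \<in> borel_measurable borel"
    by (intro borel_measurable_continuous_onI continuous_intros)
  have [measurable]: "\<rho> \<in> borel_measurable borel" unfolding \<rho>_def by measurable
  have [measurable]: "(\<lambda>y. \<psi> (x, y)) \<in> borel_measurable borel"
    by (rule measurable_compose[OF borel_measurable_Pair smooth_measurable[OF \<psi>]]) auto
  have [measurable]: "e \<in> borel_measurable borel" unfolding e_def by measurable
  have \<rho>: "\<bar>snd x\<bar> \<le> \<rho> y" for y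
  proof -
    have "x - (y, 0) = (fst x - y, snd x)" by (simp add: prod_eq_iff)
    then show ?thesis using norm_snd_le[of "snd x" "fst x - y"] by (simp add: \<rho>_def)
  qed
  have \<rho>0: "0 < \<rho> y" for y using \<rho>[of y] x by linarith
  obtain P where P: "0 \<le> P" "\<And>z. norm (\<psi> z) \<le> P"
    using continuous_compact_support_bounded[OF smooth_continuous[OF \<psi>]] \<psi>
    unfolding smooth_compactly_supported_def by blast
  have eP: "norm (e y) \<le> P" for y using P(2) by (simp add: e_def norm_mult)
  have e0: "e y = 0" if "S < norm y" for y
    using S[of x y] that norm_ge_zero[of x] by (force simp: e_def)
  have ui: "integrable lborel (\<lambda>y. (e y * complex_of_real (\<rho> y powr (- \<beta>))) * f y)"
  proof (rule integrable_bounded_mult_L2[OF _ _ f2])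
    show "norm (e y * complex_of_real (\<rho> y powr (- \<beta>))) \<le> P * \<bar>snd x\<bar> powr (- \<beta>)" for y
      unfolding norm_mult using eP[of y] \<rho>[of y] x \<beta> P(1)
      by (intro mult_mono) (auto intro!: powr_mono2')
    show "e y * complex_of_real (\<rho> y powr (- \<beta>)) = 0" if "S < norm y" for y using e0[OF that] by simp
  qed measurable
  define \<Phi> where "\<Phi> y r = e y * f y * complex_of_real (scale_weight M \<beta> (\<rho> y) r)" for y r
  have w: "integrable lborel (scale_weight M \<beta> (\<rho> y))"
    "integral\<^sup>L lborel (scale_weight M \<beta> (\<rho> y)) = \<rho> y powr (- \<beta>) * scale_mass M \<beta>" for y
    by (intro scale_weight_integrable integral_scale_weight M \<rho>0 \<beta>)+
  have inner: "(\<integral>r. \<Phi> y r \<partial>lborel) = complex_of_real (scale_mass M \<beta>) * ((e y * complex_of_real (\<rho> y powr (- \<beta>))) * f y)" for y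
    using w by (simp add: \<Phi>_def integral_complex_of_real)
  have \<Phi>i: "integrable (lborel \<Otimes>\<^sub>M lborel) (case_prod \<Phi>)"
  proof (rule lborel_pair.Fubini_integrable)
    show "case_prod \<Phi> \<in> borel_measurable (lborel \<Otimes>\<^sub>M lborel)" unfolding \<Phi>_def by measurable
    have "(\<integral>r. norm (\<Phi> y r) \<partial>lborel) = scale_mass M \<beta> * norm ((e y * complex_of_real (\<rho> y powr (- \<beta>))) * f y)" for y
      using w by (simp add: \<Phi>_def norm_mult scale_weight_nonneg)
    then show "integrable lborel (\<lambda>y. \<integral>r. norm (case_prod \<Phi> (y, r)) \<partial>lborel)"
      using ui by simp
    show "AE y in lborel. integrable lborel (\<lambda>r. case_prod \<Phi> (y, r))"
      using w by (simp add: \<Phi>_def)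
  qed
  have outer: "(\<integral>y. \<Phi> y r \<partial>lborel)
      = complex_of_real (indicator {0<..S} r * r powr (- \<beta> - 1)) * (\<integral>y. scale_kernel \<gamma> \<psi> lam M r x y * f y \<partial>lborel)" for r
  proof -
    have "\<Phi> y r = complex_of_real (indicator {0<..S} r * r powr (- \<beta> - 1)) * (scale_kernel \<gamma> \<psi> lam M r x y * f y)" for y
    proof (cases "0 < r \<and> (S < r \<longrightarrow> \<psi> (x, y) = 0)")
      case True
      then show ?thesis
        by (cases "S < r")
           (auto simp: \<Phi>_def scale_weight_def e_def \<rho>_def scale_kernel_def cutoff_scaled)
    next
      case False
      show ?thesis
      proof (cases "0 < r")
        case True
        with False have "S < r" "\<psi> (x, y) \<noteq> 0" by auto
        moreover have "\<rho> y \<le> norm x + norm y"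
          using norm_triangle_ineq4[of x "(y, 0)"] by (simp add: \<rho>_def norm_Pair)
        ultimately have "\<rho> y < r" using S[of x y] by linarith
        then have "scale_weight M \<beta> (\<rho> y) r = 0" by (intro scale_weight_eq_0 M \<rho>0) auto
        with \<open>S < r\<close> show ?thesis by (simp add: \<Phi>_def)
      qed (simp add: \<Phi>_def scale_weight_def)
    qed
    then show ?thesis by simp
  qed
  have oi: "integrable lborel (\<lambda>r. complex_of_real (indicator {0<..S} r * r powr (- \<beta> - 1))
      * (\<integral>y. scale_kernel \<gamma> \<psi> lam M r x y * f y \<partial>lborel))"
    using lborel_pair.integrable_snd[OF \<Phi>i] unfolding outer .
  have "ennreal (scale_mass M \<beta>) * ennreal (norm (\<integral>y. (e y * complex_of_real (\<rho> y powr (- \<beta>))) * f y \<partial>lborel))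
      = ennreal (norm (complex_of_real (scale_mass M \<beta>) * (\<integral>y. (e y * complex_of_real (\<rho> y powr (- \<beta>))) * f y \<partial>lborel)))"
    using scale_mass_pos[OF M \<beta>] by (simp add: norm_mult ennreal_mult)
  also have "complex_of_real (scale_mass M \<beta>) * (\<integral>y. (e y * complex_of_real (\<rho> y powr (- \<beta>))) * f y \<partial>lborel)
      = (\<integral>y. (\<integral>r. \<Phi> y r \<partial>lborel) \<partial>lborel)"
    unfolding inner by simp
  also have "\<dots> = (\<integral>r. (\<integral>y. \<Phi> y r \<partial>lborel) \<partial>lborel)"
    by (rule lborel_pair.Fubini_integral[OF \<Phi>i, symmetric])
  also have "ennreal (norm \<dots>) \<le> (\<integral>\<^sup>+r. ennreal (norm (\<integral>y. \<Phi> y r \<partial>lborel)) \<partial>lborel)"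
    using oi unfolding outer by (rule integral_norm_bound_ennreal)
  also have "\<dots> = (\<integral>\<^sup>+r. ennreal (indicator {0<..S} r * r powr (- \<beta> - 1))
         * ennreal (norm (\<integral>y. scale_kernel \<gamma> \<psi> lam M r x y * f y \<partial>lborel)) \<partial>lborel)"
    unfolding outer by (intro nn_integral_cong) (simp add: norm_mult ennreal_mult abs_mult)
  finally show ?thesis unfolding e_def \<rho>_def .
qed

text \<open>
  Minkowski's integral inequality for \<open>L2\<close>: by the Cauchy--Schwarz inequality in \<open>r\<close> for the factors
  \<open>sqrt (w * N)\<close> and \<open>sqrt (w / N) * norm (T r x)\<close>, followed by Tonelli's theorem in \<open>x\<close> and \<open>r\<close>.
\<close>

lemma Minkowski_L2:
  fixes T :: "real \<Rightarrow> 'x::euclidean_space \<Rightarrow> complex"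
  assumes T: "case_prod T \<in> borel_measurable (lborel \<Otimes>\<^sub>M lborel)"
    and [measurable]: "w \<in> borel_measurable borel" "N \<in> borel_measurable borel"
    and w: "\<And>r. 0 \<le> w r" and N: "\<And>r. w r \<noteq> 0 \<Longrightarrow> 0 < N r"
    and TN: "\<And>r. w r \<noteq> 0 \<Longrightarrow> (\<integral>\<^sup>+x. ennreal ((norm (T r x))\<^sup>2) \<partial>lborel) \<le> ennreal ((N r)\<^sup>2) * X"
  shows "(\<integral>\<^sup>+x. (\<integral>\<^sup>+r. ennreal (w r) * ennreal (norm (T r x)) \<partial>lborel)\<^sup>2 \<partial>lborel)
    \<le> (\<integral>\<^sup>+r. ennreal (w r * N r) \<partial>lborel)\<^sup>2 * X"
proof -
  note T [measurable]
  have Tm [measurable]: "T r \<in> borel_measurable borel" "(\<lambda>r. T r x) \<in> borel_measurable borel" for r x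
    using measurable_compose[OF measurable_Pair[OF measurable_const measurable_ident] T, of r]
      measurable_compose[OF measurable_Pair[OF measurable_ident measurable_const] T, of x]
    by (simp_all)
  define I where "I = (\<integral>\<^sup>+r. ennreal (w r * N r) \<partial>lborel)"
  define a where "a r = sqrt (w r * N r)" for r
  define b where "b r x = sqrt (w r / N r) * norm (T r x)" for r x
  have [measurable]: "a \<in> borel_measurable borel" unfolding a_def by measurable
  have [measurable]: "(\<lambda>r. b r x) \<in> borel_measurable borel" for x unfolding b_def by measurable
  have wN: "0 \<le> w r * N r" "0 \<le> w r / N r" for r
    using w[of r] N[of r] by (cases "w r = 0"; auto)+
  have ab: "ennreal (w r) * ennreal (norm (T r x)) = ennreal (a r) * ennreal (b r x)" for r x
  proof (cases "w r = 0")
    case False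
    have "a r * b r x = w r * norm (T r x)"
      using w[of r] N[OF False] by (simp add: a_def b_def flip: real_sqrt_mult mult.assoc)
    moreover have "0 \<le> a r" "0 \<le> b r x" using wN by (auto simp: a_def b_def)
    ultimately show ?thesis using w[of r] by (simp flip: ennreal_mult)
  qed (simp add: a_def b_def)
  have a2: "(\<integral>\<^sup>+r. (ennreal (a r))\<^sup>2 \<partial>lborel) = I"
    unfolding I_def using wN by (intro nn_integral_cong) (simp add: a_def ennreal_power)
  have b2: "(ennreal (b r x))\<^sup>2 = ennreal (w r / N r) * ennreal ((norm (T r x))\<^sup>2)" for r x
    using wN[of r] by (simp add: b_def ennreal_power power_mult_distrib ennreal_mult)
  have "(\<integral>\<^sup>+x. (\<integral>\<^sup>+r. ennreal (w r) * ennreal (norm (T r x)) \<partial>lborel)\<^sup>2 \<partial>lborel)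
      \<le> (\<integral>\<^sup>+x. I * (\<integral>\<^sup>+r. ennreal (w r / N r) * ennreal ((norm (T r x))\<^sup>2) \<partial>lborel) \<partial>lborel)"
  proof (intro nn_integral_mono)
    fix x
    have "(\<integral>\<^sup>+r. ennreal (a r) * ennreal (b r x) \<partial>lborel)\<^sup>2
        \<le> (\<integral>\<^sup>+r. (ennreal (a r))\<^sup>2 \<partial>lborel) * (\<integral>\<^sup>+r. (ennreal (b r x))\<^sup>2 \<partial>lborel)"
      by (intro Cauchy_Schwarz_nn_integral) measurable
    then show "(\<integral>\<^sup>+r. ennreal (w r) * ennreal (norm (T r x)) \<partial>lborel)\<^sup>2
        \<le> I * (\<integral>\<^sup>+r. ennreal (w r / N r) * ennreal ((norm (T r x))\<^sup>2) \<partial>lborel)"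
      unfolding ab a2 b2 .
  qed
  also have "\<dots> = I * (\<integral>\<^sup>+x. (\<integral>\<^sup>+r. ennreal (w r / N r) * ennreal ((norm (T r x))\<^sup>2) \<partial>lborel) \<partial>lborel)"
    by (intro nn_integral_cmult) measurable
  also have "(\<integral>\<^sup>+x. (\<integral>\<^sup>+r. ennreal (w r / N r) * ennreal ((norm (T r x))\<^sup>2) \<partial>lborel) \<partial>lborel)
      = (\<integral>\<^sup>+r. (\<integral>\<^sup>+x. ennreal (w r / N r) * ennreal ((norm (T r x))\<^sup>2) \<partial>lborel) \<partial>lborel)"
    by (rule lborel_pair.Fubini') measurable
  also have "\<dots> \<le> (\<integral>\<^sup>+r. ennreal (w r * N r) * X \<partial>lborel)"
  proof (intro nn_integral_mono)
    fix r
    show "(\<integral>\<^sup>+x. ennreal (w r / N r) * ennreal ((norm (T r x))\<^sup>2) \<partial>lborel) \<le> ennreal (w r * N r) * X"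
    proof (cases "w r = 0")
      case False
      have "(\<integral>\<^sup>+x. ennreal (w r / N r) * ennreal ((norm (T r x))\<^sup>2) \<partial>lborel)
          = ennreal (w r / N r) * (\<integral>\<^sup>+x. ennreal ((norm (T r x))\<^sup>2) \<partial>lborel)"
        by (intro nn_integral_cmult) measurable
      also have "\<dots> \<le> ennreal (w r / N r) * (ennreal ((N r)\<^sup>2) * X)"
        by (intro mult_left_mono TN False) auto
      also have "\<dots> = ennreal (w r / N r * (N r)\<^sup>2) * X"
        using wN[of r] by (simp only: mult.assoc[symmetric] ennreal_mult[OF _ zero_le_power2])
      also have "w r / N r * (N r)\<^sup>2 = w r * N r"
        using N[OF False] by (simp add: power2_eq_square)
      finally show ?thesis .
    qed simp
  qed
  also have "\<dots> = I * X" unfolding I_def by (rule nn_integral_multc) measurable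
  finally show ?thesis by (simp add: I_def power2_eq_square mult.assoc mult_left_mono)
qed

section \<open>The integral over scales\<close>

definition decay_rate :: "real \<Rightarrow> real \<Rightarrow> real \<Rightarrow> real \<Rightarrow> real" where
  "decay_rate m \<gamma> \<alpha> lam =
     (if m < \<gamma> * \<alpha> - 1/2 then lam powr (- (1 / \<gamma>) * (m + 1/2))
      else if m = \<gamma> * \<alpha> - 1/2 then lam powr (- \<alpha>) * ln lam
      else lam powr (- \<alpha>))"

lemma decay_rate_pos: "2 \<le> lam \<Longrightarrow> 0 < decay_rate m \<gamma> \<alpha> lam"
  by (simp add: decay_rate_def)

lemma nn_integral_powr_from_0:
  fixes a \<rho> :: real
  assumes "-1 < a" "0 \<le> \<rho>"
  shows "(\<integral>\<^sup>+r. ennreal (indicator {0..\<rho>} r * r powr a) \<partial>lborel) = ennreal (\<rho> powr (a + 1) / (a + 1))"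
proof (rule nn_integral_has_integral_lborel)
  have "(\<lambda>r. indicator {0..\<rho>} r * r powr a) = (\<lambda>r. if r \<in> {0..\<rho>} then r powr a else 0)"
    by (auto simp: indicator_def)
  then show "((\<lambda>r. indicator {0..\<rho>} r * r powr a) has_integral (\<rho> powr (a + 1) / (a + 1))) UNIV"
    using has_integral_powr_from_0[OF assms] by (simp only: has_integral_restrict_UNIV)
qed auto

lemma nn_integral_powr_Icc:
  fixes b \<rho> S :: real
  assumes "0 < \<rho>" "\<rho> \<le> S"
  shows "(\<integral>\<^sup>+r. ennreal (r powr b) * indicator {\<rho>..S} r \<partial>lborel)
    = ennreal (if b = -1 then ln S - ln \<rho> else (S powr (b + 1) - \<rho> powr (b + 1)) / (b + 1))"
proof (cases "b = -1")
  case True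
  have "(\<integral>\<^sup>+r. ennreal (r powr b) * indicator {\<rho>..S} r \<partial>lborel) = ennreal (ln S - ln \<rho>)"
  proof (rule nn_integral_FTC_Icc)
    fix r assume "r \<in> {\<rho>..S}"
    then show "(ln has_real_derivative r powr b) (at r)"
      using assms True by (auto intro!: derivative_eq_intros simp: powr_minus divide_inverse)
  qed (use assms in auto)
  with True show ?thesis by simp
next
  case False
  have "(\<integral>\<^sup>+r. ennreal (r powr b) * indicator {\<rho>..S} r \<partial>lborel)
      = ennreal (S powr (b + 1) / (b + 1) - \<rho> powr (b + 1) / (b + 1))"
  proof (rule nn_integral_FTC_Icc)
    fix r assume "r \<in> {\<rho>..S}"
    then show "((\<lambda>r. r powr (b + 1) / (b + 1)) has_real_derivative r powr b) (at r)"
      using assms False by (auto intro!: derivative_eq_intros)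
  qed (use assms in auto)
  with False show ?thesis by (simp add: diff_divide_distrib)
qed

text \<open>
  The integrand is bounded by \<open>r powr (m - 1/2)\<close> up to the crossover \<open>\<rho>\<close>, where \<open>lam * \<rho> powr \<gamma> = 1\<close>, and by
  \<open>lam powr (- \<alpha>) * r powr (- \<delta> - 1)\<close> beyond it. The first part contributes
  \<open>\<rho> powr (m + 1/2) = lam powr (- \<alpha> + \<delta> / \<gamma>)\<close>; the sign of \<open>\<delta>\<close> decides which end of \<open>[\<rho>, S]\<close> dominates
  the second, and \<open>\<delta> = 0\<close> produces the logarithm. In that case \<open>lam \<ge> 2\<close> allows the bounded terms to be
  absorbed into \<open>ln lam\<close>, which explains the division by \<open>ln 2\<close> in the constant.
\<close>

lemma scale_integral_le:
  fixes m \<gamma> \<alpha> S :: real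
  assumes m: "0 < m" and \<gamma>: "0 < \<gamma>" and \<alpha>: "0 \<le> \<alpha>" and S: "1 \<le> S"
  obtains C where "0 < C" "\<And>lam. 2 \<le> lam \<Longrightarrow>
    (\<integral>\<^sup>+r. ennreal (indicator {0<..S} r * (r powr (m - 1/2) * min 1 ((lam * r powr \<gamma>) powr (- \<alpha>)))) \<partial>lborel)
      \<le> ennreal (C * decay_rate m \<gamma> \<alpha> lam)"
proof -
  define \<delta> where "\<delta> = \<gamma> * \<alpha> - 1/2 - m"
  define C1 where "C1 = 1 / (m + 1/2)"
  have C1: "0 < C1" using m by (simp add: C1_def)
  define C2 where "C2 = (if \<delta> = 0 then (C1 + ln S) / ln 2 + 1 / \<gamma> else if 0 < \<delta> then C1 + 1 / \<delta> else C1 + S powr (- \<delta>) / (- \<delta>))"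
  have "S powr (- \<delta>) / \<delta> \<le> 0" if "\<delta> < 0" using that by (intro divide_nonneg_nonpos) auto
  then have C2: "0 < C2"
    using C1 S \<gamma> by (force simp: C2_def intro!: add_pos_pos add_nonneg_pos divide_nonneg_pos)
  have main: "(\<integral>\<^sup>+r. ennreal (indicator {0<..S} r * (r powr (m - 1/2) * min 1 ((lam * r powr \<gamma>) powr (- \<alpha>)))) \<partial>lborel)
      \<le> ennreal (C2 * decay_rate m \<gamma> \<alpha> lam)" if lam: "2 \<le> lam" for lam
  proof -
    define \<rho> where "\<rho> = lam powr (- (1 / \<gamma>))"
    have \<rho>: "0 < \<rho>" "\<rho> \<le> 1"
      using lam \<gamma> by (auto simp: \<rho>_def intro!: powr_le_one_le[THEN order_trans] simp: powr_minus_divide ge_one_powr_ge_zero divide_le_eq)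
    have \<rho>S: "\<rho> \<le> S" using \<rho> S by simp
    define b where "b = m - 1/2 - \<gamma> * \<alpha>"
    have b: "b + 1 = - \<delta>" by (simp add: b_def \<delta>_def)
    have pt: "ennreal (indicator {0<..S} r * (r powr (m - 1/2) * min 1 ((lam * r powr \<gamma>) powr (- \<alpha>))))
        \<le> ennreal (indicator {0..\<rho>} r * r powr (m - 1/2)) + ennreal (lam powr (- \<alpha>)) * (ennreal (r powr b) * indicator {\<rho>..S} r)"
      for r
    proof (cases "0 < r \<and> r \<le> S")
      case True
      show ?thesis
      proof (cases "r \<le> \<rho>")
        case le: True
        have "r powr (m - 1/2) * min 1 ((lam * r powr \<gamma>) powr (- \<alpha>)) \<le> r powr (m - 1/2) * 1"
          by (intro mult_left_mono) auto
        then have "ennreal (indicator {0<..S} r * (r powr (m - 1/2) * min 1 ((lam * r powr \<gamma>) powr (- \<alpha>))))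
            \<le> ennreal (indicator {0..\<rho>} r * r powr (m - 1/2))"
          using True le by (intro ennreal_leI) simp
        then show ?thesis by (rule order_trans) simp
      next
        case gt: False
        have "(lam * r powr \<gamma>) powr (- \<alpha>) = lam powr (- \<alpha>) * r powr (- (\<gamma> * \<alpha>))"
          using lam True by (simp add: powr_mult powr_powr)
        then have "r powr (m - 1/2) * min 1 ((lam * r powr \<gamma>) powr (- \<alpha>))
            \<le> r powr (m - 1/2) * (lam powr (- \<alpha>) * r powr (- (\<gamma> * \<alpha>)))"
          by (intro mult_left_mono) auto
        also have "\<dots> = lam powr (- \<alpha>) * r powr b"
          by (simp add: b_def powr_add[symmetric])
        finally have "ennreal (indicator {0<..S} r * (r powr (m - 1/2) * min 1 ((lam * r powr \<gamma>) powr (- \<alpha>))))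
            \<le> ennreal (lam powr (- \<alpha>) * r powr b)"
          using True by (intro ennreal_leI) simp
        also have "\<dots> = ennreal (lam powr (- \<alpha>)) * (ennreal (r powr b) * indicator {\<rho>..S} r)"
          using True gt by (simp add: ennreal_mult)
        finally show ?thesis by (rule order_trans) simp
      qed
    qed auto
    define I2 where "I2 = (if b = -1 then ln S - ln \<rho> else (S powr (b + 1) - \<rho> powr (b + 1)) / (b + 1))"
    have I2: "0 \<le> I2"
    proof (cases "b = -1")
      case False
      show ?thesis
      proof (cases "0 < b + 1")
        case True
        then show ?thesis using \<rho> \<rho>S False powr_mono2[of "b + 1" \<rho> S] by (simp add: I2_def)
      next
        case neg: False
        then show ?thesis using \<rho> \<rho>S False powr_mono2'[of "b + 1" \<rho> S]
          by (auto simp: I2_def intro!: divide_nonpos_nonpos)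
      qed
    qed (use \<rho> \<rho>S in \<open>simp add: I2_def\<close>)
    have "(\<integral>\<^sup>+r. ennreal (indicator {0<..S} r * (r powr (m - 1/2) * min 1 ((lam * r powr \<gamma>) powr (- \<alpha>)))) \<partial>lborel)
        \<le> (\<integral>\<^sup>+r. ennreal (indicator {0..\<rho>} r * r powr (m - 1/2)) + ennreal (lam powr (- \<alpha>)) * (ennreal (r powr b) * indicator {\<rho>..S} r) \<partial>lborel)"
      by (intro nn_integral_mono pt)
    also have "\<dots> = (\<integral>\<^sup>+r. ennreal (indicator {0..\<rho>} r * r powr (m - 1/2)) \<partial>lborel)
        + ennreal (lam powr (- \<alpha>)) * (\<integral>\<^sup>+r. ennreal (r powr b) * indicator {\<rho>..S} r \<partial>lborel)"
      by (subst nn_integral_add) (auto simp: nn_integral_cmult)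
    also have "\<dots> = ennreal (C1 * \<rho> powr (m + 1/2)) + ennreal (lam powr (- \<alpha>)) * ennreal I2"
      using \<rho> \<rho>S m by (subst nn_integral_powr_from_0, simp, simp, subst nn_integral_powr_Icc)
        (auto simp: C1_def I2_def add.commute)
    also have "\<dots> = ennreal (C1 * \<rho> powr (m + 1/2) + lam powr (- \<alpha>) * I2)"
      using C1 I2 by (simp add: ennreal_plus ennreal_mult)
    also have "C1 * \<rho> powr (m + 1/2) + lam powr (- \<alpha>) * I2 \<le> C2 * decay_rate m \<gamma> \<alpha> lam"
    proof -
      have \<rho>p: "\<rho> powr (m + 1/2) = lam powr (- (1 / \<gamma>) * (m + 1/2))" by (simp add: \<rho>_def powr_powr)
      have ex: "- (1 / \<gamma>) * (m + 1/2) = - \<alpha> + \<delta> / \<gamma>" using \<gamma> by (simp add: \<delta>_def field_simps)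
      consider "\<delta> = 0" | "0 < \<delta>" | "\<delta> < 0" by linarith
      then show ?thesis
      proof cases
        case 1
        then have b1: "b = -1" and eq: "m = \<gamma> * \<alpha> - 1/2" using b by (auto simp: \<delta>_def)
        have "I2 = ln S + ln lam / \<gamma>" using lam by (simp add: I2_def b1 \<rho>_def ln_powr)
        moreover have "C1 + ln S \<le> (C1 + ln S) / ln 2 * ln lam"
        proof -
          have "(C1 + ln S) / ln 2 * ln 2 \<le> (C1 + ln S) / ln 2 * ln lam"
            using C1 S lam by (intro mult_left_mono divide_nonneg_nonneg) auto
          then show ?thesis by simp
        qed
        ultimately have "C1 + I2 \<le> C2 * ln lam" using 1 by (simp add: C2_def distrib_right)
        then have "lam powr (- \<alpha>) * (C1 + I2) \<le> lam powr (- \<alpha>) * (C2 * ln lam)"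
          by (intro mult_left_mono) auto
        then show ?thesis using 1 unfolding \<rho>p ex decay_rate_def
          by (simp add: eq algebra_simps)
      next
        case 2
        have "I2 = (\<rho> powr (- \<delta>) - S powr (- \<delta>)) / \<delta>"
          using 2 b by (simp add: I2_def diff_divide_distrib)
        also have "\<dots> \<le> \<rho> powr (- \<delta>) / \<delta>" using 2 by (intro divide_right_mono) auto
        also have "\<rho> powr (- \<delta>) = lam powr (\<delta> / \<gamma>)" by (simp add: \<rho>_def powr_powr)
        finally have "lam powr (- \<alpha>) * I2 \<le> lam powr (- \<alpha>) * (lam powr (\<delta> / \<gamma>) / \<delta>)"
          by (intro mult_left_mono) auto
        also have "\<dots> = (1 / \<delta>) * lam powr (- \<alpha> + \<delta> / \<gamma>)" by (simp only: powr_add) simp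
        finally have "C1 * \<rho> powr (m + 1/2) + lam powr (- \<alpha>) * I2 \<le> (C1 + 1 / \<delta>) * lam powr (- \<alpha> + \<delta> / \<gamma>)"
          unfolding \<rho>p ex by (simp add: distrib_right)
        then show ?thesis using 2 unfolding decay_rate_def ex by (simp add: C2_def \<delta>_def)
      next
        case 3
        have "I2 = (S powr (- \<delta>) - \<rho> powr (- \<delta>)) / (- \<delta>)" using 3 b by (simp add: I2_def)
        also have "\<dots> \<le> S powr (- \<delta>) / (- \<delta>)" using 3 by (intro divide_right_mono) auto
        finally have i: "lam powr (- \<alpha>) * I2 \<le> lam powr (- \<alpha>) * (S powr (- \<delta>) / (- \<delta>))"
          by (intro mult_left_mono) auto
        have "\<rho> powr (m + 1/2) \<le> lam powr (- \<alpha>)"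
          unfolding \<rho>p ex using 3 lam \<gamma> by (intro powr_mono) (auto simp: divide_nonpos_pos)
        then have "C1 * \<rho> powr (m + 1/2) \<le> C1 * lam powr (- \<alpha>)" using C1 by (intro mult_left_mono) auto
        with i have "C1 * \<rho> powr (m + 1/2) + lam powr (- \<alpha>) * I2 \<le> C2 * lam powr (- \<alpha>)"
          using 3 by (simp add: C2_def algebra_simps)
        then show ?thesis using 3 by (simp add: decay_rate_def \<delta>_def)
      qed
    qed
    finally show ?thesis by (simp add: ennreal_leI)
  qed
  show thesis using that[OF C2 main] .
qed

section \<open>The operator bound\<close>

lemma AE_snd_nonzero: "AE x in lborel. snd (x :: 'y::euclidean_space \<times> real) \<noteq> 0"
proof -
  have "negligible {x :: 'y \<times> real. (0, 1) \<bullet> x = 0}"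
    by (rule negligible_hyperplane) (simp add: prod_eq_iff)
  then have n: "{x :: 'y \<times> real. snd x = 0} \<in> null_sets lebesgue"
    by (simp add: negligible_iff_null_sets inner_prod_def)
  have "closed {x :: 'y \<times> real. snd x = 0}"
    by (intro closed_Collect_eq continuous_intros)
  then have "{x :: 'y \<times> real. snd x = 0} \<in> sets lborel" by auto
  with n have "{x :: 'y \<times> real. snd x = 0} \<in> null_sets lborel"
    using null_sets_completion_iff by blast
  then show ?thesis by (rule AE_I'[where N = "{x. snd x = 0}"]) auto
qed

text \<open>
  The superposition of scales holds off the null set \<open>snd x = 0\<close>. Minkowski's inequality is applied
  with the weight \<open>w r = r powr (- \<beta> - 1)\<close> and the norm bound \<open>N r\<close> of one scale; their product is the
  integrand of the scale integral, as \<open>- \<beta> - 1 + (d + 1/2) = m - 1/2\<close>.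
\<close>

lemma oscillatory_operator_bound:
  fixes \<psi> :: "('y::euclidean_space \<times> real) \<times> 'y \<Rightarrow> complex" and m \<gamma> :: real
  assumes m: "0 < m" "m < real DIM('y)" and \<gamma>: "1 < \<gamma>" and \<psi>: "smooth_compactly_supported \<psi>"
  defines "\<alpha> \<equiv> real DIM('y) / 2"
  obtains C where "0 < C"
    "\<And>lam f. 2 \<le> lam \<Longrightarrow> f \<in> borel_measurable borel \<Longrightarrow>
       (\<integral>\<^sup>+y. ennreal ((norm (f y :: complex))\<^sup>2) \<partial>lborel) < \<infinity> \<Longrightarrow>
       (\<integral>\<^sup>+x. ennreal ((norm (\<integral>y. exp (\<i> * complex_of_real (lam * norm (x - (y, 0)) powr \<gamma>)) * \<psi> (x, y)
          * complex_of_real (norm (x - (y, 0)) powr (- (real DIM('y) - m))) * f y \<partial>lborel))\<^sup>2) \<partial>lborel)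
       \<le> (ennreal (C * decay_rate m \<gamma> \<alpha> lam))\<^sup>2 * (\<integral>\<^sup>+y. ennreal ((norm (f y))\<^sup>2) \<partial>lborel)"
proof -
  let ?d = "DIM('y)"
  define \<beta> where "\<beta> = real ?d - m"
  have \<beta>: "0 < \<beta>" using m by (simp add: \<beta>_def)
  define M where "M = Suc (Suc ?d)"
  have M: "0 < M" "Suc ?d < M" by (auto simp: M_def)
  define \<kappa> where "\<kappa> = scale_mass M \<beta>"
  have \<kappa>: "0 < \<kappa>" unfolding \<kappa>_def by (rule scale_mass_pos[OF M(1) \<beta>])
  obtain S where S: "1 \<le> S" "\<And>x y. S < norm x \<or> S < norm y \<Longrightarrow> \<psi> (x, y) = 0"
    "\<And>x y. \<psi> (x, y) \<noteq> 0 \<Longrightarrow> norm x + norm y \<le> S"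
    using compact_support_bound[OF \<psi>] by blast
  have S0: "0 < S" using S(1) by simp
  obtain D where D: "0 < D"
    "\<And>lam r f. 0 < lam \<Longrightarrow> 0 < r \<Longrightarrow> r \<le> S \<Longrightarrow> f \<in> borel_measurable borel \<Longrightarrow>
       (\<integral>\<^sup>+y. ennreal ((norm (f y :: complex))\<^sup>2) \<partial>lborel) < \<infinity> \<Longrightarrow>
       (\<integral>\<^sup>+x. ennreal ((norm (\<integral>y. scale_kernel \<gamma> \<psi> lam M r x y * f y \<partial>lborel))\<^sup>2) \<partial>lborel)
       \<le> ennreal (D * r ^ (2 * ?d + 1) * min 1 (1 / (lam * r powr \<gamma>) ^ ?d))
           * (\<integral>\<^sup>+y. ennreal ((norm (f y))\<^sup>2) \<partial>lborel)"
    using scale_operator_bound[OF \<gamma> \<psi> S0 M(2)] by blast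
  obtain E where E: "0 < E" "\<And>lam. 2 \<le> lam \<Longrightarrow>
    (\<integral>\<^sup>+r. ennreal (indicator {0<..S} r * (r powr (m - 1/2) * min 1 ((lam * r powr \<gamma>) powr (- \<alpha>)))) \<partial>lborel)
      \<le> ennreal (E * decay_rate m \<gamma> \<alpha> lam)"
    using scale_integral_le[of m \<gamma> \<alpha> S] m \<gamma> S by (auto simp: \<alpha>_def)
  show thesis
  proof (rule that[of "sqrt D * E / \<kappa>"])
    show "0 < sqrt D * E / \<kappa>" using D E \<kappa> by simp
  next
    fix lam :: real and f :: "'y \<Rightarrow> complex"
    assume lam: "2 \<le> lam" and f: "f \<in> borel_measurable borel"
      and f2: "(\<integral>\<^sup>+y. ennreal ((norm (f y))\<^sup>2) \<partial>lborel) < \<infinity>"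
    define X where "X = (\<integral>\<^sup>+y. ennreal ((norm (f y))\<^sup>2) \<partial>lborel)"
    define w where "w r = indicator {0<..S} r * r powr (- \<beta> - 1)" for r :: real
    define N where "N r = sqrt (D * r ^ (2 * ?d + 1) * min 1 (1 / (lam * r powr \<gamma>) ^ ?d))" for r
    define T where "T r x = (\<integral>y. scale_kernel \<gamma> \<psi> lam M r x y * f y \<partial>lborel)" for r x
    define T0 where "T0 x = (\<integral>y. exp (\<i> * complex_of_real (lam * norm (x - (y, 0)) powr \<gamma>)) * \<psi> (x, y)
          * complex_of_real (norm (x - (y, 0)) powr (- \<beta>)) * f y \<partial>lborel)" for x
    have wr: "0 < r \<and> r \<le> S" if "w r \<noteq> 0" for r using that by (auto simp: w_def indicator_def split: if_splits)
    have [measurable]: "w \<in> borel_measurable borel" "N \<in> borel_measurable borel"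
      unfolding w_def N_def by measurable
    have "(\<lambda>z. scale_kernel \<gamma> \<psi> lam M (fst (fst z)) (snd (fst z)) (snd z) * f (snd z))
        \<in> borel_measurable ((lborel \<Otimes>\<^sub>M lborel) \<Otimes>\<^sub>M lborel)"
      by (intro borel_measurable_times scale_kernel_measurable[OF \<psi>] measurable_compose[OF _ f]) measurable
    then have Tm: "case_prod T \<in> borel_measurable (lborel \<Otimes>\<^sub>M lborel)"
      unfolding T_def split_def
      by (intro lborel.borel_measurable_lebesgue_integral) (simp add: split_def)
    have TN: "(\<integral>\<^sup>+x. ennreal ((norm (T r x))\<^sup>2) \<partial>lborel) \<le> ennreal ((N r)\<^sup>2) * X" if "w r \<noteq> 0" for r
    proof -
      have "0 \<le> D * r ^ (2 * ?d + 1) * min 1 (1 / (lam * r powr \<gamma>) ^ ?d)"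
        using D wr[OF that] lam by simp
      then show ?thesis unfolding T_def N_def X_def
        using D(2)[of lam r f] wr[OF that] lam f f2 by (simp only: real_sqrt_pow2)
    qed
    have wN: "w r * N r = sqrt D * (indicator {0<..S} r * (r powr (m - 1/2) * min 1 ((lam * r powr \<gamma>) powr (- \<alpha>))))" for r
    proof (cases "r \<in> {0<..S}")
      case True
      then have r: "0 < r" by simp
      define t where "t = lam * r powr \<gamma>"
      have t: "0 < t" using lam r by (simp add: t_def)
      have a: "sqrt (r ^ (2 * ?d + 1)) = r powr (real ?d + 1/2)"
      proof -
        have "sqrt (r ^ (2 * ?d + 1)) = (r powr real (2 * ?d + 1)) powr (1/2)"
          using r by (simp only: powr_realpow powr_half_sqrt zero_le_power less_imp_le)
        also have "\<dots> = r powr (real (2 * ?d + 1) * (1/2))" by (rule powr_powr)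
        also have "real (2 * ?d + 1) * (1/2) = real ?d + 1/2" by simp
        finally show ?thesis .
      qed
      have "sqrt (1 / t ^ ?d) = t powr (- \<alpha>)"
        using t by (simp add: powr_half_sqrt[symmetric] powr_realpow[symmetric] powr_powr powr_minus_divide[symmetric] \<alpha>_def)
      moreover have "sqrt (min 1 (1 / t ^ ?d)) = min 1 (sqrt (1 / t ^ ?d))"
        by (auto simp: min_def)
      ultimately have "N r = sqrt D * r powr (real ?d + 1/2) * min 1 (t powr (- \<alpha>))"
        unfolding N_def t_def[symmetric] real_sqrt_mult a by simp
      moreover have "r powr (- \<beta> - 1) * r powr (real ?d + 1/2) = r powr (m - 1/2)"
        using r by (simp add: powr_add[symmetric] \<beta>_def)
      ultimately show ?thesis using True by (simp add: w_def t_def[symmetric] mult.assoc mult.left_commute)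
    qed (simp add: w_def)
    have dr: "0 < decay_rate m \<gamma> \<alpha> lam" by (rule decay_rate_pos[OF lam])
    have I: "(\<integral>\<^sup>+r. ennreal (w r * N r) \<partial>lborel) \<le> ennreal (sqrt D * E * decay_rate m \<gamma> \<alpha> lam)"
    proof -
      have "(\<integral>\<^sup>+r. ennreal (w r * N r) \<partial>lborel) = ennreal (sqrt D) *
          (\<integral>\<^sup>+r. ennreal (indicator {0<..S} r * (r powr (m - 1/2) * min 1 ((lam * r powr \<gamma>) powr (- \<alpha>)))) \<partial>lborel)"
        unfolding wN using D by (subst nn_integral_cmult[symmetric]) (auto simp: ennreal_mult)
      also have "\<dots> \<le> ennreal (sqrt D) * ennreal (E * decay_rate m \<gamma> \<alpha> lam)"
        by (intro mult_left_mono E(2) lam) auto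
      also have "\<dots> = ennreal (sqrt D * E * decay_rate m \<gamma> \<alpha> lam)"
        using D E dr by (simp add: ennreal_mult mult.assoc)
      finally show ?thesis .
    qed
    have Mink: "(\<integral>\<^sup>+x. (\<integral>\<^sup>+r. ennreal (w r) * ennreal (norm (T r x)) \<partial>lborel)\<^sup>2 \<partial>lborel)
        \<le> (\<integral>\<^sup>+r. ennreal (w r * N r) \<partial>lborel)\<^sup>2 * X"
    proof (rule Minkowski_L2[OF Tm _ _ _ _ TN])
      show "0 \<le> w r" for r by (simp add: w_def)
      show "0 < N r" if "w r \<noteq> 0" for r using wr[OF that] D lam by (simp add: N_def)
    qed auto
    have pt: "ennreal ((norm (T0 x))\<^sup>2) \<le> (ennreal (1 / \<kappa>))\<^sup>2 * (\<integral>\<^sup>+r. ennreal (w r) * ennreal (norm (T r x)) \<partial>lborel)\<^sup>2"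
      if "snd x \<noteq> 0" for x
    proof -
      have "ennreal \<kappa> * ennreal (norm (T0 x)) \<le> (\<integral>\<^sup>+r. ennreal (w r) * ennreal (norm (T r x)) \<partial>lborel)"
        unfolding \<kappa>_def T0_def w_def T_def
        by (rule norm_superposition_le[OF \<psi> M(1) \<beta> S(3) f f2 that])
      then have "ennreal (1 / \<kappa>) * (ennreal \<kappa> * ennreal (norm (T0 x)))
          \<le> ennreal (1 / \<kappa>) * (\<integral>\<^sup>+r. ennreal (w r) * ennreal (norm (T r x)) \<partial>lborel)"
        by (intro mult_left_mono) auto
      moreover have "ennreal (1 / \<kappa>) * (ennreal \<kappa> * ennreal (norm (T0 x))) = ennreal (norm (T0 x))"
        using \<kappa> by (simp add: mult.assoc[symmetric] ennreal_mult[symmetric] del: mult.assoc)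
      ultimately have "(ennreal (norm (T0 x)))\<^sup>2
          \<le> (ennreal (1 / \<kappa>) * (\<integral>\<^sup>+r. ennreal (w r) * ennreal (norm (T r x)) \<partial>lborel))\<^sup>2"
        by (intro power_mono) auto
      then show ?thesis by (simp add: ennreal_power power_mult_distrib)
    qed
    have "(\<integral>\<^sup>+x. ennreal ((norm (T0 x))\<^sup>2) \<partial>lborel)
        \<le> (\<integral>\<^sup>+x. (ennreal (1 / \<kappa>))\<^sup>2 * (\<integral>\<^sup>+r. ennreal (w r) * ennreal (norm (T r x)) \<partial>lborel)\<^sup>2 \<partial>lborel)"
      by (intro nn_integral_mono_AE eventually_mono[OF AE_snd_nonzero]) (rule pt)
    also have "\<dots> = (ennreal (1 / \<kappa>))\<^sup>2 * (\<integral>\<^sup>+x. (\<integral>\<^sup>+r. ennreal (w r) * ennreal (norm (T r x)) \<partial>lborel)\<^sup>2 \<partial>lborel)"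
    proof (intro nn_integral_cmult)
      have [measurable]: "(\<lambda>z. T (snd z) (fst z)) \<in> borel_measurable (lborel \<Otimes>\<^sub>M lborel)"
        using measurable_compose[OF measurable_pair_swap' Tm] by (simp add: split_def)
      have "(\<lambda>z. ennreal (w (snd z)) * ennreal (norm (T (snd z) (fst z)))) \<in> borel_measurable (lborel \<Otimes>\<^sub>M lborel)"
        by measurable
      then have [measurable]: "(\<lambda>x. \<integral>\<^sup>+r. ennreal (w r) * ennreal (norm (T r x)) \<partial>lborel) \<in> borel_measurable lborel"
        by (intro lborel.borel_measurable_nn_integral) (simp add: split_def)
      show "(\<lambda>x. (\<integral>\<^sup>+r. ennreal (w r) * ennreal (norm (T r x)) \<partial>lborel)\<^sup>2) \<in> borel_measurable lborel"
        unfolding power2_eq_square by measurable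
    qed
    also have "\<dots> \<le> (ennreal (1 / \<kappa>))\<^sup>2 * ((\<integral>\<^sup>+r. ennreal (w r * N r) \<partial>lborel)\<^sup>2 * X)"
      by (intro mult_left_mono Mink) auto
    also have "\<dots> \<le> (ennreal (1 / \<kappa>))\<^sup>2 * ((ennreal (sqrt D * E * decay_rate m \<gamma> \<alpha> lam))\<^sup>2 * X)"
      by (intro mult_left_mono mult_right_mono power_mono I) auto
    also have "\<dots> = (ennreal (1 / \<kappa>) * ennreal (sqrt D * E * decay_rate m \<gamma> \<alpha> lam))\<^sup>2 * X"
      by (simp only: power_mult_distrib mult.assoc)
    also have "ennreal (1 / \<kappa>) * ennreal (sqrt D * E * decay_rate m \<gamma> \<alpha> lam)
        = ennreal (sqrt D * E / \<kappa> * decay_rate m \<gamma> \<alpha> lam)"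
      using \<kappa> D E dr by (subst ennreal_mult[symmetric]) auto
    finally show "(\<integral>\<^sup>+x. ennreal ((norm (\<integral>y. exp (\<i> * complex_of_real (lam * norm (x - (y, 0)) powr \<gamma>)) * \<psi> (x, y)
          * complex_of_real (norm (x - (y, 0)) powr (- (real ?d - m))) * f y \<partial>lborel))\<^sup>2) \<partial>lborel)
       \<le> (ennreal (sqrt D * E / \<kappa> * decay_rate m \<gamma> \<alpha> lam))\<^sup>2 * (\<integral>\<^sup>+y. ennreal ((norm (f y))\<^sup>2) \<partial>lborel)"
      unfolding T0_def \<beta>_def X_def .
  qed
qed

text \<open>
  Iterated integrals of Lebesgue measurable functions are awkward, since the completion of a product
  measure is not the product of the completions; a Borel representative avoids this.
\<close>

lemma lebesgue_measurable_complex_borel: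
  fixes f :: "'a::euclidean_space \<Rightarrow> complex"
  assumes "f \<in> borel_measurable lebesgue"
  obtains g where "g \<in> borel_measurable borel" "AE x in lebesgue. f x = g x"
proof -
  have "(\<lambda>x. Re (f x)) \<in> borel_measurable lebesgue" "(\<lambda>x. Im (f x)) \<in> borel_measurable lebesgue"
    using assms by measurable
  then obtain a b where a: "a \<in> borel_measurable lborel" "AE x in lborel. Re (f x) = a x"
    and b: "b \<in> borel_measurable lborel" "AE x in lborel. Im (f x) = b x"
    using completion_ex_borel_measurable_real by metis
  have "(\<lambda>x. complex_of_real (a x) + \<i> * complex_of_real (b x)) \<in> borel_measurable borel"
    using a(1) b(1) by (auto intro!: borel_measurable_add borel_measurable_times borel_measurable_of_real)
  moreover have "AE x in lborel. f x = complex_of_real (a x) + \<i> * complex_of_real (b x)"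
    using a(2) b(2) by eventually_elim (metis complex_eq)
  ultimately show thesis using that AE_completion by blast
qed

lemma L2_norm_le_of_borel:
  fixes g :: "'a::euclidean_space \<Rightarrow> complex"
  assumes g: "g \<in> borel_measurable borel"
    and le: "(\<integral>\<^sup>+x. ennreal ((norm (g x))\<^sup>2) \<partial>lborel) \<le> (ennreal B)\<^sup>2" and B: "0 \<le> B"
  shows "L2_norm g \<le> ennreal B"
proof -
  have gl: "g \<in> borel_measurable lebesgue" using g by (intro measurable_completion) simp
  have nn: "(\<integral>\<^sup>+x. ennreal ((norm (g x))\<^sup>2) \<partial>lebesgue) \<le> ennreal (B\<^sup>2)"
    using le B by (simp add: nn_integral_completion ennreal_power)
  have i: "integrable lebesgue (\<lambda>x. (norm (g x))\<^sup>2)"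
  proof (rule integrableI_bounded)
    show "(\<lambda>x. (norm (g x))\<^sup>2) \<in> borel_measurable lebesgue" using gl by measurable
    show "(\<integral>\<^sup>+x. ennreal (norm ((norm (g x))\<^sup>2)) \<partial>lebesgue) < \<infinity>"
      using nn by (simp add: le_less_trans)
  qed
  have "ennreal (\<integral>x. (norm (g x))\<^sup>2 \<partial>lebesgue) \<le> ennreal (B\<^sup>2)"
    using nn nn_integral_eq_integral[OF i] by simp
  then have "(\<integral>x. (norm (g x))\<^sup>2 \<partial>lebesgue) \<le> B\<^sup>2" by (simp add: ennreal_le_iff)
  then have "sqrt (\<integral>x. (norm (g x))\<^sup>2 \<partial>lebesgue) \<le> B" using B by (intro real_le_lsqrt) auto
  moreover have "g \<in> L2" using gl i by (simp add: L2_def)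
  ultimately show ?thesis by (simp add: L2_norm_def ennreal_leI)
qed

theorem theorem4p1:
  fixes n :: nat and m \<gamma> \<alpha> :: real
    and \<psi>\<^sub>0 :: "((real ^ 'k::finite) \<times> real) \<times> (real ^ 'k) \<Rightarrow> complex"
  assumes "n \<ge> 2" and "CARD('k) = n - 1"
    and "0 < m" and "m < real n - 1"
    and "\<gamma> > 1"
    and "\<alpha> = (real n - 1) / 2"
    and "smooth_compactly_supported \<psi>\<^sub>0"
  shows "\<exists>C>0. \<forall>lam\<ge>2.
    L2_operator_norm (T_op m \<gamma> \<psi>\<^sub>0 lam) \<le> ennreal
      (if m < \<gamma> * \<alpha> - 1/2 then C * lam powr (- (1 / \<gamma>) * (m + 1/2))
       else if m = \<gamma> * \<alpha> - 1/2 then C * lam powr (- \<alpha>) * ln lam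
       else C * lam powr (- \<alpha>))"
proof -
  have d: "real CARD('k) = real n - 1" using assms(1,2) by simp
  have dim: "DIM(real ^ 'k) = CARD('k)" by simp
  have \<alpha>: "real DIM(real ^ 'k) / 2 = \<alpha>" using assms(6) d by simp
  obtain C where C: "0 < C"
    "\<And>lam f. 2 \<le> lam \<Longrightarrow> f \<in> borel_measurable borel \<Longrightarrow>
       (\<integral>\<^sup>+y. ennreal ((norm (f y :: complex))\<^sup>2) \<partial>lborel) < \<infinity> \<Longrightarrow>
       (\<integral>\<^sup>+x. ennreal ((norm (\<integral>y. exp (\<i> * complex_of_real (lam * norm (x - (y, 0)) powr \<gamma>)) * \<psi>\<^sub>0 (x, y)
          * complex_of_real (norm (x - (y, 0)) powr (- (real DIM(real ^ 'k) - m))) * f y \<partial>lborel))\<^sup>2) \<partial>lborel)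
       \<le> (ennreal (C * decay_rate m \<gamma> \<alpha> lam))\<^sup>2 * (\<integral>\<^sup>+y. ennreal ((norm (f y))\<^sup>2) \<partial>lborel)"
    using oscillatory_operator_bound[OF assms(3) _ assms(5,7)] assms(4) d unfolding \<alpha> by auto
  have K: "K m z = norm z powr (- (real DIM(real ^ 'k) - m))" for z :: "(real ^ 'k) \<times> real"
    by (simp add: K_def)
  have "L2_norm (T_op m \<gamma> \<psi>\<^sub>0 lam f) \<le> ennreal (C * decay_rate m \<gamma> \<alpha> lam)"
    if lam: "2 \<le> lam" and f: "f \<in> L2" "L2_norm f \<le> 1" for lam f
  proof -
    have fm: "f \<in> borel_measurable lebesgue" and fi: "integrable lebesgue (\<lambda>x. (norm (f x))\<^sup>2)"
      using f(1) by (auto simp: L2_def)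
    \<comment> \<open>The operator only sees the almost-everywhere class of \<open>f\<close>.\<close>
    obtain g where g [measurable]: "g \<in> borel_measurable borel" and fg: "AE x in lebesgue. f x = g x"
      using lebesgue_measurable_complex_borel[OF fm] by blast
    have "ennreal (sqrt (\<integral>x. (norm (f x))\<^sup>2 \<partial>lebesgue)) \<le> ennreal 1"
      using f by (simp add: L2_norm_def)
    then have I1: "(\<integral>x. (norm (f x))\<^sup>2 \<partial>lebesgue) \<le> 1" by (simp add: ennreal_le_iff)
    have "(\<integral>\<^sup>+y. ennreal ((norm (g y))\<^sup>2) \<partial>lborel) = (\<integral>\<^sup>+y. ennreal ((norm (g y))\<^sup>2) \<partial>lebesgue)"
      by (simp add: nn_integral_completion)
    also have "\<dots> = (\<integral>\<^sup>+y. ennreal ((norm (f y))\<^sup>2) \<partial>lebesgue)"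
      using fg by (intro nn_integral_cong_AE) auto
    also have "\<dots> = ennreal (\<integral>x. (norm (f x))\<^sup>2 \<partial>lebesgue)"
      by (intro nn_integral_eq_integral fi) auto
    also have "\<dots> \<le> 1" using I1 by (simp add: ennreal_leI flip: ennreal_1)
    finally have g1: "(\<integral>\<^sup>+y. ennreal ((norm (g y))\<^sup>2) \<partial>lborel) \<le> 1" .
    define k where "k x y = exp (\<i> * complex_of_real (lam * norm (x - (y, 0)) powr \<gamma>)) * \<psi>\<^sub>0 (x, y)
          * complex_of_real (norm (x - (y, 0)) powr (- (real DIM(real ^ 'k) - m)))" for x y
    have km: "(\<lambda>z. k (fst z) (snd z)) \<in> borel_measurable (borel \<Otimes>\<^sub>M borel)"
    proof -
      have [measurable]: "(\<lambda>z :: ((real ^ 'k) \<times> real) \<times> (real ^ 'k). fst z - (snd z, 0)) \<in> borel_measurable (borel \<Otimes>\<^sub>M borel)"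
        by (intro borel_measurable_diff borel_measurable_Pair) auto
      have [measurable]: "(\<lambda>z. \<psi>\<^sub>0 (fst z, snd z)) \<in> borel_measurable (borel \<Otimes>\<^sub>M borel)"
        by (rule measurable_compose[OF borel_measurable_Pair smooth_measurable[OF assms(7)]]) auto
      show ?thesis unfolding k_def by measurable
    qed
    have kgm: "(\<lambda>z. k (fst z) (snd z) * g (snd z)) \<in> borel_measurable (borel \<Otimes>\<^sub>M borel)"
      by (intro borel_measurable_times km) measurable
    have kx: "k x \<in> borel_measurable borel" for x
      using measurable_compose[OF measurable_Pair[OF measurable_const measurable_ident] km, of x] by simp
    have T: "T_op m \<gamma> \<psi>\<^sub>0 lam f = (\<lambda>x. \<integral>y. k x y * g y \<partial>lborel)"
    proof
      fix x
      have "T_op m \<gamma> \<psi>\<^sub>0 lam f x = (\<integral>y. k x y * f y \<partial>lebesgue)"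
        by (simp add: T_op_def k_def K)
      also have "\<dots> = (\<integral>y. k x y * g y \<partial>lebesgue)"
      proof (rule integral_cong_AE)
        have "k x \<in> borel_measurable lebesgue" "g \<in> borel_measurable lebesgue"
          using kx[of x] g by (auto intro!: measurable_completion)
        then show "(\<lambda>y. k x y * f y) \<in> borel_measurable lebesgue" "(\<lambda>y. k x y * g y) \<in> borel_measurable lebesgue"
          using fm by (auto intro!: borel_measurable_times)
        show "AE y in lebesgue. k x y * f y = k x y * g y" using fg by eventually_elim simp
      qed
      also have "\<dots> = (\<integral>y. k x y * g y \<partial>lborel)"
        using kx[of x] g by (intro integral_completion) (auto intro!: borel_measurable_times)
      finally show "T_op m \<gamma> \<psi>\<^sub>0 lam f x = (\<integral>y. k x y * g y \<partial>lborel)" .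
    qed
    show ?thesis
      unfolding T
    proof (rule L2_norm_le_of_borel)
      show "(\<lambda>x. \<integral>y. k x y * g y \<partial>lborel) \<in> borel_measurable borel"
        using kgm by (intro lborel.borel_measurable_lebesgue_integral) (simp add: split_def)
      have "(\<integral>\<^sup>+x. ennreal ((norm (\<integral>y. k x y * g y \<partial>lborel))\<^sup>2) \<partial>lborel)
          \<le> (ennreal (C * decay_rate m \<gamma> \<alpha> lam))\<^sup>2 * (\<integral>\<^sup>+y. ennreal ((norm (g y))\<^sup>2) \<partial>lborel)"
        unfolding k_def using g1 by (intro C(2) lam g) (simp add: le_less_trans)
      also have "\<dots> \<le> (ennreal (C * decay_rate m \<gamma> \<alpha> lam))\<^sup>2 * 1"
        by (intro mult_left_mono g1) auto
      finally show "(\<integral>\<^sup>+x. ennreal ((norm (\<integral>y. k x y * g y \<partial>lborel))\<^sup>2) \<partial>lborel)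
          \<le> (ennreal (C * decay_rate m \<gamma> \<alpha> lam))\<^sup>2" by simp
      show "0 \<le> C * decay_rate m \<gamma> \<alpha> lam" using C(1) decay_rate_pos[OF lam, of m \<gamma> \<alpha>] by simp
    qed
  qed
  then have "\<forall>lam\<ge>2. L2_operator_norm (T_op m \<gamma> \<psi>\<^sub>0 lam) \<le> ennreal (C * decay_rate m \<gamma> \<alpha> lam)"
    unfolding L2_operator_norm_def by (auto intro!: SUP_least)
  moreover have "C * decay_rate m \<gamma> \<alpha> lam =
      (if m < \<gamma> * \<alpha> - 1/2 then C * lam powr (- (1 / \<gamma>) * (m + 1/2))
       else if m = \<gamma> * \<alpha> - 1/2 then C * lam powr (- \<alpha>) * ln lam
       else C * lam powr (- \<alpha>))" for lam
    by (simp add: decay_rate_def)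
  ultimately show ?thesis using C(1) by auto
qed

end
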